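(* Let $\frac13<\alpha<\frac12$ and $1-\alpha<\beta<2\alpha$, let $T>0$, and let $x:[0,T]\to\mathbb{R}^d$ be Hölder continuous of exponent $\alpha$. Let $A^{ij}(s,t)$, $1\le i,j\le d$, $0\le s\le t\le T$, be real numbers satisfying $A^{ij}(s,u)=A^{ij}(s,t)+A^{ij}(t,u)+(x^i(t)-x^i(s))(x^j(u)-x^j(t))$ for $s\le t\le u$ and, for some constant $c$, $|A^{ij}(s,t)|\le c(t-s)^{2\alpha}$ for all $s\le t$. Suppose moreover that there is a constant $B$ such that $$\Big|\sum_{l=k}^{m-1}A^{ij}(lh,(l+1)h)\Big|\le B(m-k)^\beta h^{2\alpha}$$ whenever $0<k<m$ are integers and $h>0$ is such that $mh\le T$. Let $f=(f^i_j)\in C^\gamma$ where $\gamma>\alpha^{-1}$, let $y_0\in\mathbb{R}^n$, and let $y$ be the solution on $[0,T]$, in the sense defined in the context, of $dy^i=\sum_j f^i_j(y)\,dx^j$, $y(0)=y_0$. For $0<t\le T$ and $K$ a positive integer, let $z_k$ ($0\le k\le K$) be defined by the Euler recurrence relation $$z^i_{k+1}=z^i_k+\sum_j f^i_j(z_k)\,(x^j(t_{k+1})-x^j(t_k)),\qquad z_0=y_0,\quad t_k=kt/K.$$ Then $$|z_K-y(t)|\le C\,t^{2\alpha}K^{\beta-2\alpha},$$ where $C$ is a constant independent of $K$ and $t$.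
   Context: $n,d$ are positive integers. For $\rho=N+\alpha'$ with $N$ a positive integer and $0<\alpha'\le 1$, $C^\rho$ is the set of $f=(f^i_j)_{1\le i\le n,\,1\le j\le d}$ such that each $f^i_j:\mathbb{R}^n\to\mathbb{R}$ has derivatives up to order $N$, all of which satisfy locally a Hölder condition of exponent $\alpha'$. Solution: $y:[0,T]\to\mathbb{R}^n$ is a solution on $[0,T]$ if $y(0)=y_0$ and there exist a continuous increasing function $\tilde\omega$ on $[0,T]$ and a non-negative function $\theta$ on $[0,\infty)$ with $\theta(\delta)=o(\delta)$ as $\delta\to0$ such that for all $i$ and all $0\le s<t\le T$ $$\Big|y^i(t)-y^i(s)-\sum_j f^i_j(y(s))(x^j(t)-x^j(s))-\sum_{h,r,j}f^h_r(y(s))\,\partial_hf^i_j(y(s))\,A^{rj}(s,t)\Big|\le\theta(\tilde\omega(t)-\tilde\omega(s)),$$ where $h$ runs over $1,\dots,n$ and $r,j$ over $1,\dots,d$. (Under the hypotheses a solution on $[0,T]$, if it exists, is unique.) *)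

theory Defs
  imports "HOL-Analysis.Analysis"
begin

definition holder_on :: "real \<Rightarrow> 'a::metric_space set \<Rightarrow> ('a \<Rightarrow> 'b::metric_space) \<Rightarrow> bool" where
  "holder_on a S g \<longleftrightarrow> (\<exists>C. \<forall>u\<in>S. \<forall>v\<in>S. dist (g u) (g v) \<le> C * dist u v powr a)"

definition locally_holder :: "real \<Rightarrow> ('a::metric_space \<Rightarrow> 'b::metric_space) \<Rightarrow> bool" where
  "locally_holder a g \<longleftrightarrow> (\<forall>u. \<exists>e>0. holder_on a (ball u e) g)"

definition partial_deriv :: "'n::finite \<Rightarrow> (real^'n \<Rightarrow> real) \<Rightarrow> real^'n \<Rightarrow> real" where
  "partial_deriv h g v = frechet_derivative g (at v) (axis h 1)"

text \<open>
  Differentiability is required in the Frechet sense. Since all the partial derivatives are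
  required to be locally Hoelder, hence continuous, this is the same as existence of the partial
  derivatives.
\<close>
fun holder_derivs :: "nat \<Rightarrow> real \<Rightarrow> (real^'n::finite \<Rightarrow> real) \<Rightarrow> bool" where
  "holder_derivs 0 a g \<longleftrightarrow> locally_holder a g"
| "holder_derivs (Suc N) a g \<longleftrightarrow>
     locally_holder a g \<and> (\<forall>v. g differentiable (at v)) \<and>
     (\<forall>h. holder_derivs N a (partial_deriv h g))"

text \<open>The component \<open>f\<^sup>i\<^sub>j\<close> of a system of vector fields is written \<open>f i j\<close>.\<close>
definition C_space :: "real \<Rightarrow> ('n::finite \<Rightarrow> 'd::finite \<Rightarrow> real^'n \<Rightarrow> real) set" where
  "C_space \<rho> = {f. \<exists>(N::nat) a. 1 \<le> N \<and> 0 < a \<and> a \<le> 1 \<and> \<rho> = real N + a \<and>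
                     (\<forall>i j. holder_derivs N a (f i j))}"

text \<open>
  ``Increasing'' is read as non-decreasing. The comparison function is defined at \<open>0\<close>, and
  \<open>\<theta>(\<delta>) = o(\<delta>)\<close> as \<open>\<delta> \<rightarrow> 0\<close> in \<open>[0, \<infinity>)\<close> includes \<open>\<theta> 0 = 0\<close>, which the Landau symbol at
  \<open>at_right 0\<close> does not see. For strictly increasing \<open>\<omega>\<close> the value \<open>\<theta> 0\<close> is irrelevant, so
  solutions in the strict sense are covered.
\<close>
definition is_solution ::
  "real \<Rightarrow> (real \<Rightarrow> real^'d::finite) \<Rightarrow> ('d \<Rightarrow> 'd \<Rightarrow> real \<Rightarrow> real \<Rightarrow> real) \<Rightarrow>
   ('n::finite \<Rightarrow> 'd \<Rightarrow> real^'n \<Rightarrow> real) \<Rightarrow> real^'n \<Rightarrow> (real \<Rightarrow> real^'n) \<Rightarrow> bool" where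
  "is_solution T x A f y0 y \<longleftrightarrow>
     y 0 = y0 \<and>
     (\<exists>\<omega> \<theta>. continuous_on {0..T} \<omega> \<and> mono_on {0..T} \<omega> \<and>
        (\<forall>\<delta>\<ge>0. 0 \<le> \<theta> \<delta>) \<and> \<theta> 0 = 0 \<and> \<theta> \<in> o[at_right 0](\<lambda>\<delta>. \<delta>) \<and>
        (\<forall>i s t. 0 \<le> s \<and> s < t \<and> t \<le> T \<longrightarrow>
           \<bar>y t $ i - y s $ i - (\<Sum>j\<in>UNIV. f i j (y s) * (x t $ j - x s $ j))
             - (\<Sum>h\<in>UNIV. \<Sum>r\<in>UNIV. \<Sum>j\<in>UNIV.
                  f h r (y s) * partial_deriv h (f i j) (y s) * A r j s t)\<bar>
           \<le> \<theta> (\<omega> t - \<omega> s :: real)))"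

primrec euler ::
  "(real \<Rightarrow> real^'d::finite) \<Rightarrow> ('n::finite \<Rightarrow> 'd \<Rightarrow> real^'n \<Rightarrow> real) \<Rightarrow> real^'n \<Rightarrow>
   (nat \<Rightarrow> real) \<Rightarrow> nat \<Rightarrow> real^'n" where
  "euler x f y0 \<tau> 0 = y0"
| "euler x f y0 \<tau> (Suc k) =
     (\<chi> i. euler x f y0 \<tau> k $ i
            + (\<Sum>j\<in>UNIV. f i j (euler x f y0 \<tau> k) * (x (\<tau> (Suc k)) $ j - x (\<tau> k) $ j)))"

end

theory Submission
  imports Defs
begin

text \<open>
  Write \<open>F(v)\<xi>\<close> for the vector with components \<open>\<Sum>\<^sub>j f\<^sup>i\<^sub>j(v) \<xi>\<^sub>j\<close> and \<open>G(v)B\<close> for the one with components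
  \<open>\<Sum>\<^sub>h\<^sub>r\<^sub>j f\<^sup>h\<^sub>r(v) \<partial>\<^sub>h f\<^sup>i\<^sub>j(v) B\<^sup>r\<^sup>j\<close>, and let \<open>J(s,t) = y(t) - y(s) - F(y(s)) (x(t) - x(s)) - G(y(s)) A(s,t)\<close>
  be the defect of the second order expansion. By Chen's relation \<open>J(s,u) - J(s,t) - J(t,u)\<close> is of order
  \<open>(u - s)\<^sup>3\<^sup>\<alpha>\<close> with \<open>3\<alpha> > 1\<close>, so repeated bisection bounds \<open>J\<close> itself by that order, both for the
  solution (in the limit of fine grids) and for discrete schemes.

  On the grid of mesh \<open>h\<close> subtract from \<open>A\<close> the sum of its one-step values. The new area still satisfies
  Chen's relation and the \<open>2\<alpha>\<close>-bound, vanishes on single steps, and hence turns the Euler scheme into a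
  second order scheme without one-step defect. It differs from \<open>A\<close> by \<open>O(\<tau>\<^sup>\<beta> h\<^sup>2\<^sup>\<alpha>\<^sup>-\<^sup>\<beta>)\<close> over length \<open>\<tau>\<close>. Bisecting the
  difference of the two defects, where the exponents \<open>(2 + a)\<alpha>\<close> and \<open>\<alpha> + \<beta>\<close> exceed \<open>1\<close> for the
  Hoelder exponent \<open>a\<close> of the second derivatives of \<open>f\<close>, shows that the solution depends Lipschitz continuously on the area, so the error at time \<open>t\<close> is
  \<open>O(t\<^sup>\<beta> h\<^sup>2\<^sup>\<alpha>\<^sup>-\<^sup>\<beta>)\<close>. The argument runs in a ball containing the solution, which the scheme
  cannot leave when \<open>h\<close> is small; for the remaining \<open>h\<close> only boundedly many steps occur.
\<close>

section \<open>Second order expansions along a grid\<close>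

text \<open>In the critical case the second derivatives of \<open>f\<close> are only Hoelder
  continuous, so nothing can be gained by differentiating further. Two trajectories are therefore
  compared through second differences over four points \<open>z\<close>, \<open>z'\<close>,
  \<open>y\<close>, \<open>y'\<close>: such a difference is bounded by the change of the separation
  plus a power of the step times the separation itself. This power is what turns the Hoelder
  exponent \<open>a\<close> into the bisection exponent (2 + a)\<alpha>. The other exponent,
  \<alpha> + \<beta>, arises where a path increment of order t^\<alpha> meets an area change of
  order t^\<beta> h^(2\<alpha> - \<beta>). The one-step mismatch of the two defects fits the same
  scale, because 3\<alpha> = (\<alpha> + \<beta>) + (2\<alpha> - \<beta>). Bisection closes only on
  windows whose length \<delta> is small against the constants, but \<delta> does not depend on h. A
  fixed number of windows covers [0, T], each costing a factor 2. The final rate is the identity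
  (Kh)^\<beta> h^(2\<alpha> - \<beta>) = t^(2\<alpha>) K^(\<beta> - 2\<alpha>) for h = t/K.\<close>

lemma midpoint_induct:
  fixes P :: "nat \<Rightarrow> nat \<Rightarrow> bool"
  assumes "k < m" "a \<le> k" "m \<le> b"
    and base: "\<And>k. a \<le> k \<Longrightarrow> k < b \<Longrightarrow> P k (Suc k)"
    and step: "\<And>k l m. a \<le> k \<Longrightarrow> k < l \<Longrightarrow> l < m \<Longrightarrow> m \<le> b \<Longrightarrow> 3 * (l - k) \<le> 2 * (m - k) \<Longrightarrow>
      3 * (m - l) \<le> 2 * (m - k) \<Longrightarrow> P k l \<Longrightarrow> P l m \<Longrightarrow> P k m"
  shows "P k m"
  using assms(1-3)
proof (induction "m - k" arbitrary: k m rule: less_induct)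
  case less
  show ?case
  proof (cases "m = Suc k")
    case True
    then show ?thesis using base less.prems by auto
  next
    case False
    \<comment> \<open>Rounding spoils exact halves. The worst case is length 3, split as 1 + 2, and
      it dictates the ratio 2/3 used throughout.\<close>
    define l where "l = k + (m - k) div 2"
    have l: "k < l" "l < m" "3 * (l - k) \<le> 2 * (m - k)" "3 * (m - l) \<le> 2 * (m - k)"
      using less.prems False unfolding l_def by auto
    have "P k l" "P l m"
      using less.hyps l less.prems by auto
    then show ?thesis
      using step l less.prems by blast
  qed
qed

lemma grid_split:
  fixes h :: real
  assumes "i < l" "l < j" "3 * (l - i) \<le> 2 * (j - i)" "3 * (j - l) \<le> 2 * (j - i)" "0 < h"
  shows "0 < real (l - i) * h" "0 < real (j - l) * h"
    "real (l - i) * h + real (j - l) * h = real (j - i) * h"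
    "real (l - i) * h \<le> 2/3 * (real (j - i) * h)" "real (j - l) * h \<le> 2/3 * (real (j - i) * h)"
proof -
  show "0 < real (l - i) * h" "0 < real (j - l) * h" using assms by auto
  show "real (l - i) * h + real (j - l) * h = real (j - i) * h"
    using assms by (simp add: of_nat_diff algebra_simps)
  have "real (3 * (l - i)) \<le> real (2 * (j - i))" "real (3 * (j - l)) \<le> real (2 * (j - i))"
    using assms by (simp_all only: of_nat_le_iff)
  then have "3 * real (l - i) \<le> 2 * real (j - i)" "3 * real (j - l) \<le> 2 * real (j - i)"
    by simp_all
  from this[THEN mult_right_mono, of h] assms(5)
  show "real (l - i) * h \<le> 2/3 * (real (j - i) * h)" "real (j - l) * h \<le> 2/3 * (real (j - i) * h)"
    by auto
qed

text \<open>Write r^p as r times r^(p - 1), bound the second factor by (2t/3)^(p - 1), and add. For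
  p > 1 the factor (2/3)^(p - 1) is below 1; the room it leaves pays for the local error of each
  bisection.\<close>

lemma powr_split_le:
  fixes r s t p :: real
  assumes "0 < r" "0 < s" "r \<le> 2/3 * t" "s \<le> 2/3 * t" "r + s = t" "1 \<le> p"
  shows "r powr p + s powr p \<le> (2/3) powr (p - 1) * t powr p"
proof -
  have t: "0 < t" using assms by linarith
  have *: "u powr p \<le> u * ((2/3) powr (p - 1) * t powr (p - 1))" if "0 < u" "u \<le> 2/3 * t" for u
  proof -
    have "u powr p = u * u powr (p - 1)"
      using powr_add[of u 1 "p - 1"] that by simp
    also have "\<dots> \<le> u * (2/3 * t) powr (p - 1)"
      using that assms by (intro mult_left_mono powr_mono2) auto
    finally show ?thesis using t powr_mult[of "2/3" t "p - 1"] by simp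
  qed
  have "r powr p + s powr p \<le> (r + s) * ((2/3) powr (p - 1) * t powr (p - 1))"
    unfolding distrib_right using assms by (intro add_mono *)
  also have "\<dots> = (2/3) powr (p - 1) * t powr p"
    using powr_add[of t 1 "p - 1"] t assms by simp
  finally show ?thesis .
qed

lemma powr_cube: "0 \<le> u \<Longrightarrow> ((u::real) powr r)^3 = u powr (3 * r)"
  by (cases "u = 0") (simp_all add: powr_power mult.commute)

section \<open>Abstract vector fields and the defect of one trajectory\<close>

text \<open>The grid arguments use only linearity and inequalities on \<open>S\<close>, so they
  never touch coordinates. \<open>DF u w\<close> plays the derivative of \<open>F\<close> at
  \<open>u\<close> in direction \<open>w\<close>, and \<open>G_tens\<close> identifies
  \<open>G\<close> on a rank one area with the first order change of \<open>F\<close> along its own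
  flow. \<open>F_four\<close> carries \<epsilon>^(1 + a) and \<open>G_four\<close> only
  \<epsilon>^a, since the former is multiplied by a path increment and the latter by an area, which
  has twice the order. The single constant \<open>C\<close> also bounds the path and the areas in
  the lemmas of this context.\<close>

locale rough_field =
  fixes S :: "'e::real_normed_vector set"
    and F :: "'e \<Rightarrow> 'x::real_normed_vector \<Rightarrow> 'e"
    and DF :: "'e \<Rightarrow> 'e \<Rightarrow> 'x \<Rightarrow> 'e"
    and G :: "'e \<Rightarrow> 'a::real_normed_vector \<Rightarrow> 'e"
    and tens :: "'x \<Rightarrow> 'x \<Rightarrow> 'a"
    and C a :: real
  assumes linear_F: "linear (F u)"
    and linear_DF: "linear (\<lambda>w. DF u w \<xi>)"
    and linear_G: "linear (G u)"
    and G_tens: "G u (tens \<xi> \<eta>) = DF u (F u \<xi>) \<eta>"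
    and C_ge_1: "1 \<le> C" and a_pos: "0 < a" and a_le_1: "a \<le> 1"
    and F_bound: "u \<in> S \<Longrightarrow> norm (F u \<xi>) \<le> C * norm \<xi>"
    and F_lip: "u \<in> S \<Longrightarrow> v \<in> S \<Longrightarrow> norm (F u \<xi> - F v \<xi>) \<le> C * norm (u - v) * norm \<xi>"
    and DF_bound: "u \<in> S \<Longrightarrow> norm (DF u w \<xi>) \<le> C * norm w * norm \<xi>"
    and DF_lip: "u \<in> S \<Longrightarrow> v \<in> S \<Longrightarrow>
      norm (DF u w \<xi> - DF v w \<xi>) \<le> C * norm (u - v) * norm w * norm \<xi>"
    and G_bound: "u \<in> S \<Longrightarrow> norm (G u B) \<le> C * norm B"
    and G_lip: "u \<in> S \<Longrightarrow> v \<in> S \<Longrightarrow> norm (G u B - G v B) \<le> C * norm (u - v) * norm B"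
    and F_taylor: "u \<in> S \<Longrightarrow> v \<in> S \<Longrightarrow>
      norm (F v \<xi> - F u \<xi> - DF u (v - u) \<xi>) \<le> C * (norm (v - u))\<^sup>2 * norm \<xi>"
    and F_four: "z \<in> S \<Longrightarrow> z' \<in> S \<Longrightarrow> y \<in> S \<Longrightarrow> y' \<in> S \<Longrightarrow> norm (z' - z) \<le> \<epsilon> \<Longrightarrow>
      norm (y' - y) \<le> \<epsilon> \<Longrightarrow> \<epsilon> \<le> 1 \<Longrightarrow>
      norm ((F z' \<xi> - F z \<xi> - DF z (z' - z) \<xi>) - (F y' \<xi> - F y \<xi> - DF y (y' - y) \<xi>))
        \<le> C * (\<epsilon> * norm ((z' - y') - (z - y)) + \<epsilon> powr (1 + a) * norm (z - y)) * norm \<xi>"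
    and G_four: "z \<in> S \<Longrightarrow> z' \<in> S \<Longrightarrow> y \<in> S \<Longrightarrow> y' \<in> S \<Longrightarrow> norm (z' - z) \<le> \<epsilon> \<Longrightarrow>
      norm (y' - y) \<le> \<epsilon> \<Longrightarrow> \<epsilon> \<le> 1 \<Longrightarrow>
      norm ((G z' B - G z B) - (G y' B - G y B))
        \<le> C * (norm ((z' - y') - (z - y)) + \<epsilon> powr a * norm (z - y)) * norm B"
begin

definition J :: "('i \<Rightarrow> 'e) \<Rightarrow> ('i \<Rightarrow> 'x) \<Rightarrow> ('i \<Rightarrow> 'i \<Rightarrow> 'a) \<Rightarrow> 'i \<Rightarrow> 'i \<Rightarrow> 'e" where
  "J y x A k m = y m - y k - F (y k) (x m - x k) - G (y k) (A k m)"

text \<open>Through \<open>G_tens\<close> the tensor term of Chen's relation becomes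
  \<open>DF (y k) (F (y k) (x l - x k)) (x m - x l)\<close>, which cancels the leading change of
  \<open>F\<close> between \<open>y k\<close> and \<open>y l\<close>. What survives is a Taylor
  remainder, \<open>DF\<close> applied to the part of \<open>y l - y k\<close> beyond first order,
  and the change of \<open>G\<close>. All three are of third order once \<open>J\<close> over the
  left piece is small.\<close>

lemma J_defect:
  assumes "A k m = A k l + A l m + tens (x l - x k) (x m - x l)"
  shows "J y x A k m - J y x A k l - J y x A l m =
    (F (y l) (x m - x l) - F (y k) (x m - x l) - DF (y k) (y l - y k) (x m - x l))
    + DF (y k) (J y x A k l + G (y k) (A k l)) (x m - x l)
    + (G (y l) (A l m) - G (y k) (A l m))"
proof -
  have 1: "F (y k) (x m - x k) = F (y k) (x m - x l) + F (y k) (x l - x k)"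
    using linear_add[OF linear_F, of "y k" "x m - x l" "x l - x k"] by simp
  have 2: "G (y k) (A k m) = G (y k) (A k l) + G (y k) (A l m) + DF (y k) (F (y k) (x l - x k)) (x m - x l)"
    unfolding assms G_tens[symmetric] by (simp add: linear_add[OF linear_G])
  have "J y x A k l + G (y k) (A k l) = (y l - y k) - F (y k) (x l - x k)"
    by (simp add: J_def)
  then have 3: "DF (y k) (J y x A k l + G (y k) (A k l)) (x m - x l)
      = DF (y k) (y l - y k) (x m - x l) - DF (y k) (F (y k) (x l - x k)) (x m - x l)"
    using linear_diff[OF linear_DF] by metis
  show ?thesis
    unfolding 3 unfolding J_def 1 2 by (simp add: algebra_simps)
qed

text \<open>Here \<open>e\<close> stands for the length of the interval to the power \<alpha>. As e
  \<le> 1, the area term of order e^2 is absorbed by the path term, whence the factor 2.\<close>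

lemma increment_le:
  assumes "y k \<in> S" "norm (x m - x k) \<le> C * e" "norm (A k m) \<le> C * e\<^sup>2" "0 \<le> e" "e \<le> 1"
  shows "norm (y m - y k) \<le> norm (J y x A k m) + 2 * C\<^sup>2 * e"
proof -
  have "y m - y k = J y x A k m + F (y k) (x m - x k) + G (y k) (A k m)"
    by (simp add: J_def)
  then have "norm (y m - y k) \<le> norm (J y x A k m) + norm (F (y k) (x m - x k)) + norm (G (y k) (A k m))"
    by (metis norm_triangle_ineq norm_triangle_le add_right_mono)
  moreover have "norm (F (y k) (x m - x k)) \<le> C * (C * e)"
    using F_bound[OF assms(1)] assms(2) C_ge_1 by (meson mult_left_mono order_trans zero_le_one)
  moreover have "norm (G (y k) (A k m)) \<le> C * (C * e\<^sup>2)"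
    using G_bound[OF assms(1)] assms(3) C_ge_1 by (meson mult_left_mono order_trans zero_le_one)
  moreover have "C * (C * e\<^sup>2) \<le> C * (C * e)"
    using assms C_ge_1 by (intro mult_left_mono) (auto simp: power2_eq_square mult_left_le)
  ultimately show ?thesis by (simp add: power2_eq_square)
qed

text \<open>The bound assumed on the left piece is deliberately crude: e^2 + 2\<epsilon> in place of
  a multiple of e^3. This keeps 23 C^6 and 12 C^2 free of the constant that the bisection has to
  produce, so that no circle arises. In use, \<epsilon> is the amount of one-step defects collected
  on the left piece.\<close>

lemma J_step:
  assumes chen: "A k m = A k l + A l m + tens (x l - x k) (x m - x l)"
    and S: "y k \<in> S" "y l \<in> S"
    and x: "norm (x l - x k) \<le> C * e" "norm (x m - x l) \<le> C * e"
    and A: "norm (A k l) \<le> C * e\<^sup>2" "norm (A l m) \<le> C * e\<^sup>2"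
    and e: "0 \<le> e" "e \<le> 1" and \<epsilon>: "0 \<le> \<epsilon>" "\<epsilon> \<le> 1"
    and Jkl: "norm (J y x A k l) \<le> e\<^sup>2 + 2 * \<epsilon>"
  shows "norm (J y x A k m) \<le> norm (J y x A k l) + norm (J y x A l m)
    + 23 * C^6 * e^3 + 12 * C\<^sup>2 * (e * \<epsilon>)"
proof -
  note C = C_ge_1
  have C0: "0 \<le> C" using C by linarith
  have CC: "1 \<le> C^2" "C^2 \<le> C^4" "C^4 \<le> C^6" 
    using C by (auto intro: power_increasing one_le_power)
  define \<xi> where "\<xi> = x m - x l"
  have e2: "e\<^sup>2 \<le> e" using e by (simp add: power2_eq_square mult_left_le)
  have \<epsilon>2: "\<epsilon>\<^sup>2 \<le> \<epsilon>" using \<epsilon> by (simp add: power2_eq_square mult_left_le)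
  have e\<epsilon>: "e\<^sup>2 * \<epsilon> \<le> e * \<epsilon>" using e2 \<epsilon> by (intro mult_right_mono)
  define d where "d = norm (y l - y k)"
  have d0: "0 \<le> d" by (simp add: d_def)
  have "d \<le> norm (J y x A k l) + 2 * C\<^sup>2 * e"
    unfolding d_def by (rule increment_le[where y = y and x = x and A = A, OF S(1) x(1) A(1) e])
  also have "\<dots> \<le> e + 2 * \<epsilon> + 2 * C\<^sup>2 * e" using Jkl e2 by linarith
  also have "\<dots> \<le> 3 * C\<^sup>2 * e + 2 * \<epsilon>"
    using mult_right_mono[OF CC(1) e(1)] by (simp add: algebra_simps)
  finally have d: "d \<le> 3 * C\<^sup>2 * e + 2 * \<epsilon>" .
  have "d\<^sup>2 \<le> (3 * C\<^sup>2 * e + 2 * \<epsilon>)\<^sup>2" using d d0 by (rule power_mono)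
  also have "\<dots> \<le> 2 * (3 * C\<^sup>2 * e)\<^sup>2 + 2 * (2 * \<epsilon>)\<^sup>2"
    using zero_le_power2[of "3 * C\<^sup>2 * e - 2 * \<epsilon>"] by (simp add: power2_eq_square algebra_simps)
  also have "\<dots> = 18 * C^4 * e\<^sup>2 + 8 * \<epsilon>\<^sup>2"
    by (simp add: power_mult_distrib)
  finally have d2: "d\<^sup>2 \<le> 18 * C^4 * e\<^sup>2 + 8 * \<epsilon>" using \<epsilon>2 by linarith
  have T1: "norm (F (y l) \<xi> - F (y k) \<xi> - DF (y k) (y l - y k) \<xi>) \<le> C * d\<^sup>2 * norm \<xi>"
    unfolding d_def by (rule F_taylor[OF S])
  have "norm (J y x A k l + G (y k) (A k l)) \<le> norm (J y x A k l) + C * norm (A k l)"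
    using G_bound[OF S(1)] norm_triangle_ineq by (meson add_left_mono order_trans)
  also have "\<dots> \<le> (e\<^sup>2 + 2 * \<epsilon>) + C * (C * e\<^sup>2)"
    using Jkl A(1) C0 by (intro add_mono mult_left_mono)
  finally have g: "norm (J y x A k l + G (y k) (A k l)) \<le> (e\<^sup>2 + 2 * \<epsilon>) + C * (C * e\<^sup>2)" .
  have T2: "norm (DF (y k) (J y x A k l + G (y k) (A k l)) \<xi>) \<le> C * ((e\<^sup>2 + 2 * \<epsilon>) + C * (C * e\<^sup>2)) * norm \<xi>"
    by (rule order_trans[OF DF_bound[OF S(1)]]) (intro mult_right_mono mult_left_mono g C0; simp)
  have "C * d\<^sup>2 * norm \<xi> + C * ((e\<^sup>2 + 2 * \<epsilon>) + C * (C * e\<^sup>2)) * norm \<xi>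
      = (d\<^sup>2 + (e\<^sup>2 + 2 * \<epsilon>) + C\<^sup>2 * e\<^sup>2) * (C * norm \<xi>)"
    by (simp add: algebra_simps power2_eq_square)
  \<comment> \<open>The coefficients are 18 + 1 + 1 and 8 + 2, from the squared increment, the crude
    bound on \<open>J\<close> and the area.\<close>
  also have "\<dots> \<le> (20 * C^4 * e\<^sup>2 + 10 * \<epsilon>) * (C * (C * e))"
  proof (rule mult_mono)
    have "C\<^sup>2 * e\<^sup>2 \<le> C^4 * e\<^sup>2" "1 * e\<^sup>2 \<le> C^4 * e\<^sup>2" using mult_right_mono[OF CC(2), of "e\<^sup>2"] mult_right_mono[OF order_trans[OF CC(1,2)], of "e\<^sup>2"] by auto
    then show "d\<^sup>2 + (e\<^sup>2 + 2 * \<epsilon>) + C\<^sup>2 * e\<^sup>2 \<le> 20 * C^4 * e\<^sup>2 + 10 * \<epsilon>"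
      using d2 by linarith
    show "C * norm \<xi> \<le> C * (C * e)" using x(2) C0 unfolding \<xi>_def by (rule mult_left_mono)
    show "0 \<le> 20 * C^4 * e\<^sup>2 + 10 * \<epsilon>" using \<epsilon> by simp
    show "0 \<le> C * norm \<xi>" using C0 by simp
  qed
  also have "\<dots> = 20 * C^6 * e^3 + 10 * C\<^sup>2 * (e * \<epsilon>)"
    by (simp add: algebra_simps power2_eq_square power3_eq_cube eval_nat_numeral)
  finally have T12: "C * d\<^sup>2 * norm \<xi> + C * ((e\<^sup>2 + 2 * \<epsilon>) + C * (C * e\<^sup>2)) * norm \<xi>
      \<le> 20 * C^6 * e^3 + 10 * C\<^sup>2 * (e * \<epsilon>)" .
  have "norm (G (y l) (A l m) - G (y k) (A l m)) \<le> C * d * norm (A l m)"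
    unfolding d_def by (rule G_lip[OF S(2,1)])
  also have "\<dots> \<le> C * (3 * C\<^sup>2 * e + 2 * \<epsilon>) * (C * e\<^sup>2)"
    using d A(2) C0 d0 e \<epsilon> by (intro mult_mono) auto
  also have "\<dots> = 3 * C^4 * e^3 + 2 * C\<^sup>2 * (e\<^sup>2 * \<epsilon>)"
    by (simp add: algebra_simps power2_eq_square power3_eq_cube eval_nat_numeral)
  also have "\<dots> \<le> 3 * C^6 * e^3 + 2 * C\<^sup>2 * (e * \<epsilon>)"
    using CC e e2 \<epsilon> e\<epsilon> by (intro add_mono mult_right_mono mult_left_mono) auto
  finally have T3: "norm (G (y l) (A l m) - G (y k) (A l m)) \<le> 3 * C^6 * e^3 + 2 * C\<^sup>2 * (e * \<epsilon>)" .
  have "norm (J y x A k m - J y x A k l - J y x A l m) \<le>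
     norm (F (y l) \<xi> - F (y k) \<xi> - DF (y k) (y l - y k) \<xi>)
     + norm (DF (y k) (J y x A k l + G (y k) (A k l)) \<xi>) + norm (G (y l) (A l m) - G (y k) (A l m))"
    unfolding J_defect[OF chen] \<xi>_def[symmetric] by (intro order_trans[OF norm_triangle_ineq] add_right_mono norm_triangle_ineq)
  also have "\<dots> \<le> 23 * C^6 * e^3 + 12 * C\<^sup>2 * (e * \<epsilon>)"
    using T1 T2 T12 T3 by linarith
  finally have "norm (J y x A k m - J y x A k l - J y x A l m) \<le> 23 * C^6 * e^3 + 12 * C\<^sup>2 * (e * \<epsilon>)" .
  moreover have "norm (J y x A k m) \<le> norm (J y x A k m - J y x A k l - J y x A l m) + norm (J y x A k l) + norm (J y x A l m)"
    using norm_triangle_ineq[of "J y x A k m - J y x A k l - J y x A l m" "J y x A k l + J y x A l m"]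
      norm_triangle_ineq[of "J y x A k l" "J y x A l m"] by simp
  ultimately show ?thesis by linarith
qed

text \<open>The increments of \<open>E\<close> absorb the one-step defects: they are \<open>\<epsilon>\<close> times those of \<open>\<omega>\<close> for a
  solution sampled on a fine grid, and zero for the Euler scheme.\<close>
lemma local_expansion:
  fixes y :: "nat \<Rightarrow> 'e" and x :: "nat \<Rightarrow> 'x" and A :: "nat \<Rightarrow> nat \<Rightarrow> 'a" and E :: "nat \<Rightarrow> real"
  assumes \<alpha>: "1/3 < \<alpha>" and h: "0 < h"
    and S: "\<And>k. k \<le> M \<Longrightarrow> y k \<in> S"
    and chen: "\<And>k l m. k \<le> l \<Longrightarrow> l \<le> m \<Longrightarrow> m \<le> M \<Longrightarrow> A k m = A k l + A l m + tens (x l - x k) (x m - x l)"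
    and x: "\<And>k m. k < m \<Longrightarrow> m \<le> M \<Longrightarrow> norm (x m - x k) \<le> C * (real (m - k) * h) powr \<alpha>"
    and A: "\<And>k m. k < m \<Longrightarrow> m \<le> M \<Longrightarrow> norm (A k m) \<le> C * ((real (m - k) * h) powr \<alpha>)\<^sup>2"
    and E: "\<And>k. k < M \<Longrightarrow> norm (J y x A k (Suc k)) \<le> E (Suc k) - E k" and E_le: "E M - E 0 \<le> 1"
    and L: "23 * C^6 \<le> L * (1 - (2/3) powr (3 * \<alpha> - 1))"
    and N: "12 * C\<^sup>2 \<le> N * (1 - (2/3) powr \<alpha>)"
    and \<delta>: "0 \<le> \<delta>" "\<delta> \<le> 1" "L * \<delta> powr \<alpha> \<le> 1" "N * \<delta> powr \<alpha> \<le> 1"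
    and km: "k < m" "m \<le> M" "real (m - k) * h \<le> \<delta>"
  shows "norm (J y x A k m) \<le> L * ((real (m - k) * h) powr \<alpha>)^3
           + (1 + N * (real (m - k) * h) powr \<alpha>) * (E m - E k)"
proof -
  define e where "e = (\<lambda>k m. (real (m - k) * h) powr \<alpha>)"
  define \<kappa> where "\<kappa> = (2/3::real) powr (3 * \<alpha> - 1)"
  define \<mu> where "\<mu> = (2/3::real) powr \<alpha>"
  have \<kappa>\<mu>: "\<kappa> < 1" "\<mu> < 1" "0 < \<mu>" 
    unfolding \<kappa>_def \<mu>_def using \<alpha> powr_less_mono2[of \<alpha> "2/3" 1] powr_less_mono2[of "3*\<alpha>-1" "2/3" 1] by auto
  have C0: "0 \<le> C" using C_ge_1 by simp
  have L0: "0 \<le> L"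
  proof (rule ccontr)
    assume "\<not> 0 \<le> L"
    then have "L * (1 - \<kappa>) < 0" using \<kappa>\<mu> by (simp add: mult_neg_pos)
    moreover have "0 \<le> 23 * C^6" using C0 by simp
    ultimately show False using L[folded \<kappa>_def] by linarith
  qed
  have N0: "0 \<le> N"
  proof (rule ccontr)
    assume "\<not> 0 \<le> N"
    then have "N * (1 - \<mu>) < 0" using \<kappa>\<mu> by (simp add: mult_neg_pos)
    moreover have "0 \<le> 12 * C\<^sup>2" using C0 by simp
    ultimately show False using N[folded \<mu>_def] by linarith
  qed
  have Emono: "E k \<le> E m" if "k \<le> m" "m \<le> M" for k m
    using that
  proof (induction m rule: dec_induct)
    case (step n)
    then have "E n \<le> E (Suc n)" using E[of n] norm_ge_zero[of "J y x A n (Suc n)"] by linarith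
    then show ?case using step by simp
  qed simp
  have e\<delta>: "e i j \<le> \<delta> powr \<alpha>" if "real (j - i) * h \<le> \<delta>" for i j
    unfolding e_def using that \<alpha> h by (intro powr_mono2) auto
  \<comment> \<open>The factor 1 + N e is a weight that grows with the interval. On the two pieces
    \<open>e\<close> is at most \<mu> times its value on the whole, so the weight rises by at least
    N (1 - \<mu>) e, which pays for the mixed error 12 C^2 e \<epsilon>. In the same way L (1 -
    \<kappa>) pays for the cubic error.\<close>
  have "norm (J y x A k m) \<le> L * (e k m)^3 + (1 + N * e k m) * (E m - E k)"
  proof (rule midpoint_induct[where P = "\<lambda>i j. norm (J y x A i j) \<le> L * (e i j)^3 + (1 + N * e i j) * (E j - E i)",
        OF km(1) order_refl order_refl])
    fix i assume "k \<le> i" "i < m"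
    then have i: "i < M" using km by simp
    have "1 * (E (Suc i) - E i) \<le> (1 + N * e i (Suc i)) * (E (Suc i) - E i)"
      using N0 Emono[of i "Suc i"] i by (intro mult_right_mono) (auto simp: e_def)
    moreover have "0 \<le> L * (e i (Suc i))^3" using L0 by (simp add: e_def)
    ultimately show "norm (J y x A i (Suc i)) \<le> L * (e i (Suc i))^3 + (1 + N * e i (Suc i)) * (E (Suc i) - E i)"
      using E[OF i] add_increasing by (metis mult_1 order_trans)
  next
    fix i l j
    assume 2: "k \<le> i" "i < l" "l < j" "j \<le> m" "3 * (l - i) \<le> 2 * (j - i)" "3 * (j - l) \<le> 2 * (j - i)"
      "norm (J y x A i l) \<le> L * (e i l)^3 + (1 + N * e i l) * (E l - E i)"
      "norm (J y x A l j) \<le> L * (e l j)^3 + (1 + N * e l j) * (E j - E l)"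
    have jM: "j \<le> M" using 2 km by simp
    define r where "r = real (l - i) * h"
    define s where "s = real (j - l) * h"
    define t where "t = real (j - i) * h"
    have rst: "0 < r" "0 < s" "r + s = t" "r \<le> 2/3 * t" "s \<le> 2/3 * t"
      unfolding r_def s_def t_def by (fact grid_split[OF 2(2,3,5,6) h])+
    have t\<delta>: "t \<le> \<delta>"
    proof -
      have "t \<le> real (m - k) * h" unfolding t_def using 2 h by (intro mult_right_mono) auto
      then show ?thesis using km by simp
    qed
    define e' where "e' = e i j"
    have e'_eq: "e' = t powr \<alpha>" by (simp add: e'_def e_def t_def)
    have \<delta>\<alpha>: "\<delta> powr \<alpha> \<le> 1" using \<delta> \<alpha> powr_mono2[of \<alpha> \<delta> 1] by simp
    have e'\<delta>: "e' \<le> \<delta> powr \<alpha>" unfolding e'_def using t\<delta> e\<delta> by (simp add: t_def)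
    have e': "0 \<le> e'" "e' \<le> 1" "L * e' \<le> 1" "N * e' \<le> 1"
      using e'\<delta> \<delta>\<alpha> mult_left_mono[OF e'\<delta> L0] mult_left_mono[OF e'\<delta> N0] \<delta> by (auto simp: e'_def e_def)
    have el: "e i l \<le> \<mu> * e'" "e l j \<le> \<mu> * e'"
    proof -
      have "u powr \<alpha> \<le> \<mu> * t powr \<alpha>" if "0 < u" "u \<le> 2/3 * t" for u
        using powr_mono2[of \<alpha> u "2/3 * t"] that powr_mult[of "2/3" t \<alpha>] \<alpha> rst by (simp add: \<mu>_def)
      from this[OF rst(1,4)] this[OF rst(2,5)] show "e i l \<le> \<mu> * e'" "e l j \<le> \<mu> * e'"
        unfolding e_def e'_eq r_def s_def by simp_all
    qed
    have \<mu>e: "\<mu> * e' \<le> e'" using \<kappa>\<mu> e' by (simp add: mult_left_le_one_le)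
    have el': "e i l \<le> e'" "e l j \<le> e'" using el \<mu>e by auto
    have e0: "0 \<le> e i l" "0 \<le> e l j" by (auto simp: e_def)
    have cubes: "(e i l)^3 + (e l j)^3 \<le> \<kappa> * e'^3"
    proof -
      have "r powr (3 * \<alpha>) + s powr (3 * \<alpha>) \<le> \<kappa> * t powr (3 * \<alpha>)"
        unfolding \<kappa>_def using rst \<alpha> by (intro powr_split_le) auto
      moreover have "0 \<le> r" "0 \<le> s" "0 \<le> t" using rst by auto
      ultimately have "(r powr \<alpha>)^3 + (s powr \<alpha>)^3 \<le> \<kappa> * (t powr \<alpha>)^3"
        by (simp only: powr_cube)
      then show ?thesis unfolding e_def e'_eq r_def s_def .
    qed
    define \<epsilon> where "\<epsilon> = E l - E i"
    have \<epsilon>: "0 \<le> \<epsilon>" "\<epsilon> \<le> 1" "E l \<le> E j"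
      using Emono[of i l] Emono[of 0 i] Emono[of l M] Emono[of l j] E_le 2 jM by (auto simp: \<epsilon>_def)
    have sq: "e'^3 = e' * e'\<^sup>2" by (simp add: power2_eq_square power3_eq_cube)
    have J1: "norm (J y x A i l) \<le> L * (e i l)^3 + (1 + N * e i l) * \<epsilon>"
      using 2 by (simp add: \<epsilon>_def)
    \<comment> \<open>Here the smallness of \<delta> enters: L e \<le> 1 and N e \<le> 1 reduce the
      induction hypothesis to the crude form that \<open>J_step\<close> expects.\<close>
    also have "\<dots> \<le> e'\<^sup>2 + 2 * \<epsilon>"
    proof (rule add_mono)
      have "L * (e i l)^3 \<le> L * e'^3" using L0 e0 el' by (intro mult_left_mono power_mono)
      also have "\<dots> \<le> 1 * e'\<^sup>2" unfolding sq mult.assoc[symmetric] using e' by (intro mult_right_mono) auto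
      finally show "L * (e i l)^3 \<le> e'\<^sup>2" by simp
      have "N * e i l \<le> 1" using mult_left_mono[OF el'(1) N0] e' by linarith
      then show "(1 + N * e i l) * \<epsilon> \<le> 2 * \<epsilon>" using \<epsilon> by (intro mult_right_mono) auto
    qed
    finally have Jil: "norm (J y x A i l) \<le> e'\<^sup>2 + 2 * \<epsilon>" .
    have "norm (J y x A i j) \<le> norm (J y x A i l) + norm (J y x A l j)
      + 23 * C^6 * e'^3 + 12 * C\<^sup>2 * (e' * \<epsilon>)"
    proof (rule J_step)
      show "A i j = A i l + A l j + tens (x l - x i) (x j - x l)" using chen 2 jM by simp
      show "norm (x l - x i) \<le> C * e'" "norm (x j - x l) \<le> C * e'"
        using x[of i l] x[of l j] 2 jM mult_left_mono[OF el'(1) C0] mult_left_mono[OF el'(2) C0]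
        by (auto simp: e_def)
      show "norm (A i l) \<le> C * e'\<^sup>2" "norm (A l j) \<le> C * e'\<^sup>2"
        using A[of i l] A[of l j] 2 jM mult_left_mono[OF power_mono[OF el'(1) e0(1), of 2] C0]
          mult_left_mono[OF power_mono[OF el'(2) e0(2), of 2] C0]
        by (auto simp: e_def)
    qed (use 2 jM S e' \<epsilon> Jil in auto)
    also have "\<dots> \<le> (L * (e i l)^3 + (1 + N * e i l) * \<epsilon>) + (L * (e l j)^3 + (1 + N * e l j) * (E j - E l))
      + 23 * C^6 * e'^3 + 12 * C\<^sup>2 * (e' * \<epsilon>)"
      using 2(8) J1 by simp
    also have "\<dots> \<le> L * e'^3 + (1 + N * e') * (E j - E i)"
    proof -
      have "(1 + N * e i l) * \<epsilon> \<le> (1 + N * (\<mu> * e')) * \<epsilon>"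
        using N0 el \<epsilon> by (intro mult_right_mono add_left_mono mult_left_mono) auto
      moreover have "(1 + N * e l j) * (E j - E l) \<le> (1 + N * (\<mu> * e')) * (E j - E l)"
        using N0 el \<epsilon> by (intro mult_right_mono add_left_mono mult_left_mono) auto
      moreover have "12 * C\<^sup>2 * (e' * \<epsilon>) \<le> N * (1 - \<mu>) * (e' * (E j - E i))"
        using e' \<epsilon> \<kappa>\<mu> N0 by (intro mult_mono[OF N[folded \<mu>_def]] mult_left_mono) (auto simp: \<epsilon>_def)
      moreover have "(1 + N * (\<mu> * e')) * \<epsilon> + (1 + N * (\<mu> * e')) * (E j - E l)
          + N * (1 - \<mu>) * (e' * (E j - E i)) = (1 + N * e') * (E j - E i)"
        by (simp add: \<epsilon>_def algebra_simps)
      moreover have "L * (e i l)^3 + L * (e l j)^3 + 23 * C^6 * e'^3 \<le> L * e'^3"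
      proof -
        have "L * ((e i l)^3 + (e l j)^3) \<le> L * (\<kappa> * e'^3)" using cubes L0 by (rule mult_left_mono)
        moreover have "23 * C^6 * e'^3 \<le> L * (1 - \<kappa>) * e'^3"
          using L e' by (intro mult_right_mono) (auto simp: \<kappa>_def)
        ultimately show ?thesis by (simp add: algebra_simps)
      qed
      ultimately show ?thesis by linarith
    qed
    finally show "norm (J y x A i j) \<le> L * (e i j)^3 + (1 + N * e i j) * (E j - E i)" by (simp add: e'_def)
  qed
  then show ?thesis by (simp add: e_def)
qed

section \<open>One bisection step for a pair of trajectories\<close>

lemma G_apply_diff:
  assumes S: "u \<in> S" "u' \<in> S" and W: "norm W' \<le> C * e\<^sup>2" "norm (W' - W) \<le> s"
    and v: "norm (u' - u) \<le> v"
  shows "norm (G u' W' - G u W) \<le> C * v * (C * e\<^sup>2) + C * s"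
proof -
  have C0: "0 \<le> C" using C_ge_1 by simp
  have v0: "0 \<le> v" using v norm_ge_zero order_trans by blast
  have "G u' W' - G u W = (G u' W' - G u W') + G u (W' - W)"
    by (simp add: linear_diff[OF linear_G])
  moreover have "norm (G u' W' - G u W') \<le> C * v * (C * e\<^sup>2)"
    using W(1) v C0 v0 by (intro order_trans[OF G_lip[OF S(2,1)]] mult_mono mult_left_mono) auto
  moreover have "norm (G u (W' - W)) \<le> C * s"
    using W(2) C0 by (intro order_trans[OF G_bound[OF S(1)]] mult_left_mono)
  ultimately show ?thesis by (metis add_mono norm_triangle_le)
qed

text \<open>The separation of the trajectories changes through three sources: the difference of the
  defects, the fields evaluated at points at distance \<open>v\<close>, and the difference
  \<open>s\<close> of the areas.\<close>

lemma increment_diff_le: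
  assumes S: "Y k \<in> S" "Z k \<in> S" and x: "norm (x l - x k) \<le> C * e"
    and A: "norm (A' k l) \<le> C * e\<^sup>2" "norm (A' k l - A k l) \<le> s"
    and v: "norm (Z k - Y k) \<le> v" and e: "0 \<le> e" "e \<le> 1"
  shows "norm ((Z l - Y l) - (Z k - Y k)) \<le> norm (J Z x A' k l - J Y x A k l) + 2 * C\<^sup>2 * v * e + C * s"
proof -
  have C0: "0 \<le> C" using C_ge_1 by simp
  have v0: "0 \<le> v" using v norm_ge_zero order_trans by blast
  have e2: "e\<^sup>2 \<le> e" using e by (simp add: power2_eq_square mult_left_le)
  have "(Z l - Y l) - (Z k - Y k) = (J Z x A' k l - J Y x A k l)
      + (F (Z k) (x l - x k) - F (Y k) (x l - x k)) + (G (Z k) (A' k l) - G (Y k) (A k l))"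
    by (simp add: J_def)
  moreover have "norm (F (Z k) (x l - x k) - F (Y k) (x l - x k)) \<le> C * v * (C * e)"
    using x v C0 v0 by (intro order_trans[OF F_lip[OF S(2,1)]] mult_mono mult_left_mono) auto
  moreover have "norm (G (Z k) (A' k l) - G (Y k) (A k l)) \<le> C * v * (C * e\<^sup>2) + C * s"
    by (rule G_apply_diff[OF S A v])
  ultimately have "norm ((Z l - Y l) - (Z k - Y k))
      \<le> norm (J Z x A' k l - J Y x A k l) + C * v * (C * e) + (C * v * (C * e\<^sup>2) + C * s)"
    by (smt (verit) norm_triangle_ineq)
  moreover have "C * v * (C * e\<^sup>2) \<le> C * v * (C * e)"
    using e2 C0 v0 by (intro mult_left_mono) auto
  ultimately show ?thesis by (simp add: power2_eq_square algebra_simps)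
qed

text \<open>Two instances of \<open>J_defect\<close> are subtracted, and every term is arranged to
  contain the difference \<open>D\<close> on the left piece, the separation \<open>v\<close> at its
  left end, or the area difference \<open>s\<close>. The defects enter as \<open>DF (Z k)\<close> of
  \<open>D k l\<close> plus the change of \<open>DF\<close> applied to \<open>J Y\<close>, so the
  third order bound is asked of \<open>Y\<close>, while \<open>Z\<close> enters through its
  increments and its separation from \<open>Y\<close>. The exponent 2 + a combines \<epsilon>^(1 +
  a) with a path increment, or \<epsilon>^a with an area; terms of order e^3 and e^4 are absorbed
  because e \<le> 1 and a \<le> 1.\<close>

lemma J_diff_step:
  fixes Y Z :: "nat \<Rightarrow> 'e" and x :: "nat \<Rightarrow> 'x" and A A' :: "nat \<Rightarrow> nat \<Rightarrow> 'a"
  defines "D \<equiv> \<lambda>i j. J Z x A' i j - J Y x A i j"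
  assumes chen: "A k m = A k l + A l m + tens (x l - x k) (x m - x l)"
    and chen': "A' k m = A' k l + A' l m + tens (x l - x k) (x m - x l)"
    and S: "Y k \<in> S" "Y l \<in> S" "Z k \<in> S" "Z l \<in> S"
    and x: "norm (x l - x k) \<le> C * e" "norm (x m - x l) \<le> C * e"
    and A: "norm (A k l) \<le> C * e\<^sup>2" "norm (A l m) \<le> C * e\<^sup>2"
    and A': "norm (A' k l) \<le> C * e\<^sup>2" "norm (A' l m) \<le> C * e\<^sup>2"
    and s: "norm (A' k l - A k l) \<le> s" "norm (A' l m - A l m) \<le> s"
    and e: "0 \<le> e" "e \<le> 1" and P: "1 \<le> P" "P * e \<le> 1"
    and YZ: "norm (Y l - Y k) \<le> P * e" "norm (Z l - Z k) \<le> P * e"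
    and JY: "norm (J Y x A k l) \<le> P * e^3"
    and v: "norm (Z k - Y k) \<le> v"
  shows "norm (D k m) \<le> norm (D k l) + norm (D l m)
    + 9 * C^4 * P\<^sup>2 * (e * norm (D k l) + e powr (2 + a) * v + e * s)"
proof -
  have C0: "0 \<le> C" and P0: "0 \<le> P" using C_ge_1 P by auto
  have v0: "0 \<le> v" and s0: "0 \<le> s" using v s norm_ge_zero order_trans by blast+
  define \<xi> where "\<xi> = x m - x l"
  have \<xi>: "norm \<xi> \<le> C * e" using x by (simp add: \<xi>_def)
  define d where "d = norm (D k l)"
  define X where "X = norm ((Z l - Y l) - (Z k - Y k))"
  define b where "b = e powr (2 + a)"
  have b0: "0 \<le> b" by (simp add: b_def)
  have d0: "0 \<le> d" and X0: "0 \<le> X" by (auto simp: d_def X_def)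
  have ev: "e powr (1 + a) * e = b" "e powr a * e\<^sup>2 = b"
  proof -
    show "e powr (1 + a) * e = b"
      using e powr_add[of e "1 + a" 1] by (cases "e = 0") (auto simp: b_def add.commute)
    show "e powr a * e\<^sup>2 = b"
      using e powr_add[of e a 2] by (cases "e = 0") (auto simp: b_def add.commute)
  qed
  have e2: "e\<^sup>2 \<le> e" using e by (simp add: power2_eq_square mult_left_le)
  have e3: "e^3 \<le> b"
  proof (cases "e = 0")
    case False
    then have "e^3 = e powr 3" using e by simp
    also have "\<dots> \<le> b" unfolding b_def using e False a_le_1 by (intro powr_mono') auto
    finally show ?thesis .
  qed (simp add: b_def)
  have e4: "e^3 * e \<le> b"
    using e3 e mult_left_le[of e "e^3"] by (simp add: zero_le_power)
  have Pa: "(P * e) powr (1 + a) \<le> P\<^sup>2 * e powr (1 + a)" "(P * e) powr a \<le> P * e powr a"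
  proof -
    have "P powr (1 + a) \<le> P\<^sup>2" "P powr a \<le> P"
      using powr_mono[of "1 + a" 2 P] powr_mono[of a 1 P] P a_le_1 by auto
    then show "(P * e) powr (1 + a) \<le> P\<^sup>2 * e powr (1 + a)" "(P * e) powr a \<le> P * e powr a"
      using P e by (auto simp: powr_mult intro!: mult_right_mono)
  qed
  note G_diff = G_apply_diff[OF S(1,3) A'(1) s(1) v]
  have Xle: "norm ((Z l - Y l) - (Z k - Y k)) \<le> norm (D k l) + 2 * C\<^sup>2 * v * e + C * s"
    unfolding D_def by (rule increment_diff_le) (fact S x A' s v e)+
  define H where "H = (\<lambda>u w. F w \<xi> - F u \<xi> - DF u (w - u) \<xi>)"
  have T1: "norm (H (Z k) (Z l) - H (Y k) (Y l)) \<le> C\<^sup>2 * P * (e\<^sup>2 * X) + C\<^sup>2 * P\<^sup>2 * (b * v)"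
  proof -
    have "norm (H (Z k) (Z l) - H (Y k) (Y l)) \<le> C * ((P * e) * X + (P * e) powr (1 + a) * norm (Z k - Y k)) * norm \<xi>"
      unfolding H_def X_def by (rule F_four[OF S(3,4,1,2) YZ(2,1) P(2)])
    also have "\<dots> \<le> C * ((P * e) * X + (P\<^sup>2 * e powr (1 + a)) * v) * (C * e)"
      using Pa v \<xi> C0 P0 e X0 v0 by (intro mult_mono mult_left_mono add_mono) auto
    also have "\<dots> = C\<^sup>2 * P * (e\<^sup>2 * X) + C\<^sup>2 * P\<^sup>2 * ((e powr (1 + a) * e) * v)"
      by (simp add: algebra_simps power2_eq_square)
    finally show ?thesis by (simp only: ev)
  qed
  have T2: "norm (DF (Z k) (J Z x A' k l) \<xi> - DF (Y k) (J Y x A k l) \<xi>) \<le> C\<^sup>2 * (e * d) + C\<^sup>2 * P * (b * v)"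
  proof -
    have "DF (Z k) (J Z x A' k l) \<xi> - DF (Y k) (J Y x A k l) \<xi>
        = DF (Z k) (D k l) \<xi> + (DF (Z k) (J Y x A k l) \<xi> - DF (Y k) (J Y x A k l) \<xi>)"
      using linear_diff[OF linear_DF, of "Z k" "J Z x A' k l" "J Y x A k l" \<xi>] by (simp add: D_def)
    moreover have "norm (DF (Z k) (D k l) \<xi>) \<le> C * d * (C * e)"
      unfolding d_def using \<xi> C0 by (intro order_trans[OF DF_bound[OF S(3)]] mult_left_mono) auto
    moreover have "norm (DF (Z k) (J Y x A k l) \<xi> - DF (Y k) (J Y x A k l) \<xi>) \<le> C * v * (P * e^3) * (C * e)"
      using \<xi> v JY C0 v0 P0 e by (intro order_trans[OF DF_lip[OF S(3,1)]] mult_mono mult_left_mono) auto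
    moreover have "C * v * (P * e^3) * (C * e) \<le> C\<^sup>2 * P * (b * v)"
    proof -
      have "C * v * (P * e^3) * (C * e) = C\<^sup>2 * P * v * (e^3 * e)" by (simp add: algebra_simps power2_eq_square)
      also have "\<dots> \<le> C\<^sup>2 * P * v * b" using e4 P0 v0 by (intro mult_left_mono) auto
      finally show ?thesis by (simp add: algebra_simps)
    qed
    moreover have "C * d * (C * e) = C\<^sup>2 * (e * d)" by (simp add: power2_eq_square)
    ultimately show ?thesis by (smt (verit) norm_triangle_ineq)
  qed
  have T2': "norm (DF (Z k) (G (Z k) (A' k l)) \<xi> - DF (Y k) (G (Y k) (A k l)) \<xi>) \<le> 2 * C^4 * (b * v) + C^3 * (e * s)"
  proof -
    have "DF (Z k) (G (Z k) (A' k l)) \<xi> - DF (Y k) (G (Y k) (A k l)) \<xi>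
        = (DF (Z k) (G (Z k) (A' k l)) \<xi> - DF (Y k) (G (Z k) (A' k l)) \<xi>)
          + DF (Y k) (G (Z k) (A' k l) - G (Y k) (A k l)) \<xi>"
      using linear_diff[OF linear_DF, of "Y k" "G (Z k) (A' k l)" "G (Y k) (A k l)" \<xi>] by simp
    moreover have "norm (G (Z k) (A' k l)) \<le> C * (C * e\<^sup>2)"
      using A'(1) C0 by (intro order_trans[OF G_bound[OF S(3)]] mult_left_mono)
    then have "norm (DF (Z k) (G (Z k) (A' k l)) \<xi> - DF (Y k) (G (Z k) (A' k l)) \<xi>) \<le> C * v * (C * (C * e\<^sup>2)) * (C * e)"
      using \<xi> v C0 v0 e by (intro order_trans[OF DF_lip[OF S(3,1)]] mult_mono mult_left_mono) auto
    moreover have "norm (DF (Y k) (G (Z k) (A' k l) - G (Y k) (A k l)) \<xi>) \<le> C * (C * v * (C * e\<^sup>2) + C * s) * (C * e)"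
      using \<xi> G_diff C0 v0 s0 e by (intro order_trans[OF DF_bound[OF S(1)]] mult_mono mult_left_mono) auto
    moreover have "C * v * (C * (C * e\<^sup>2)) * (C * e) + C * (C * v * (C * e\<^sup>2) + C * s) * (C * e)
        = 2 * C^4 * (e^3 * v) + C^3 * (e * s)"
      by (simp add: algebra_simps power2_eq_square power3_eq_cube power4_eq_xxxx)
    moreover have "2 * C^4 * (e^3 * v) \<le> 2 * C^4 * (b * v)"
      using e3 v0 by (intro mult_left_mono mult_right_mono) auto
    ultimately show ?thesis by (smt (verit) norm_triangle_ineq)
  qed
  have T3: "norm ((G (Z l) (A' l m) - G (Z k) (A' l m)) - (G (Y l) (A l m) - G (Y k) (A l m)))
      \<le> C\<^sup>2 * (e\<^sup>2 * X) + C\<^sup>2 * P * (b * v) + C * P * (e * s)"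
  proof -
    define W where "W = A' l m - A l m"
    have "(G (Z l) (A' l m) - G (Z k) (A' l m)) - (G (Y l) (A l m) - G (Y k) (A l m))
      = ((G (Z l) (A l m) - G (Z k) (A l m)) - (G (Y l) (A l m) - G (Y k) (A l m)))
         + (G (Z l) W - G (Z k) W)"
      by (simp add: W_def linear_diff[OF linear_G])
    moreover have "norm ((G (Z l) (A l m) - G (Z k) (A l m)) - (G (Y l) (A l m) - G (Y k) (A l m)))
        \<le> C * (X + P * e powr a * v) * (C * e\<^sup>2)"
      unfolding X_def using Pa v A(2) C0 P0 e v0
      by (intro order_trans[OF G_four[OF S(3,4,1,2) YZ(2,1) P(2)]] mult_mono mult_left_mono add_mono) auto
    moreover have "C * (X + P * e powr a * v) * (C * e\<^sup>2) = C\<^sup>2 * (e\<^sup>2 * X) + C\<^sup>2 * P * (b * v)"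
      unfolding ev(2)[symmetric] by (simp add: algebra_simps power2_eq_square)
    moreover have "norm (G (Z l) W - G (Z k) W) \<le> C * (P * e) * s"
      unfolding W_def using YZ(2) s(2) C0 P0 e
      by (intro order_trans[OF G_lip[OF S(4,3)]] mult_mono mult_left_mono) auto
    ultimately show ?thesis
      by (smt (verit) norm_triangle_ineq mult.assoc)
  qed
  define \<Delta> where "\<Delta> = D k m - D k l - D l m"
  have split4: "norm (p + q + r + t) \<le> norm p + norm q + norm r + norm t" for p q r t :: 'e
    by (smt (verit) norm_triangle_ineq)
  have \<Delta>_eq: "\<Delta> = (H (Z k) (Z l) - H (Y k) (Y l))
      + (DF (Z k) (J Z x A' k l) \<xi> - DF (Y k) (J Y x A k l) \<xi>)
      + (DF (Z k) (G (Z k) (A' k l)) \<xi> - DF (Y k) (G (Y k) (A k l)) \<xi>)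
      + ((G (Z l) (A' l m) - G (Z k) (A' l m)) - (G (Y l) (A l m) - G (Y k) (A l m)))"
  proof -
    have "\<Delta> = (J Z x A' k m - J Z x A' k l - J Z x A' l m) - (J Y x A k m - J Y x A k l - J Y x A l m)"
      by (simp add: \<Delta>_def D_def)
    then show ?thesis
      unfolding J_defect[where A = A' and y = Z and x = x, OF chen'] J_defect[where A = A and y = Y and x = x, OF chen]
      by (simp add: H_def \<xi>_def linear_add[OF linear_DF])
  qed
  have "norm \<Delta> \<le> (C\<^sup>2 * P * (e\<^sup>2 * X) + C\<^sup>2 * (e\<^sup>2 * X)) + C\<^sup>2 * (e * d)
      + (C\<^sup>2 * P\<^sup>2 * (b * v) + C\<^sup>2 * P * (b * v) + 2 * C^4 * (b * v) + C\<^sup>2 * P * (b * v))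
      + (C^3 * (e * s) + C * P * (e * s))"
    unfolding \<Delta>_eq using T1 T2 T2' T3 split4 by (smt (verit))
  \<comment> \<open>The coefficient 9 is the count for \<open>b * v\<close>: five direct
    contributions and four through the two occurrences of \<open>X\<close>. The counts for
    \<open>e * d\<close> and \<open>e * s\<close> are 3 and 4.\<close>
  also have "\<dots> \<le> 9 * C^4 * P\<^sup>2 * (e * d + b * v + e * s)"
  proof -
    define q where "q = C^4 * P\<^sup>2"
    have qq: "C^i * P^j \<le> q" if "i \<le> 4" "j \<le> 2" for i j
      unfolding q_def using C_ge_1 P that by (intro mult_mono power_increasing) auto
    have le: "C^i * P^j * u \<le> q * u" if "i \<le> 4" "j \<le> 2" "0 \<le> u" for i j u
      using qq that by (intro mult_right_mono)
    have nn: "0 \<le> e * d" "0 \<le> b * v" "0 \<le> e * s" "0 \<le> e\<^sup>2 * X" using e d0 b0 v0 s0 X0 by auto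
    have "C\<^sup>2 * (e\<^sup>2 * X) \<le> C\<^sup>2 * P * (e\<^sup>2 * X)"
      using P nn by (intro mult_right_mono) (auto simp: mult_le_cancel_left1)
    moreover have "C\<^sup>2 * P * (e\<^sup>2 * X) \<le> C\<^sup>2 * P * (e * d + 2 * C\<^sup>2 * (b * v) + C * (e * s))"
    proof -
      have "e\<^sup>2 * X \<le> e\<^sup>2 * (d + 2 * C\<^sup>2 * v * e + C * s)"
        using Xle by (intro mult_left_mono) (auto simp: X_def d_def)
      also have "\<dots> = e\<^sup>2 * d + 2 * C\<^sup>2 * (e^3 * v) + C * (e\<^sup>2 * s)"
        by (simp add: algebra_simps power2_eq_square power3_eq_cube power4_eq_xxxx)
      also have "\<dots> \<le> e * d + 2 * C\<^sup>2 * (b * v) + C * (e * s)"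
        using e2 e3 d0 v0 s0 C0 by (intro add_mono mult_left_mono mult_right_mono) auto
      finally show ?thesis using P0 by (intro mult_left_mono) auto
    qed
    moreover have "C\<^sup>2 * P * (e * d + 2 * C\<^sup>2 * (b * v) + C * (e * s))
        = C^2 * P^1 * (e * d) + 2 * (C^4 * P^1 * (b * v)) + C^3 * P^1 * (e * s)"
      by (simp add: algebra_simps power2_eq_square power3_eq_cube power4_eq_xxxx)
    moreover have "C^2 * P^1 * (e * d) \<le> q * (e * d)" "C^4 * P^1 * (b * v) \<le> q * (b * v)"
      "C^3 * P^1 * (e * s) \<le> q * (e * s)" "C\<^sup>2 * (e * d) \<le> q * (e * d)"
      "C\<^sup>2 * P\<^sup>2 * (b * v) \<le> q * (b * v)" "C\<^sup>2 * P * (b * v) \<le> q * (b * v)"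
      "C^4 * (b * v) \<le> q * (b * v)" "C^3 * (e * s) \<le> q * (e * s)" "C * P * (e * s) \<le> q * (e * s)"
      using nn le[of 2 1 "e * d"] le[of 4 1 "b * v"] le[of 3 1 "e * s"] le[of 2 0 "e * d"]
        le[of 2 2 "b * v"] le[of 2 1 "b * v"] le[of 4 0 "b * v"] le[of 3 0 "e * s"] le[of 1 1 "e * s"]
      by (simp_all only: power_0 power_one_right mult_1_right)
    moreover have "9 * C^4 * P\<^sup>2 * (e * d + b * v + e * s) = 9 * (q * (e * d)) + 9 * (q * (b * v)) + 9 * (q * (e * s))"
      by (simp add: q_def algebra_simps)
    moreover have "0 \<le> q * (e * d)" "0 \<le> q * (b * v)" "0 \<le> q * (e * s)"
      using nn qq[of 0 0] by (auto simp: zero_le_mult_iff)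
    ultimately show ?thesis using nn by linarith
  qed
  finally have "norm \<Delta> \<le> 9 * C^4 * P\<^sup>2 * (e * d + b * v + e * s)" .
  moreover have "D k m = \<Delta> + D k l + D l m" by (simp add: \<Delta>_def)
  then have "norm (D k m) \<le> norm \<Delta> + norm (D k l) + norm (D l m)"
    by (smt (verit) norm_triangle_ineq)
  ultimately show ?thesis by (simp add: d_def b_def)
qed

text \<open>A qualitative o-condition is upgraded to a rate. With \<open>E\<close> equal to
  \<epsilon> times \<omega> along a sufficiently fine grid, the one-step defects telescope to at
  most \<epsilon> times the total increase of \<omega>. The grid has disappeared from the resulting
  bound, so \<epsilon> can be sent to 0.\<close>

lemma solution_expansion:
  fixes y :: "real \<Rightarrow> 'e" and x :: "real \<Rightarrow> 'x" and A :: "real \<Rightarrow> real \<Rightarrow> 'a" and \<omega> :: "real \<Rightarrow> real"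
  assumes \<alpha>: "1/3 < \<alpha>"
    and S: "\<And>t. 0 \<le> t \<Longrightarrow> t \<le> T \<Longrightarrow> y t \<in> S"
    and chen: "\<And>s t u. 0 \<le> s \<Longrightarrow> s \<le> t \<Longrightarrow> t \<le> u \<Longrightarrow> u \<le> T \<Longrightarrow>
      A s u = A s t + A t u + tens (x t - x s) (x u - x t)"
    and x: "\<And>s t. 0 \<le> s \<Longrightarrow> s \<le> t \<Longrightarrow> t \<le> T \<Longrightarrow> norm (x t - x s) \<le> C * (t - s) powr \<alpha>"
    and A: "\<And>s t. 0 \<le> s \<Longrightarrow> s \<le> t \<Longrightarrow> t \<le> T \<Longrightarrow> norm (A s t) \<le> C * ((t - s) powr \<alpha>)\<^sup>2"
    and \<omega>: "mono_on {0..T} \<omega>"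
    and small: "\<And>\<epsilon>. 0 < \<epsilon> \<Longrightarrow> \<exists>\<eta>>0. \<forall>s t. 0 \<le> s \<longrightarrow> s < t \<longrightarrow> t \<le> T \<longrightarrow> t - s < \<eta> \<longrightarrow>
      norm (J y x A s t) \<le> \<epsilon> * (\<omega> t - \<omega> s)"
    and L: "23 * C^6 \<le> L * (1 - (2/3) powr (3 * \<alpha> - 1))"
    and N: "12 * C\<^sup>2 \<le> N * (1 - (2/3) powr \<alpha>)"
    and \<delta>: "0 \<le> \<delta>" "\<delta> \<le> 1" "L * \<delta> powr \<alpha> \<le> 1" "N * \<delta> powr \<alpha> \<le> 1"
    and st: "0 \<le> s" "s < t" "t \<le> T" "t - s \<le> \<delta>"
  shows "norm (J y x A s t) \<le> L * ((t - s) powr \<alpha>)^3"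
proof (rule field_le_epsilon)
  fix \<epsilon>' :: real assume \<epsilon>': "0 < \<epsilon>'"
  define W where "W = \<omega> T - \<omega> 0"
  have W: "0 \<le> W" unfolding W_def using mono_onD[OF \<omega>, of 0 T] st by auto
  \<comment> \<open>The minimum with 1 secures the hypothesis on the total of \<open>E\<close>; the
    factor 2 anticipates the weight 1 + N e \<le> 2. Adding 1 to \<open>W\<close> covers a constant
    \<omega>.\<close>
  define \<epsilon> where "\<epsilon> = min \<epsilon>' 1 / (2 * (W + 1))"
  have \<epsilon>: "0 < \<epsilon>" using \<epsilon>' W by (simp add: \<epsilon>_def)
  have "\<epsilon> * W \<le> \<epsilon> * (W + 1)" using \<epsilon> by (simp add: mult_left_mono)
  also have "\<dots> = min \<epsilon>' 1 / 2" using W by (simp add: \<epsilon>_def field_simps)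
  finally have \<epsilon>W: "\<epsilon> * W \<le> 1" "2 * (\<epsilon> * W) \<le> \<epsilon>'" by auto
  obtain \<eta> where \<eta>: "0 < \<eta>" "\<And>s t. 0 \<le> s \<Longrightarrow> s < t \<Longrightarrow> t \<le> T \<Longrightarrow> t - s < \<eta> \<Longrightarrow> norm (J y x A s t) \<le> \<epsilon> * (\<omega> t - \<omega> s)"
    using small[OF \<epsilon>] by blast
  obtain n where n: "(t - s) / \<eta> < real n" using reals_Archimedean2 by blast
  have n0: "0 < n" using n \<eta> st by (auto intro: gr0I simp: divide_less_0_iff)
  define h where "h = (t - s) / real n"
  have h: "0 < h" "h < \<eta>" "real n * h = t - s"
    using n n0 \<eta> st by (auto simp: h_def field_simps)
  define p where "p = (\<lambda>k. s + real k * h)"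
  have p: "0 \<le> p k" "p k \<le> T" if "k \<le> n" for k
  proof -
    show "0 \<le> p k" using st h by (simp add: p_def)
    have "real k * h \<le> real n * h" using that h by (intro mult_right_mono) auto
    then show "p k \<le> T" using st h by (simp add: p_def)
  qed
  have pmono: "p k \<le> p m" if "k \<le> m" for k m using that h by (simp add: p_def mult_right_mono)
  have pdiff: "p m - p k = real (m - k) * h" if "k \<le> m" for k m
    using that by (simp add: p_def of_nat_diff algebra_simps)
  have ends: "p 0 = s" "p n = t" using h by (auto simp: p_def)
  have "norm (J (\<lambda>k. y (p k)) (\<lambda>k. x (p k)) (\<lambda>k m. A (p k) (p m)) 0 n)
     \<le> L * ((real (n - 0) * h) powr \<alpha>)^3 + (1 + N * (real (n - 0) * h) powr \<alpha>) * (\<epsilon> * \<omega> (p n) - \<epsilon> * \<omega> (p 0))"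
  proof (rule local_expansion[where M = n and \<delta> = \<delta> and E = "\<lambda>k. \<epsilon> * \<omega> (p k)"])
    fix k assume k: "k < n"
    have "norm (J y x A (p k) (p (Suc k))) \<le> \<epsilon> * (\<omega> (p (Suc k)) - \<omega> (p k))"
      using k h p[of k] p[of "Suc k"] pdiff[of k "Suc k"] by (intro \<eta>(2)) (auto)
    then show "norm (J (\<lambda>k. y (p k)) (\<lambda>k. x (p k)) (\<lambda>k m. A (p k) (p m)) k (Suc k))
      \<le> \<epsilon> * \<omega> (p (Suc k)) - \<epsilon> * \<omega> (p k)"
      by (simp add: J_def right_diff_distrib)
  next
    have "\<omega> t - \<omega> s \<le> W"
      unfolding W_def using mono_onD[OF \<omega>, of 0 s] mono_onD[OF \<omega>, of t T] st by auto
    then have "\<epsilon> * (\<omega> t - \<omega> s) \<le> 1" using \<epsilon> \<epsilon>W(1) by (meson less_imp_le mult_left_mono order_trans)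
    then show "\<epsilon> * \<omega> (p n) - \<epsilon> * \<omega> (p 0) \<le> 1" by (simp add: ends right_diff_distrib)
  next
    fix k m assume "k < m" "m \<le> n"
    then show "norm (x (p m) - x (p k)) \<le> C * (real (m - k) * h) powr \<alpha>"
      "norm (A (p k) (p m)) \<le> C * ((real (m - k) * h) powr \<alpha>)\<^sup>2"
      using x[of "p k" "p m"] A[of "p k" "p m"] p[of k] p[of m] pmono[of k m] pdiff[of k m] by auto
  next
    fix k l m assume "k \<le> l" "l \<le> m" "m \<le> n"
    then show "A (p k) (p m) = A (p k) (p l) + A (p l) (p m) + tens (x (p l) - x (p k)) (x (p m) - x (p l))"
      using p[of k] p[of m] pmono[of k l] pmono[of l m] by (intro chen) auto
  next
    show "\<And>k. k \<le> n \<Longrightarrow> y (p k) \<in> S" using p S by blast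
  qed (use \<alpha> L N \<delta> n0 h st in auto)
  also have "\<dots> = L * ((t - s) powr \<alpha>)^3 + (1 + N * (t - s) powr \<alpha>) * (\<epsilon> * (\<omega> t - \<omega> s))"
    by (simp add: ends h right_diff_distrib)
  also have "\<dots> \<le> L * ((t - s) powr \<alpha>)^3 + \<epsilon>'"
  proof -
    have N0: "0 \<le> N"
    proof (rule ccontr)
      assume "\<not> 0 \<le> N"
      moreover have "(2/3::real) powr \<alpha> < 1" using \<alpha> powr_less_mono2[of \<alpha> "2/3" 1] by auto
      ultimately have "N * (1 - (2/3) powr \<alpha>) < 0" by (simp add: mult_neg_pos)
      moreover have "0 \<le> 12 * C\<^sup>2" by simp
      ultimately show False using N by linarith
    qed
    have "(t - s) powr \<alpha> \<le> \<delta> powr \<alpha>" using st \<alpha> by (intro powr_mono2) auto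
    then have "N * (t - s) powr \<alpha> \<le> 1" using \<delta> N0 by (meson mult_left_mono order_trans)
    moreover have "0 \<le> \<omega> t - \<omega> s" using mono_onD[OF \<omega>, of s t] st by auto
    ultimately have "(1 + N * (t - s) powr \<alpha>) * (\<epsilon> * (\<omega> t - \<omega> s)) \<le> 2 * (\<epsilon> * (\<omega> t - \<omega> s))"
      using \<epsilon> by (intro mult_right_mono) auto
    also have "\<dots> \<le> 2 * (\<epsilon> * W)"
      unfolding W_def using mono_onD[OF \<omega>, of 0 s] mono_onD[OF \<omega>, of t T] st \<epsilon> by (intro mult_left_mono) auto
    finally show ?thesis using \<epsilon>W by simp
  qed
  finally show "norm (J y x A s t) \<le> L * ((t - s) powr \<alpha>)^3 + \<epsilon>'"
    by (simp add: J_def ends)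
qed

end

section \<open>Stability under a change of the area\<close>

text \<open>\<open>Y\<close> is the sampled solution and \<open>Z\<close> the Euler scheme, driven by the areas \<open>A\<close> and \<open>A'\<close> over the
  same path; \<open>\<sigma>\<close> stands for \<open>h\<close> to the power \<open>2\<alpha> - \<beta>\<close>, the size of \<open>A' - A\<close>.\<close>
locale rough_pair = rough_field S F DF G tens C a
  for S :: "'e::real_normed_vector set"
    and F :: "'e \<Rightarrow> 'x::real_normed_vector \<Rightarrow> 'e"
    and DF :: "'e \<Rightarrow> 'e \<Rightarrow> 'x \<Rightarrow> 'e"
    and G :: "'e \<Rightarrow> 'a::real_normed_vector \<Rightarrow> 'e"
    and tens :: "'x \<Rightarrow> 'x \<Rightarrow> 'a"
    and C a :: real +
  fixes \<alpha> \<beta> h \<delta> P B M \<sigma> q :: real and n :: nat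
    and Y Z :: "nat \<Rightarrow> 'e" and x :: "nat \<Rightarrow> 'x" and A A' :: "nat \<Rightarrow> nat \<Rightarrow> 'a"
  assumes q_def: "q = min ((2 + a) * \<alpha>) (\<alpha> + \<beta>)" and q: "1 < q"
    and \<alpha>: "0 < \<alpha>" and \<beta>: "0 < \<beta>" "\<beta> \<le> 2 * \<alpha>"
    and h: "0 < h" and \<sigma>: "0 \<le> \<sigma>" and P: "1 \<le> P" and B: "0 \<le> B"
    and \<delta>: "0 < \<delta>" "\<delta> \<le> 1" "P * \<delta> powr \<alpha> \<le> 1"
      "9 * C^4 * P\<^sup>2 * \<delta> powr \<alpha> \<le> (1 - (2/3) powr (q - 1)) / 2"
      "(M + 2 * C\<^sup>2) * \<delta> powr \<alpha> \<le> 1/2"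
    and M: "P \<le> M" "9 * C^4 * P\<^sup>2 * (1 + B) \<le> M * ((1 - (2/3) powr (q - 1)) / 2)"
    and YZ_in: "k \<le> n \<Longrightarrow> Y k \<in> S" "k \<le> n \<Longrightarrow> Z k \<in> S"
    and chen: "k \<le> l \<Longrightarrow> l \<le> m \<Longrightarrow> m \<le> n \<Longrightarrow> A k m = A k l + A l m + tens (x l - x k) (x m - x l)"
      "k \<le> l \<Longrightarrow> l \<le> m \<Longrightarrow> m \<le> n \<Longrightarrow> A' k m = A' k l + A' l m + tens (x l - x k) (x m - x l)"
    and x_le: "k < m \<Longrightarrow> m \<le> n \<Longrightarrow> norm (x m - x k) \<le> C * (real (m - k) * h) powr \<alpha>"
    and A_le: "k < m \<Longrightarrow> m \<le> n \<Longrightarrow> norm (A k m) \<le> C * ((real (m - k) * h) powr \<alpha>)\<^sup>2"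
      "k < m \<Longrightarrow> m \<le> n \<Longrightarrow> norm (A' k m) \<le> C * ((real (m - k) * h) powr \<alpha>)\<^sup>2"
      "k < m \<Longrightarrow> m \<le> n \<Longrightarrow> norm (A' k m - A k m) \<le> B * ((real (m - k) * h) powr \<beta> * \<sigma>)"
    and YZ_le: "k < m \<Longrightarrow> m \<le> n \<Longrightarrow> real (m - k) * h \<le> \<delta> \<Longrightarrow> norm (Y m - Y k) \<le> P * (real (m - k) * h) powr \<alpha>"
      "k < m \<Longrightarrow> m \<le> n \<Longrightarrow> real (m - k) * h \<le> \<delta> \<Longrightarrow> norm (Z m - Z k) \<le> P * (real (m - k) * h) powr \<alpha>"
    and JY_le: "k < m \<Longrightarrow> m \<le> n \<Longrightarrow> real (m - k) * h \<le> \<delta> \<Longrightarrow>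
      norm (J Y x A k m) \<le> P * ((real (m - k) * h) powr \<alpha>)^3"
    and base: "k < n \<Longrightarrow> norm (J Z x A' k (Suc k) - J Y x A k (Suc k)) \<le> P * (h powr q * \<sigma>)"
    and start: "Z 0 = Y 0"
begin

text \<open>The separation is treated as a given uniform bound \<open>v\<close>, and the difference
  of the defects is bisected with exponent \<open>q\<close>, the smaller of (2 + a)\<alpha> for the
  separation and \<alpha> + \<beta> for the area. The room 1 - \<kappa> left by splitting t^q is
  shared equally: one half, by smallness of \<delta>, pays for the error proportional to
  \<open>D\<close> on the left piece; the other half, by the size of \<open>M\<close>, pays for the
  local error. This explains the halves in the assumptions of the locale.\<close>

lemma window_J_diff:
  assumes v: "\<And>k. k\<^sub>0 \<le> k \<Longrightarrow> k \<le> m\<^sub>0 \<Longrightarrow> norm (Z k - Y k) \<le> v"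
    and w: "m\<^sub>0 \<le> n" "real (m\<^sub>0 - k\<^sub>0) * h \<le> \<delta>"
    and km: "k\<^sub>0 \<le> k" "k < m" "m \<le> m\<^sub>0"
  shows "norm (J Z x A' k m - J Y x A k m) \<le> M * ((real (m - k) * h) powr q * (v + \<sigma>))"
proof -
  define D where "D = (\<lambda>i j. J Z x A' i j - J Y x A i j)"
  define \<nu> where "\<nu> = v + \<sigma>"
  define Q where "Q = 9 * C^4 * P\<^sup>2"
  define \<kappa> where "\<kappa> = (2/3::real) powr (q - 1)"
  have v0: "0 \<le> v" using v[of k] km norm_ge_zero[of "Z k - Y k"] by linarith
  have \<nu>0: "0 \<le> \<nu>" using v0 \<sigma> by (simp add: \<nu>_def)
  have C0: "0 \<le> C" and Q0: "0 \<le> Q" and M0: "0 \<le> M" and P0: "0 \<le> P" using C_ge_1 P M by (auto simp: Q_def)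
  have "norm (D k m) \<le> M * ((real (m - k) * h) powr q * \<nu>)"
  proof (rule midpoint_induct[where P = "\<lambda>i j. norm (D i j) \<le> M * ((real (j - i) * h) powr q * \<nu>)", OF km(2,1,3)])
    fix i assume "k\<^sub>0 \<le> i" "i < m\<^sub>0"
    then have "norm (D i (Suc i)) \<le> P * (h powr q * \<sigma>)" using base[of i] w by (simp add: D_def)
    also have "\<dots> \<le> M * (h powr q * \<nu>)"
      using M M0 v0 \<sigma> by (intro mult_mono mult_left_mono) (auto simp: \<nu>_def)
    finally show "norm (D i (Suc i)) \<le> M * ((real (Suc i - i) * h) powr q * \<nu>)" by simp
  next
    fix i l j
    assume ilj: "k\<^sub>0 \<le> i" "i < l" "l < j" "j \<le> m\<^sub>0" "3 * (l - i) \<le> 2 * (j - i)" "3 * (j - l) \<le> 2 * (j - i)"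
      and IH: "norm (D i l) \<le> M * ((real (l - i) * h) powr q * \<nu>)" "norm (D l j) \<le> M * ((real (j - l) * h) powr q * \<nu>)"
    have jn: "j \<le> n" using ilj w by simp
    define r where "r = real (l - i) * h"
    define s where "s = real (j - l) * h"
    define t where "t = real (j - i) * h"
    have rst: "0 < r" "0 < s" "r + s = t" "r \<le> 2/3 * t" "s \<le> 2/3 * t"
      unfolding r_def s_def t_def by (fact grid_split[OF ilj(2,3,5,6) h])+
    have t: "0 < t" "t \<le> \<delta>" "r \<le> t" "s \<le> t"
    proof -
      have "t \<le> real (m\<^sub>0 - k\<^sub>0) * h" unfolding t_def using ilj h by (intro mult_right_mono) auto
      then show "t \<le> \<delta>" using w by simp
    qed (use rst in auto)
    define e where "e = t powr \<alpha>"
    have e\<delta>: "e \<le> \<delta> powr \<alpha>" unfolding e_def using t \<alpha> by (intro powr_mono2) auto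
    have "\<delta> powr \<alpha> \<le> 1" using \<delta> \<alpha> powr_mono2[of \<alpha> \<delta> 1] by simp
    then have e: "0 \<le> e" "e \<le> 1" "P * e \<le> 1" "Q * e \<le> (1 - \<kappa>) / 2"
      using e\<delta> \<delta>(3,4) mult_left_mono[OF e\<delta> P0] mult_left_mono[OF e\<delta> Q0]
      unfolding Q_def \<kappa>_def by (auto simp: e_def)
    have rse: "r powr \<alpha> \<le> e" "s powr \<alpha> \<le> e" unfolding e_def using rst t \<alpha> by (auto intro!: powr_mono2)
    have pw: "C * u powr \<alpha> \<le> C * e" "C * (u powr \<alpha>)\<^sup>2 \<le> C * e\<^sup>2" "P * u powr \<alpha> \<le> P * e"
      "P * (u powr \<alpha>)^3 \<le> P * e^3" if "u powr \<alpha> \<le> e" for u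
      using that C0 P by (auto intro!: mult_left_mono power_mono)
    have pb: "B * (u powr \<beta> * \<sigma>) \<le> B * (t powr \<beta> * \<sigma>)" if "0 < u" "u \<le> t" for u
      using that B \<sigma> \<beta> by (intro mult_left_mono mult_right_mono powr_mono2) auto
    have r\<delta>: "r \<le> \<delta>" using t by linarith
    note bounds = x_le[of i l, folded r_def] x_le[of l j, folded s_def]
      A_le[of i l, folded r_def] A_le[of l j, folded s_def]
    have "norm (D i j) \<le> norm (D i l) + norm (D l j)
        + 9 * C^4 * P\<^sup>2 * (e * norm (D i l) + e powr (2 + a) * v + e * (B * (t powr \<beta> * \<sigma>)))"
      unfolding D_def
    proof (rule J_diff_step)
      show "A i j = A i l + A l j + tens (x l - x i) (x j - x l)" using chen(1)[of i l j] ilj jn by simp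
      show "A' i j = A' i l + A' l j + tens (x l - x i) (x j - x l)" using chen(2)[of i l j] ilj jn by simp
      show "norm (x l - x i) \<le> C * e" "norm (x j - x l) \<le> C * e"
        using bounds(1,2) ilj jn pw(1)[OF rse(1)] pw(1)[OF rse(2)] by auto
      show "norm (A i l) \<le> C * e\<^sup>2" "norm (A l j) \<le> C * e\<^sup>2"
        "norm (A' i l) \<le> C * e\<^sup>2" "norm (A' l j) \<le> C * e\<^sup>2"
        using bounds(3,4,6,7) ilj jn pw(2)[OF rse(1)] pw(2)[OF rse(2)] by auto
      show "norm (A' i l - A i l) \<le> B * (t powr \<beta> * \<sigma>)" "norm (A' l j - A l j) \<le> B * (t powr \<beta> * \<sigma>)"
        using bounds(5,8) ilj jn pb[of r] pb[of s] rst t by auto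
      show "norm (Y l - Y i) \<le> P * e" "norm (Z l - Z i) \<le> P * e"
        using YZ_le[of i l, folded r_def] ilj jn r\<delta> pw(3)[OF rse(1)] by auto
      show "norm (J Y x A i l) \<le> P * e^3"
        using JY_le[of i l, folded r_def] ilj jn r\<delta> pw(4)[OF rse(1)] by auto
      show "norm (Z i - Y i) \<le> v" using v ilj by simp
    qed (use ilj jn YZ_in P e in auto)
    also have "\<dots> \<le> M * (t powr q * \<nu>)"
    proof -
      have t1: "t \<le> 1" using t \<delta> by simp
      have "e powr (2 + a) = t powr ((2 + a) * \<alpha>)" by (simp add: e_def powr_powr mult.commute)
      also have "\<dots> \<le> t powr q" using t t1 by (intro powr_mono') (auto simp: q_def)
      finally have "e powr (2 + a) * v \<le> t powr q * v" using v0 by (rule mult_right_mono)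
      moreover have "e * (B * (t powr \<beta> * \<sigma>)) \<le> B * (t powr q * \<sigma>)"
      proof -
        have "e * (B * (t powr \<beta> * \<sigma>)) = B * (t powr (\<alpha> + \<beta>) * \<sigma>)" by (simp add: e_def powr_add)
        also have "\<dots> \<le> B * (t powr q * \<sigma>)"
          using t t1 B \<sigma> by (intro mult_left_mono mult_right_mono powr_mono') (auto simp: q_def)
        finally show ?thesis .
      qed
      ultimately have "e powr (2 + a) * v + e * (B * (t powr \<beta> * \<sigma>)) \<le> t powr q * v + B * (t powr q * \<sigma>)"
        by linarith
      also have "\<dots> \<le> (1 + B) * (t powr q * \<nu>)"
        using B v0 \<sigma> by (simp add: \<nu>_def algebra_simps)
      finally have "Q * (e powr (2 + a) * v + e * (B * (t powr \<beta> * \<sigma>))) \<le> (Q * (1 + B)) * (t powr q * \<nu>)"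
        using Q0 by (metis mult.assoc mult_left_mono)
      also have "\<dots> \<le> M * ((1 - \<kappa>) / 2) * (t powr q * \<nu>)"
        using M(2) \<nu>0 unfolding Q_def \<kappa>_def by (intro mult_right_mono) auto
      finally have 1: "Q * (e powr (2 + a) * v + e * (B * (t powr \<beta> * \<sigma>))) \<le> M * ((1 - \<kappa>) / 2) * (t powr q * \<nu>)" .
      have "norm (D i l) \<le> M * (t powr q * \<nu>)"
        using IH(1) unfolding r_def[symmetric]
        by (rule order_trans) (use M0 \<nu>0 rst t q in \<open>auto intro!: mult_left_mono mult_right_mono powr_mono2\<close>)
      then have 2: "Q * e * norm (D i l) \<le> (1 - \<kappa>) / 2 * (M * (t powr q * \<nu>))"
        using e mult_nonneg_nonneg[OF Q0 e(1)] by (intro mult_mono) auto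
      have "r powr q + s powr q \<le> \<kappa> * t powr q"
        unfolding \<kappa>_def using rst q by (intro powr_split_le) auto
      then have "M * \<nu> * (r powr q + s powr q) \<le> M * \<nu> * (\<kappa> * t powr q)"
        using M0 \<nu>0 by (intro mult_left_mono) auto
      then have 3: "norm (D i l) + norm (D l j) \<le> M * \<nu> * (\<kappa> * t powr q)"
        using IH unfolding r_def[symmetric] s_def[symmetric] by (simp add: algebra_simps)
      have "M * \<nu> * (\<kappa> * t powr q) + (1 - \<kappa>) / 2 * (M * (t powr q * \<nu>)) + M * ((1 - \<kappa>) / 2) * (t powr q * \<nu>)
         = M * (t powr q * \<nu>)"
        by (simp add: field_simps)
      moreover have "Q * (e * norm (D i l) + e powr (2 + a) * v + e * (B * (t powr \<beta> * \<sigma>)))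
          = Q * e * norm (D i l) + Q * (e powr (2 + a) * v + e * (B * (t powr \<beta> * \<sigma>)))"
        by (simp add: algebra_simps)
      ultimately show ?thesis
        using 1 2 3 unfolding Q_def[symmetric] by linarith
    qed
    finally show "norm (D i j) \<le> M * ((real (j - i) * h) powr q * \<nu>)" by (simp add: t_def)
  qed
  then show ?thesis by (simp add: D_def \<nu>_def)
qed

text \<open>This replaces Gronwall's inequality. Let \<open>v\<close> be the largest separation in
  the window. Comparing the point where it is attained with the start of the window bounds
  \<open>v\<close> by the initial separation, plus v/2, plus the contribution of the area, and v/2
  is absorbed on the left.\<close>

lemma window_stability:
  assumes w: "k\<^sub>0 \<le> m\<^sub>0" "m\<^sub>0 \<le> n" "real (m\<^sub>0 - k\<^sub>0) * h \<le> \<delta>" and k: "k\<^sub>0 \<le> k" "k \<le> m\<^sub>0"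
  shows "norm (Z k - Y k) \<le> 2 * norm (Z k\<^sub>0 - Y k\<^sub>0) + 2 * (M + C * B) * ((real (m\<^sub>0 - k\<^sub>0) * h) powr \<beta> * \<sigma>)"
proof -
  define W where "W = (\<lambda>k. norm (Z k - Y k)) ` {k\<^sub>0..m\<^sub>0}"
  define v where "v = Max W"
  define t where "t = real (m\<^sub>0 - k\<^sub>0) * h"
  have W: "finite W" "W \<noteq> {}" using w by (auto simp: W_def)
  have vW: "norm (Z i - Y i) \<le> v" if "k\<^sub>0 \<le> i" "i \<le> m\<^sub>0" for i
    unfolding v_def using W that by (intro Max_ge) (auto simp: W_def)
  have v0: "0 \<le> v" using vW[of k\<^sub>0] w norm_ge_zero[of "Z k\<^sub>0 - Y k\<^sub>0"] by linarith
  have C0: "0 \<le> C" and M0: "0 \<le> M" using C_ge_1 P M by auto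
  have rhs0: "0 \<le> (M + C * B) * (t powr \<beta> * \<sigma>)" using C0 M0 B \<sigma> by simp
  obtain i where i: "k\<^sub>0 \<le> i" "i \<le> m\<^sub>0" "v = norm (Z i - Y i)"
  proof -
    have "v \<in> W" using Max_in[OF W] by (simp add: v_def)
    then show ?thesis using that unfolding W_def by auto
  qed
  have "v \<le> 2 * norm (Z k\<^sub>0 - Y k\<^sub>0) + 2 * ((M + C * B) * (t powr \<beta> * \<sigma>))"
  proof (cases "i = k\<^sub>0")
    case True
    then have "v = norm (Z k\<^sub>0 - Y k\<^sub>0)" using i by simp
    then show ?thesis using rhs0 norm_ge_zero[of "Z k\<^sub>0 - Y k\<^sub>0"] by linarith
  next
    case False
    then have ki: "k\<^sub>0 < i" using i by simp
    define u where "u = real (i - k\<^sub>0) * h"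
    have u: "0 < u" "u \<le> t" "u \<le> \<delta>"
    proof -
      show "0 < u" using ki h by (simp add: u_def)
      show "u \<le> t" unfolding u_def t_def using i h by (intro mult_right_mono) auto
      then show "u \<le> \<delta>" using w by (simp add: t_def)
    qed
    have u1: "u \<le> 1" using u \<delta> by simp
    define e where "e = u powr \<alpha>"
    have e\<delta>: "e \<le> \<delta> powr \<alpha>" unfolding e_def using u \<alpha> by (intro powr_mono2) auto
    have "\<delta> powr \<alpha> \<le> 1" using \<delta> \<alpha> powr_mono2[of \<alpha> \<delta> 1] by simp
    then have e: "0 \<le> e" "e \<le> 1" "(M + 2 * C\<^sup>2) * e \<le> 1/2"
      using e\<delta> \<delta>(3,5) mult_left_mono[OF e\<delta>, of P] mult_left_mono[OF e\<delta>, of "M + 2 * C\<^sup>2"] P M0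
      by (auto simp: e_def)
    have D: "norm (J Z x A' k\<^sub>0 i - J Y x A k\<^sub>0 i) \<le> M * (u powr q * (v + \<sigma>))"
      unfolding u_def by (rule window_J_diff[OF vW w(2,3) order_refl ki i(2)])
    have step: "norm ((Z i - Y i) - (Z k\<^sub>0 - Y k\<^sub>0)) \<le> norm (J Z x A' k\<^sub>0 i - J Y x A k\<^sub>0 i)
        + 2 * C\<^sup>2 * v * e + C * (B * (u powr \<beta> * \<sigma>))"
      by (rule increment_diff_le)
        (use ki i w e u vW YZ_in x_le[of k\<^sub>0 i] A_le[of k\<^sub>0 i] in \<open>auto simp: u_def e_def\<close>)
    \<comment> \<open>Since \<open>q\<close> exceeds both \<alpha> and \<beta> and u \<le> 1, the
      power u^q may be weakened to u^\<alpha> in front of \<open>v\<close>, where smallness is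
      wanted, and to u^\<beta> in front of \<sigma>, where the rate is wanted.\<close>
    have "0 \<le> a * \<alpha>" using a_pos \<alpha> by simp
    then have "\<beta> \<le> (2 + a) * \<alpha>" "\<alpha> \<le> (2 + a) * \<alpha>" using \<beta> \<alpha> unfolding distrib_right by linarith+
    then have "\<beta> \<le> q" "\<alpha> \<le> q" using \<alpha> \<beta> by (simp_all add: q_def)
    then have "u powr q \<le> u powr \<beta>" "u powr q \<le> e"
      unfolding e_def using u(1) u1 by (simp_all add: powr_mono')
    then have "u powr q * v + u powr q * \<sigma> \<le> e * v + u powr \<beta> * \<sigma>"
      using v0 \<sigma> by (intro add_mono mult_right_mono)
    from mult_left_mono[OF this M0]
    have "M * (u powr q * (v + \<sigma>)) \<le> M * (e * v) + M * (u powr \<beta> * \<sigma>)"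
      by (simp add: distrib_left)
    then have "norm ((Z i - Y i) - (Z k\<^sub>0 - Y k\<^sub>0)) \<le> (M + 2 * C\<^sup>2) * e * v + (M + C * B) * (u powr \<beta> * \<sigma>)"
      using step D by (simp add: algebra_simps)
    also have "\<dots> \<le> 1/2 * v + (M + C * B) * (t powr \<beta> * \<sigma>)"
      using e v0 u \<beta> \<sigma> M0 C0 B by (intro add_mono mult_right_mono mult_left_mono powr_mono2) auto
    finally have "norm (Z i - Y i) \<le> norm (Z k\<^sub>0 - Y k\<^sub>0) + (1/2 * v + (M + C * B) * (t powr \<beta> * \<sigma>))"
      by (metis add.commute norm_triangle_sub order_trans add_left_mono)
    then show ?thesis using i by simp
  qed
  then show ?thesis using vW[OF k] by (simp add: t_def algebra_simps)
qed

text \<open>Windows of length at most \<delta> are chained. The recursion a_(j+1) = 2 a_j + \<Theta>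
  with a_0 = 0 has the solution (2^j - 1) \<Theta>, and the number of windows is bounded
  independently of \<open>h\<close>.\<close>

lemma stability:
  assumes T: "real n * h \<le> T" and h\<delta>: "h \<le> \<delta>" and N: "2 * T / \<delta> \<le> real N" and k: "k \<le> n"
  shows "norm (Z k - Y k) \<le> 2^N * (2 * (M + C * B)) * ((real n * h) powr \<beta> * \<sigma>)"
proof -
  define \<Theta> where "\<Theta> = 2 * (M + C * B) * (\<delta> powr \<beta> * \<sigma>)"
  have C0: "0 \<le> C" and M0: "0 \<le> M" using C_ge_1 P M by auto
  have K0: "0 \<le> 2 * (M + C * B)" using C0 M0 B by simp
  have \<Theta>0: "0 \<le> \<Theta>" unfolding \<Theta>_def using K0 \<sigma> by simp
  show ?thesis
  \<comment> \<open>The case distinction preserves the power \<beta> of the total time: a short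
    interval is a single window and keeps its own length, while on a long one \<delta>^\<beta> is at
    most (nh)^\<beta>.\<close>
  proof (cases "real n * h \<le> \<delta>")
    case True
    have "norm (Z k - Y k) \<le> 2 * norm (Z 0 - Y 0) + 2 * (M + C * B) * ((real (n - 0) * h) powr \<beta> * \<sigma>)"
      using True k by (intro window_stability) auto
    also have "\<dots> = 1 * (2 * (M + C * B) * ((real n * h) powr \<beta> * \<sigma>))" using start by simp
    also have "\<dots> \<le> 2^N * (2 * (M + C * B) * ((real n * h) powr \<beta> * \<sigma>))"
      using K0 \<sigma> by (intro mult_right_mono) auto
    finally show ?thesis by (simp only: mult.assoc)
  next
    case False
    \<comment> \<open>The number of grid steps per window. As h \<le> \<delta>, rounding down loses
      at most half of \<delta>, hence the condition N \<ge> 2T/\<delta> on the number of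
      windows.\<close>
    define w where "w = nat \<lfloor>\<delta> / h\<rfloor>"
    have "1 \<le> \<delta> / h" using h h\<delta> by simp
    then have "1 \<le> \<lfloor>\<delta> / h\<rfloor>" by simp
    then have "real w = of_int \<lfloor>\<delta> / h\<rfloor>" "1 \<le> real w" by (auto simp: w_def)
    then have w: "real w \<le> \<delta> / h" "\<delta> / h \<le> 2 * real w"
      using of_int_floor_le[of "\<delta> / h"] real_of_int_floor_add_one_gt[of "\<delta> / h"] by linarith+
    then have wh: "real w * h \<le> \<delta>" "\<delta> / 2 \<le> real w * h" using h by (auto simp: field_simps)
    have chain: "norm (Z i - Y i) \<le> (2^j - 1) * \<Theta>" if "i \<le> n" "i \<le> j * w" for i j
      using that
    proof (induction j arbitrary: i)
      case 0
      then show ?case using start by simp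
    next
      case (Suc j)
      show ?case
      proof (cases "i \<le> j * w")
        case True
        have "(2^j - 1) * \<Theta> \<le> (2^Suc j - 1) * \<Theta>" using \<Theta>0 by (intro mult_right_mono) auto
        then show ?thesis using Suc.IH[OF Suc.prems(1) True] by linarith
      next
        case False
        have "i - j * w \<le> w" using Suc.prems by simp
        then have le: "real (i - j * w) * h \<le> real w * h" using h by (intro mult_right_mono) auto
        have "norm (Z i - Y i) \<le> 2 * norm (Z (j * w) - Y (j * w)) + 2 * (M + C * B) * ((real (i - j * w) * h) powr \<beta> * \<sigma>)"
          using False Suc.prems le wh by (intro window_stability) auto
        also have "2 * (M + C * B) * ((real (i - j * w) * h) powr \<beta> * \<sigma>) \<le> \<Theta>"
          unfolding \<Theta>_def using order_trans[OF le wh(1)] h \<beta> \<sigma> K0 by (intro mult_left_mono mult_right_mono powr_mono2) auto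
        also have "norm (Z (j * w) - Y (j * w)) \<le> (2^j - 1) * \<Theta>"
          using False Suc.prems by (intro Suc.IH) auto
        finally show ?thesis by (simp add: algebra_simps)
      qed
    qed
    have "real n * h \<le> real (N * w) * h"
    proof -
      have "real n * h \<le> T" by (rule T)
      also have "\<dots> \<le> real N * (\<delta> / 2)" using N \<delta> by (simp add: field_simps)
      also have "\<dots> \<le> real N * (real w * h)" using wh by (intro mult_left_mono) auto
      finally show ?thesis by simp
    qed
    then have "n \<le> N * w" using h by (simp del: of_nat_mult)
    then have "norm (Z k - Y k) \<le> (2^N - 1) * \<Theta>" using k by (intro chain) auto
    also have "\<dots> \<le> 2^N * \<Theta>" using \<Theta>0 by (intro mult_right_mono) auto
    also have "\<dots> \<le> 2^N * (2 * (M + C * B) * ((real n * h) powr \<beta> * \<sigma>))"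
      unfolding \<Theta>_def using False \<delta> \<beta> \<sigma> K0 by (intro mult_left_mono mult_right_mono powr_mono2) auto
    finally show ?thesis by (simp only: mult.assoc)
  qed
qed

end

section \<open>Choice of constants and the error bound on fine grids\<close>

lemma small_powr_ex:
  fixes \<alpha> \<eta> :: real
  assumes "0 < \<alpha>" "0 < \<eta>"
  obtains \<delta> where "0 < \<delta>" "\<delta> \<le> 1" "\<delta> powr \<alpha> \<le> \<eta>"
proof
  have "min 1 (\<eta> powr (1 / \<alpha>)) powr \<alpha> \<le> (\<eta> powr (1 / \<alpha>)) powr \<alpha>"
    using assms by (intro powr_mono2) auto
  then show "min 1 (\<eta> powr (1 / \<alpha>)) powr \<alpha> \<le> \<eta>" using assms by (simp add: powr_powr)
qed (use assms in auto)

context rough_field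
begin

text \<open>The constants are chosen in an order that avoids circularity: \<open>L\<close> and
  \<open>N\<close> depend on \<open>C\<close> and the exponents, then \<open>P\<close>,
  \<open>Q\<close>, \<open>M\<close>, then the window length \<delta>, then \<Gamma>, and only then
  the largest admissible mesh, which may depend on \<Gamma>. The margin 1 between the radius of the
  solution and that of \<open>S\<close> is spent half on the accumulated error and half on a single
  Euler step.\<close>

lemma euler_error:
  fixes y :: "real \<Rightarrow> 'e" and x :: "real \<Rightarrow> 'x" and A :: "real \<Rightarrow> real \<Rightarrow> 'a" and \<omega> :: "real \<Rightarrow> real"
  assumes \<alpha>: "1/3 < \<alpha>" and \<beta>: "0 < \<beta>" "\<beta> < 2 * \<alpha>" "1 < \<alpha> + \<beta>" and a: "1 < (2 + a) * \<alpha>" and T: "0 < T"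
    and S_def: "S = cball 0 (R + 1)"
    and chen: "\<And>s t u. 0 \<le> s \<Longrightarrow> s \<le> t \<Longrightarrow> t \<le> u \<Longrightarrow> u \<le> T \<Longrightarrow>
      A s u = A s t + A t u + tens (x t - x s) (x u - x t)"
    and x: "\<And>s t. 0 \<le> s \<Longrightarrow> s \<le> t \<Longrightarrow> t \<le> T \<Longrightarrow> norm (x t - x s) \<le> C * (t - s) powr \<alpha>"
    and A: "\<And>s t. 0 \<le> s \<Longrightarrow> s \<le> t \<Longrightarrow> t \<le> T \<Longrightarrow> norm (A s t) \<le> C' * ((t - s) powr \<alpha>)\<^sup>2"
    and C': "C' + B \<le> C" "0 \<le> B"
    and sums: "\<And>k m h. k < m \<Longrightarrow> 0 < h \<Longrightarrow> real m * h \<le> T \<Longrightarrow>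
      norm (\<Sum>l\<in>{k..<m}. A (real l * h) (real (Suc l) * h)) \<le> B * ((real (m - k) * h) powr \<beta> * h powr (2 * \<alpha> - \<beta>))"
    and y: "\<And>t. 0 \<le> t \<Longrightarrow> t \<le> T \<Longrightarrow> norm (y t) \<le> R"
    and \<omega>: "mono_on {0..T} \<omega>"
    and small: "\<And>\<epsilon>. 0 < \<epsilon> \<Longrightarrow> \<exists>\<eta>>0. \<forall>s t. 0 \<le> s \<longrightarrow> s < t \<longrightarrow> t \<le> T \<longrightarrow> t - s < \<eta> \<longrightarrow>
      norm (J y x A s t) \<le> \<epsilon> * (\<omega> t - \<omega> s)"
  shows "\<exists>\<Gamma> h\<^sub>0. 0 < h\<^sub>0 \<and> (\<forall>h K Z. 0 < h \<and> h \<le> h\<^sub>0 \<and> real K * h \<le> T \<and> Z 0 = y 0 \<and>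
     (\<forall>k<K. Z (Suc k) = Z k + F (Z k) (x (real (Suc k) * h) - x (real k * h))) \<longrightarrow>
     norm (Z K - y (real K * h)) \<le> \<Gamma> * ((real K * h) powr \<beta> * h powr (2 * \<alpha> - \<beta>)))"
proof -
  have C0: "0 \<le> C" using C_ge_1 by simp
  define \<kappa>' where "\<kappa>' = (2/3::real) powr (3 * \<alpha> - 1)"
  define \<mu> where "\<mu> = (2/3::real) powr \<alpha>"
  define q where "q = min ((2 + a) * \<alpha>) (\<alpha> + \<beta>)"
  define \<kappa> where "\<kappa> = (2/3::real) powr (q - 1)"
  have q1: "1 < q" using a \<beta> by (simp add: q_def)
  have lt1: "\<kappa>' < 1" "\<mu> < 1" "\<kappa> < 1"
    unfolding \<kappa>'_def \<mu>_def \<kappa>_def using \<alpha> q1 powr_less_mono2[of \<alpha> "2/3" 1]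
      powr_less_mono2[of "3*\<alpha>-1" "2/3" 1] powr_less_mono2[of "q-1" "2/3" 1] by auto
  define L where "L = 23 * C^6 / (1 - \<kappa>')"
  define N where "N = 12 * C\<^sup>2 / (1 - \<mu>)"
  \<comment> \<open>\<open>P\<close> dominates both the increments of either trajectory, of order 1
    + 2 C^2, and the defect constant \<open>L\<close>.\<close>
  define P where "P = 1 + 2 * C\<^sup>2 + L"
  define Q where "Q = 9 * C^4 * P\<^sup>2"
  define M where "M = P + Q * (1 + B) / ((1 - \<kappa>) / 2)"
  have L0: "0 \<le> L" and N0: "0 \<le> N" using lt1 C0 by (auto simp: L_def N_def)
  then have P1: "1 \<le> P" by (simp add: P_def)
  then have Q0: "0 \<le> Q" by (simp add: Q_def)
  have M0: "P \<le> M" "0 \<le> M" "Q * (1 + B) \<le> M * ((1 - \<kappa>) / 2)"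
  proof -
    have "0 \<le> Q * (1 + B) / ((1 - \<kappa>) / 2)" using Q0 C' lt1 by auto
    then show "P \<le> M" "0 \<le> M" using P1 by (auto simp: M_def)
    have "Q * (1 + B) = Q * (1 + B) / ((1 - \<kappa>) / 2) * ((1 - \<kappa>) / 2)" using lt1 by simp
    also have "\<dots> \<le> M * ((1 - \<kappa>) / 2)" using P1 lt1 by (intro mult_right_mono) (auto simp: M_def)
    finally show "Q * (1 + B) \<le> M * ((1 - \<kappa>) / 2)" .
  qed
  \<comment> \<open>One denominator above all coefficients lets a single \<delta> meet every
    smallness condition; (1 - \<kappa>)/2, being at most 1/2, is the strictest target.\<close>
  define Dn where "Dn = L + N + P + Q + 2 * (M + 2 * C\<^sup>2) + 1"
  define \<eta> where "\<eta> = ((1 - \<kappa>) / 2) / Dn"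
  have Dn: "1 \<le> Dn" "L \<le> Dn" "N \<le> Dn" "P \<le> Dn" "Q \<le> Dn" "2 * (M + 2 * C\<^sup>2) \<le> Dn"
    unfolding Dn_def using L0 N0 P1 Q0 M0(2) by auto
  have \<kappa>0: "0 \<le> \<kappa>" by (simp add: \<kappa>_def)
  have "0 < \<eta>" using lt1 Dn by (simp add: \<eta>_def)
  then obtain \<delta> where \<delta>: "0 < \<delta>" "\<delta> \<le> 1" "\<delta> powr \<alpha> \<le> \<eta>"
    using small_powr_ex[of \<alpha> \<eta>] \<alpha> by auto
  have Dn\<delta>: "k * \<delta> powr \<alpha> \<le> (1 - \<kappa>) / 2" if "k \<le> Dn" for k
  proof -
    have "k * \<delta> powr \<alpha> \<le> Dn * \<eta>" using that \<delta>(3) Dn by (intro mult_mono) auto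
    then show ?thesis using Dn by (simp add: \<eta>_def)
  qed
  have half: "(1 - \<kappa>) / 2 \<le> 1 / 2" using \<kappa>0 by simp
  have \<delta>_le: "L * \<delta> powr \<alpha> \<le> 1" "N * \<delta> powr \<alpha> \<le> 1" "P * \<delta> powr \<alpha> \<le> 1"
    "Q * \<delta> powr \<alpha> \<le> (1 - \<kappa>) / 2" "(M + 2 * C\<^sup>2) * \<delta> powr \<alpha> \<le> 1/2"
    using Dn\<delta>[OF Dn(2)] Dn\<delta>[OF Dn(3)] Dn\<delta>[OF Dn(4)] Dn\<delta>[OF Dn(5)] Dn\<delta>[OF Dn(6)] half by linarith+
  have LN: "23 * C^6 \<le> L * (1 - (2/3) powr (3 * \<alpha> - 1))" "12 * C\<^sup>2 \<le> N * (1 - (2/3) powr \<alpha>)"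
    unfolding \<kappa>'_def[symmetric] \<mu>_def[symmetric] L_def N_def using lt1 by auto
  have C'_le: "C' \<le> C" using C' by simp
  have yS: "y t \<in> S" if "0 \<le> t" "t \<le> T" for t using y[OF that] by (simp add: S_def)
  have AC: "norm (A s t) \<le> C * ((t - s) powr \<alpha>)\<^sup>2" if "0 \<le> s" "s \<le> t" "t \<le> T" for s t
    using A[OF that] mult_right_mono[OF C'_le, of "((t - s) powr \<alpha>)\<^sup>2"] by simp
  have Jy: "norm (J y x A s t) \<le> L * ((t - s) powr \<alpha>)^3" if "0 \<le> s" "s < t" "t \<le> T" "t - s \<le> \<delta>" for s t
  proof (rule solution_expansion[where y = y and x = x and A = A and \<omega> = \<omega> and T = T and N = N and \<delta> = \<delta>])
    show "A s u = A s t + A t u + tens (x t - x s) (x u - x t)" if "0 \<le> s" "s \<le> t" "t \<le> u" "u \<le> T" for s t u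
      by (rule chen[OF that])
    show "\<exists>\<eta>>0. \<forall>s t. 0 \<le> s \<longrightarrow> s < t \<longrightarrow> t \<le> T \<longrightarrow> t - s < \<eta> \<longrightarrow> norm (J y x A s t) \<le> \<epsilon> * (\<omega> t - \<omega> s)"
      if "0 < \<epsilon>" for \<epsilon> by (rule small[OF that])
    show "0 \<le> \<delta>" using \<delta>(1) by simp
  qed (fact \<alpha> yS x AC \<omega> LN \<delta> \<delta>_le that)+
  have incr: "norm (w m - w k) \<le> P * e"
    if "w k \<in> S" "norm (X m - X k) \<le> C * e" "norm (D k m) \<le> C * e\<^sup>2" "0 \<le> e" "e \<le> 1" "L * e \<le> 1"
      "norm (J w X D k m) \<le> L * e^3" for w :: "nat \<Rightarrow> 'e" and X :: "nat \<Rightarrow> 'x" and D and k m e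
  proof -
    have "L * e^3 = (L * e) * e\<^sup>2" by (simp add: power2_eq_square power3_eq_cube)
    also have "\<dots> \<le> 1 * e" using that L0 by (intro mult_mono) (auto simp: power2_eq_square mult_left_le)
    finally have "norm (w m - w k) \<le> e + 2 * C\<^sup>2 * e"
      using increment_le[of w k X m e D] that by simp
    also have "\<dots> \<le> P * e" using L0 that by (simp add: P_def distrib_right)
    finally show ?thesis .
  qed
  define Ns where "Ns = nat \<lceil>2 * T / \<delta>\<rceil>"
  define \<Gamma> where "\<Gamma> = 2^Ns * (2 * (M + C * B))"
  have \<Gamma>0: "0 \<le> \<Gamma>" using M0 C0 C' by (simp add: \<Gamma>_def)
  \<comment> \<open>The first inequality keeps the error of the scheme below 1/2, the second the
    length of one Euler step.\<close>
  have small_h: "\<exists>h\<^sub>0>0. h\<^sub>0 \<le> \<delta> \<and> (\<forall>h. 0 < h \<longrightarrow> h \<le> h\<^sub>0 \<longrightarrow> \<Gamma> * (T powr \<beta> * h powr (2 * \<alpha> - \<beta>)) \<le> 1/2 \<and> C * (C * h powr \<alpha>) \<le> 1/2)"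
  proof -
    have G1: "0 < \<Gamma> * T powr \<beta> + 1" using \<Gamma>0 by (simp add: add_nonneg_pos)
    have G2: "0 < C * C + 1" by (simp add: add_nonneg_pos)
    obtain h1 where h1: "0 < h1" "h1 powr (2 * \<alpha> - \<beta>) \<le> 1 / (2 * (\<Gamma> * T powr \<beta> + 1))"
      using small_powr_ex[of "2 * \<alpha> - \<beta>" "1 / (2 * (\<Gamma> * T powr \<beta> + 1))"] \<beta> G1 by auto
    obtain h2 where h2: "0 < h2" "h2 powr \<alpha> \<le> 1 / (2 * (C * C + 1))"
      using small_powr_ex[of \<alpha> "1 / (2 * (C * C + 1))"] \<alpha> G2 by auto
    have "\<Gamma> * (T powr \<beta> * h powr (2 * \<alpha> - \<beta>)) \<le> 1/2 \<and> C * (C * h powr \<alpha>) \<le> 1/2"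
      if h: "0 < h" "h \<le> min \<delta> (min h1 h2)" for h
    proof
      have "h powr (2 * \<alpha> - \<beta>) \<le> h1 powr (2 * \<alpha> - \<beta>)" using h \<beta> by (intro powr_mono2) auto
      then have "(\<Gamma> * T powr \<beta>) * h powr (2 * \<alpha> - \<beta>) \<le> (\<Gamma> * T powr \<beta> + 1) * (1 / (2 * (\<Gamma> * T powr \<beta> + 1)))"
        using h1 \<Gamma>0 by (intro mult_mono) auto
      also have "\<dots> = 1/2" using G1 by simp
      finally show "\<Gamma> * (T powr \<beta> * h powr (2 * \<alpha> - \<beta>)) \<le> 1/2" by (simp only: mult.assoc)
      have "h powr \<alpha> \<le> h2 powr \<alpha>" using h \<alpha> by (intro powr_mono2) auto
      then have "(C * C) * h powr \<alpha> \<le> (C * C + 1) * (1 / (2 * (C * C + 1)))"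
        using h2 by (intro mult_mono) auto
      also have "\<dots> = 1/2" using G2 by simp
      finally show "C * (C * h powr \<alpha>) \<le> 1/2" by (simp only: mult.assoc)
    qed
    then show ?thesis using h1 h2 \<delta> by (intro exI[of _ "min \<delta> (min h1 h2)"]) auto
  qed
  then obtain h\<^sub>0 where h\<^sub>0: "0 < h\<^sub>0" "h\<^sub>0 \<le> \<delta>"
    "\<And>h. 0 < h \<Longrightarrow> h \<le> h\<^sub>0 \<Longrightarrow> \<Gamma> * (T powr \<beta> * h powr (2 * \<alpha> - \<beta>)) \<le> 1/2"
    "\<And>h. 0 < h \<Longrightarrow> h \<le> h\<^sub>0 \<Longrightarrow> C * (C * h powr \<alpha>) \<le> 1/2"
    by blast
  have "norm (Z K - y (real K * h)) \<le> \<Gamma> * ((real K * h) powr \<beta> * h powr (2 * \<alpha> - \<beta>))"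
    if h: "0 < h" "h \<le> h\<^sub>0" and K: "real K * h \<le> T" and Z0: "Z 0 = y 0"
      and Z: "\<And>k. k < K \<Longrightarrow> Z (Suc k) = Z k + F (Z k) (x (real (Suc k) * h) - x (real k * h))" for h K Z
  proof -
    define Y where "Y = (\<lambda>k. y (real k * h))"
    define X where "X = (\<lambda>k. x (real k * h))"
    define D where "D = (\<lambda>k m. A (real k * h) (real m * h))"
    define s where "s = (\<lambda>k m. \<Sum>l\<in>{k..<m}. A (real l * h) (real (Suc l) * h))"
    \<comment> \<open>With area \<open>D'\<close>, which vanishes on single grid steps, the Euler scheme is a Milstein scheme.\<close>
    define D' where "D' = (\<lambda>k m. D k m - s k m)"
    define \<sigma> where "\<sigma> = h powr (2 * \<alpha> - \<beta>)"
    have h\<delta>: "h \<le> \<delta>" using h h\<^sub>0(2) by linarith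
    have h1: "h \<le> 1" using h h\<^sub>0 \<delta> by linarith
    have grid: "0 \<le> real k * h" "real k * h \<le> real m * h" "real m * h \<le> T"
      "real m * h - real k * h = real (m - k) * h" if "k \<le> m" "m \<le> K" for k m
    proof -
      show "0 \<le> real k * h" "real k * h \<le> real m * h" using that h by (auto intro: mult_right_mono)
      have "real m * h \<le> real K * h" using that h by (intro mult_right_mono) auto
      then show "real m * h \<le> T" using K by linarith
      show "real m * h - real k * h = real (m - k) * h" using that by (simp add: of_nat_diff algebra_simps)
    qed
    have X_le: "norm (X m - X k) \<le> C * (real (m - k) * h) powr \<alpha>" if "k < m" "m \<le> K" for k m
      using x[of "real k * h" "real m * h"] grid[of k m] that by (simp add: X_def)
    have D_le': "norm (D k m) \<le> C' * ((real (m - k) * h) powr \<alpha>)\<^sup>2"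
      and D_le: "norm (D k m) \<le> C * ((real (m - k) * h) powr \<alpha>)\<^sup>2" if "k < m" "m \<le> K" for k m
      using A[of "real k * h" "real m * h"] AC[of "real k * h" "real m * h"] grid[of k m] that by (auto simp: D_def)
    have s_le: "norm (s k m) \<le> B * ((real (m - k) * h) powr \<beta> * \<sigma>)" if "k < m" "m \<le> K" for k m
      unfolding s_def \<sigma>_def using sums[of k m h] that h grid[of k m] by simp
    have D'_le: "norm (D' k m) \<le> C * ((real (m - k) * h) powr \<alpha>)\<^sup>2" if "k < m" "m \<le> K" for k m
    proof -
      define t where "t = real (m - k) * h"
      have "1 * h \<le> real (m - k) * h" using that h by (intro mult_right_mono) auto
      then have ht: "h \<le> t" "0 < t" using h by (auto simp: t_def)
      \<comment> \<open>An interval with at least one step has t \<ge> h. As 2\<alpha> - \<beta> is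
        positive, the sums of one-step areas thus inherit the bound of order 2\<alpha> in the length
        \<open>t\<close>.\<close>
      have "t powr \<beta> * \<sigma> \<le> t powr \<beta> * t powr (2 * \<alpha> - \<beta>)"
        unfolding \<sigma>_def using ht h \<beta> by (intro mult_left_mono powr_mono2) auto
      also have "\<dots> = (t powr \<alpha>)\<^sup>2" using ht by (simp add: powr_add[symmetric] power2_eq_square)
      finally have "norm (s k m) \<le> B * (t powr \<alpha>)\<^sup>2"
        using s_le[OF that] C'(2) unfolding t_def by (meson mult_left_mono order_trans)
      then have "norm (D' k m) \<le> (C' + B) * (t powr \<alpha>)\<^sup>2"
        using D_le'[OF that] norm_triangle_ineq4[of "D k m" "s k m"] by (simp add: D'_def t_def distrib_right)
      also have "\<dots> \<le> C * (t powr \<alpha>)\<^sup>2" using C' by (intro mult_right_mono) auto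
      finally show ?thesis by (simp add: t_def)
    qed
    have chenD: "D k m = D k l + D l m + tens (X l - X k) (X m - X l)" if "k \<le> l" "l \<le> m" "m \<le> K" for k l m
      unfolding D_def X_def
      using grid(1)[of k m] grid(2)[of k l] grid(2)[of l m] grid(3)[of l m] that by (intro chen) linarith+
    have chenD': "D' k m = D' k l + D' l m + tens (X l - X k) (X m - X l)" if "k \<le> l" "l \<le> m" "m \<le> K" for k l m
    proof -
      \<comment> \<open>Subtracting an additive function of intervals does not disturb Chen's
        relation.\<close>
      have "s k m = s k l + s l m" unfolding s_def using that by (simp add: sum.atLeastLessThan_concat)
      then show ?thesis using chenD[OF that] by (simp add: D'_def)
    qed
    have JZ: "J Z X D' k (Suc k) = 0" if "k < K" for k
      using Z[OF that] linear_0[OF linear_G, of "Z k"] by (simp add: J_def X_def D'_def s_def D_def)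
    have JY: "norm (J Y X D k m) \<le> L * ((real (m - k) * h) powr \<alpha>)^3" if "k < m" "m \<le> K" "real (m - k) * h \<le> \<delta>" for k m
    proof -
      have "real k * h < real m * h" using that h by simp
      then show ?thesis
        using Jy[of "real k * h" "real m * h"] grid[of k m] that
        by (simp add: J_def Y_def X_def D_def)
    qed
    have \<delta>e: "(real (m - k) * h) powr \<alpha> \<le> 1" "L * (real (m - k) * h) powr \<alpha> \<le> 1" if "real (m - k) * h \<le> \<delta>" for k m
    proof -
      have "(real (m - k) * h) powr \<alpha> \<le> \<delta> powr \<alpha>" using that h \<alpha> by (intro powr_mono2) auto
      moreover have "\<delta> powr \<alpha> \<le> 1" using \<delta> \<alpha> powr_mono2[of \<alpha> \<delta> 1] by simp
      ultimately show "(real (m - k) * h) powr \<alpha> \<le> 1" "L * (real (m - k) * h) powr \<alpha> \<le> 1"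
        using mult_left_mono[of "(real (m - k) * h) powr \<alpha>" "\<delta> powr \<alpha>" L] L0 \<delta>_le(1) by linarith+
    qed
    have YS: "Y k \<in> S" if "k \<le> K" for k
      unfolding Y_def using yS grid[of k k] that by auto
    \<comment> \<open>The bound is stated up to an arbitrary index \<open>n\<close>, under the
      proviso that the scheme has stayed in \<open>S\<close> so far. This is the form needed for the
      induction that establishes the proviso.\<close>
    have err: "norm (Z k - Y k) \<le> \<Gamma> * ((real n * h) powr \<beta> * \<sigma>)"
      if n: "n \<le> K" and ZS: "\<And>k. k \<le> n \<Longrightarrow> Z k \<in> S" and k: "k \<le> n" for n k
    proof -
      have JZ_le: "norm (J Z X D' k m) \<le> L * ((real (m - k) * h) powr \<alpha>)^3"
        if "k < m" "m \<le> n" "real (m - k) * h \<le> \<delta>" for k m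
      proof -
        have "norm (J Z X D' k m) \<le> L * ((real (m - k) * h) powr \<alpha>)^3 + (1 + N * (real (m - k) * h) powr \<alpha>) * (0 - 0)"
        proof (rule local_expansion[where \<delta> = \<delta> and M = n and E = "\<lambda>_. 0"])
          show "D' k m = D' k l + D' l m + tens (X l - X k) (X m - X l)" if "k \<le> l" "l \<le> m" "m \<le> n" for k l m
            using chenD' that n by (meson order_trans)
          show "norm (J Z X D' k (Suc k)) \<le> 0 - 0" if "k < n" for k using JZ[of k] that n by simp
          show "norm (X m - X k) \<le> C * (real (m - k) * h) powr \<alpha>"
            "norm (D' k m) \<le> C * ((real (m - k) * h) powr \<alpha>)\<^sup>2" if "k < m" "m \<le> n" for k m
            using X_le[of k m] D'_le[of k m] that n by simp_all
          show "0 \<le> \<delta>" using \<delta>(1) by simp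
        qed (use \<alpha> h(1) ZS LN \<delta>(2) \<delta>_le(1,2) that in \<open>simp_all only: diff_0_right zero_le_one\<close>)
        then show ?thesis by simp
      qed
      interpret rough_pair S F DF G tens C a \<alpha> \<beta> h \<delta> P B M \<sigma> q n Y Z X D D'
      proof (intro rough_pair.intro rough_pair_axioms.intro)
        show "rough_field S F DF G tens C a" by (rule rough_field_axioms)
        show "q = min ((2 + a) * \<alpha>) (\<alpha> + \<beta>)" by (rule q_def)
        show "1 < q" "0 < \<alpha>" "0 < \<beta>" "\<beta> \<le> 2 * \<alpha>" "0 < h" "0 \<le> \<sigma>" "1 \<le> P" "0 \<le> B" "0 < \<delta>" "\<delta> \<le> 1"
          using q1 \<alpha> \<beta> h P1 C' \<delta> by (auto simp: \<sigma>_def)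
        show "P * \<delta> powr \<alpha> \<le> 1" "(M + 2 * C\<^sup>2) * \<delta> powr \<alpha> \<le> 1/2" "P \<le> M"
          by (fact \<delta>_le M0)+
        show "9 * C^4 * P\<^sup>2 * \<delta> powr \<alpha> \<le> (1 - (2/3) powr (q - 1)) / 2"
          using \<delta>_le(4) by (simp only: Q_def \<kappa>_def)
        show "9 * C^4 * P\<^sup>2 * (1 + B) \<le> M * ((1 - (2/3) powr (q - 1)) / 2)"
          using M0(3) by (simp only: Q_def \<kappa>_def)
        show "Z 0 = Y 0" using Z0 by (simp add: Y_def)
        fix k l m :: nat
        show "Y k \<in> S" "Z k \<in> S" if "k \<le> n" using that YS ZS n by auto
        show "D k m = D k l + D l m + tens (X l - X k) (X m - X l)"
          "D' k m = D' k l + D' l m + tens (X l - X k) (X m - X l)" if "k \<le> l" "l \<le> m" "m \<le> n"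
          using that chenD[of k l m] chenD'[of k l m] n by auto
        show "norm (X m - X k) \<le> C * (real (m - k) * h) powr \<alpha>"
          "norm (D k m) \<le> C * ((real (m - k) * h) powr \<alpha>)\<^sup>2"
          "norm (D' k m) \<le> C * ((real (m - k) * h) powr \<alpha>)\<^sup>2"
          "norm (D' k m - D k m) \<le> B * ((real (m - k) * h) powr \<beta> * \<sigma>)" if "k < m" "m \<le> n"
          using that X_le[of k m] D_le[of k m] D'_le[of k m] s_le[of k m] n by (auto simp: D'_def)
        show "norm (Y m - Y k) \<le> P * (real (m - k) * h) powr \<alpha>"
          "norm (Z m - Z k) \<le> P * (real (m - k) * h) powr \<alpha>"
          "norm (J Y X D k m) \<le> P * ((real (m - k) * h) powr \<alpha>)^3"
          if km: "k < m" "m \<le> n" "real (m - k) * h \<le> \<delta>"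
        proof -
          have mK: "m \<le> K" using km n by simp
          show "norm (Y m - Y k) \<le> P * (real (m - k) * h) powr \<alpha>"
            by (rule incr[OF YS X_le D_le _ \<delta>e JY]) (use km mK in auto)
          show "norm (Z m - Z k) \<le> P * (real (m - k) * h) powr \<alpha>"
            by (rule incr[OF ZS X_le D'_le _ \<delta>e JZ_le]) (use km mK in auto)
          have "L * ((real (m - k) * h) powr \<alpha>)^3 \<le> P * ((real (m - k) * h) powr \<alpha>)^3"
            by (intro mult_right_mono) (auto simp: P_def)
          then show "norm (J Y X D k m) \<le> P * ((real (m - k) * h) powr \<alpha>)^3"
            using JY[OF km(1) mK km(3)] by linarith
        qed
        show "norm (J Z X D' k (Suc k) - J Y X D k (Suc k)) \<le> P * (h powr q * \<sigma>)" if "k < n"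
        proof -
          have "h \<le> \<delta>" using h h\<^sub>0 by linarith
          then have "norm (J Z X D' k (Suc k) - J Y X D k (Suc k)) \<le> L * (h powr \<alpha>)^3"
            using JZ[of k] JY[of k "Suc k"] that n by simp
          \<comment> \<open>Over one step \<open>J Z\<close> vanishes, so the difference is the
            third order defect of the solution. The splitting 3\<alpha> = (\<alpha> + \<beta>) +
            (2\<alpha> - \<beta>) extracts exactly the factor \<sigma>.\<close>
          also have "(h powr \<alpha>)^3 = h powr (\<alpha> + \<beta>) * \<sigma>"
            unfolding \<sigma>_def using h by (simp add: powr_cube powr_add[symmetric])
          also have "L * (h powr (\<alpha> + \<beta>) * \<sigma>) \<le> P * (h powr q * \<sigma>)"
            using P1 h h1 L0 by (intro mult_mono mult_right_mono powr_mono') (auto simp: P_def q_def \<sigma>_def)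
          finally show ?thesis .
        qed
      qed
      have "real n * h \<le> T" using grid[of n n] n by simp
      moreover have "2 * T / \<delta> \<le> real Ns" unfolding Ns_def by linarith
      ultimately show ?thesis
        unfolding \<Gamma>_def using h\<delta> k by (intro stability) auto
    qed
    \<comment> \<open>Continuation argument: while the scheme is in \<open>S\<close>, its error is
      at most 1/2, and the next step moves it by at most 1/2, so it remains within distance 1 of the
      ball of radius \<open>R\<close>.\<close>
    have ZS: "\<forall>k\<le>m. Z k \<in> S" if "m \<le> K" for m
      using that
    proof (induction m)
      case 0
      then show ?case using YS[of 0] Z0 by (simp add: Y_def)
    next
      case (Suc m)
      then have IH: "\<And>k. k \<le> m \<Longrightarrow> Z k \<in> S" and mK: "m < K" by auto
      have "norm (Z m - Y m) \<le> \<Gamma> * ((real m * h) powr \<beta> * \<sigma>)" using err[of m m] IH mK by simp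
      also have "\<dots> \<le> \<Gamma> * (T powr \<beta> * \<sigma>)"
        using \<Gamma>0 \<beta> grid[of m m] mK by (intro mult_left_mono mult_right_mono powr_mono2) (auto simp: \<sigma>_def)
      also have "\<dots> \<le> 1/2" unfolding \<sigma>_def using h\<^sub>0(3) h by blast
      finally have 1: "norm (Z m - Y m) \<le> 1/2" .
      have "norm (F (Z m) (X (Suc m) - X m)) \<le> C * (C * h powr \<alpha>)"
        using F_bound[OF IH[of m], of "X (Suc m) - X m"] X_le[of m "Suc m"] mK C0
        by (simp add: order_trans[OF _ mult_left_mono])
      also have "\<dots> \<le> 1/2" using h\<^sub>0(4) h by blast
      finally have 2: "norm (F (Z m) (X (Suc m) - X m)) \<le> 1/2" .
      have 3: "norm (Y m) \<le> R" unfolding Y_def using y grid[of m m] mK by simp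
      have "Z (Suc m) = (Z m - Y m) + F (Z m) (X (Suc m) - X m) + Y m"
        using Z[OF mK] by (simp add: X_def)
      then have "norm (Z (Suc m)) \<le> norm (Z m - Y m) + norm (F (Z m) (X (Suc m) - X m)) + norm (Y m)"
        by (metis norm_triangle_ineq norm_triangle_le add_right_mono)
      then have "Z (Suc m) \<in> S" using 1 2 3 by (simp add: S_def)
      then show ?case using IH by (auto simp: le_Suc_eq)
    qed
    show ?thesis
      using err[of K K] ZS[of K] by (simp add: Y_def \<sigma>_def)
  qed
  note bound = this
  show ?thesis
  proof (rule exI[of _ \<Gamma>], rule exI[of _ h\<^sub>0], intro conjI allI impI)
    show "0 < h\<^sub>0" by (rule h\<^sub>0(1))
    fix h K Z
    assume "0 < h \<and> h \<le> h\<^sub>0 \<and> real K * h \<le> T \<and> Z 0 = y 0 \<and>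
      (\<forall>k<K. Z (Suc k) = Z k + F (Z k) (x (real (Suc k) * h) - x (real k * h)))"
    then show "norm (Z K - y (real K * h)) \<le> \<Gamma> * ((real K * h) powr \<beta> * h powr (2 * \<alpha> - \<beta>))"
      by (elim conjE) (rule bound, auto)
  qed
qed

end

section \<open>Hoelder functions and the four-point inequality\<close>

lemma locally_holder_imp_continuous_on:
  assumes "locally_holder a g" "0 < a"
  shows "continuous_on K g"
proof -
  have "isCont g u" for u
  proof -
    obtain e C where e: "0 < e" and C: "\<And>v w. v \<in> ball u e \<Longrightarrow> w \<in> ball u e \<Longrightarrow> dist (g v) (g w) \<le> C * dist v w powr a"
      using assms(1) unfolding locally_holder_def holder_on_def by meson
    have "((\<lambda>v. C * dist v u powr a) \<longlongrightarrow> 0) (at u)"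
      using assms(2) by (auto intro!: tendsto_eq_intros)
    moreover have "\<forall>\<^sub>F v in at u. dist (g v) (g u) \<le> C * dist v u powr a"
      using e by (auto simp: eventually_at dist_commute intro!: exI[of _ e] C)
    ultimately have "((\<lambda>v. dist (g v) (g u)) \<longlongrightarrow> 0) (at u)"
      by (intro tendsto_sandwich[of "\<lambda>_. 0" "\<lambda>v. dist (g v) (g u)" "at u" "\<lambda>v. C * dist v u powr a"]) auto
    then show "isCont g u" unfolding isCont_def using tendsto_dist_iff by blast
  qed
  then show ?thesis by (simp add: continuous_at_imp_continuous_on)
qed

text \<open>With a Lebesgue number \<rho> of a finite subcover, points closer than \<rho> lie in a
  common ball and obey its local constant. For points further apart the oscillation of
  \<open>g\<close> on \<open>K\<close>, divided by \<rho>^a, serves as a constant.\<close>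

lemma locally_holder_imp_holder_on:
  assumes g: "locally_holder a g" and a: "0 < a" and K: "compact K"
  shows "holder_on a K g"
proof -
  obtain e C where e: "\<And>u. 0 < e u"
    and C: "\<And>u v w. v \<in> ball u (e u) \<Longrightarrow> w \<in> ball u (e u) \<Longrightarrow> dist (g v) (g w) \<le> C u * dist v w powr a"
    using g unfolding locally_holder_def holder_on_def by metis
  obtain U where U: "finite U" "K \<subseteq> (\<Union>u\<in>U. ball u (e u))"
  proof (rule compactE_image[OF K, of UNIV "\<lambda>u. ball u (e u)"])
    show "K \<subseteq> (\<Union>c\<in>UNIV. ball c (e c))"
    proof
      fix c assume "c \<in> K"
      have "c \<in> ball c (e c)" using e by simp
      then show "c \<in> (\<Union>c\<in>UNIV. ball c (e c))" by blast
    qed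
  qed auto
  obtain \<rho> where \<rho>: "0 < \<rho>" "\<And>v. v \<in> K \<Longrightarrow> \<exists>G\<in>(\<lambda>u. ball u (e u)) ` U. ball v \<rho> \<subseteq> G"
    using Heine_Borel_lemma[OF K, of "(\<lambda>u. ball u (e u)) ` U"] U by auto
  have "bounded (g ` K)"
    using K locally_holder_imp_continuous_on[OF g a] by (intro compact_imp_bounded compact_continuous_image)
  then obtain M where M: "\<And>v w. v \<in> K \<Longrightarrow> w \<in> K \<Longrightarrow> dist (g v) (g w) \<le> M"
    by (metis bounded_two_points imageI)
  define L where "L = (\<Sum>u\<in>U. \<bar>C u\<bar>) + \<bar>M\<bar> / \<rho> powr a"
  have "dist (g v) (g w) \<le> L * dist v w powr a" if vw: "v \<in> K" "w \<in> K" for v w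
  proof (cases "dist v w < \<rho>")
    case True
    then obtain u where u: "u \<in> U" "v \<in> ball u (e u)" "w \<in> ball u (e u)"
      using \<rho>(2)[OF vw(1)] \<rho>(1) by (auto simp: subset_iff)
    have "C u \<le> (\<Sum>u\<in>U. \<bar>C u\<bar>)"
      using member_le_sum[of u U "\<lambda>u. \<bar>C u\<bar>"] u U by auto
    also have "\<dots> \<le> L" by (simp add: L_def)
    finally show ?thesis using C[OF u(2,3)] by (meson mult_right_mono order_trans powr_ge_zero)
  next
    case False
    then have "\<rho> powr a \<le> dist v w powr a" using \<rho> a by (intro powr_mono2) auto
    then have "\<bar>M\<bar> / \<rho> powr a * \<rho> powr a \<le> L * dist v w powr a"
      by (intro mult_mono) (auto simp: L_def sum_nonneg)
    then show ?thesis using M[OF vw] \<rho> by simp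
  qed
  then show ?thesis unfolding holder_on_def by blast
qed

lemma holder_on_imp_bounded:
  fixes g :: "'a::real_normed_vector \<Rightarrow> real"
  assumes "holder_on a S g" "bounded S" "0 < a"
  obtains K where "0 \<le> K" "\<And>u. u \<in> S \<Longrightarrow> \<bar>g u\<bar> \<le> K"
    "\<And>u v. u \<in> S \<Longrightarrow> v \<in> S \<Longrightarrow> \<bar>g u - g v\<bar> \<le> K * norm (u - v) powr a"
proof -
  obtain C where C: "\<And>u v. u \<in> S \<Longrightarrow> v \<in> S \<Longrightarrow> \<bar>g u - g v\<bar> \<le> C * norm (u - v) powr a"
    using assms(1) unfolding holder_on_def dist_norm real_norm_def by blast
  obtain D where D: "\<And>u v. u \<in> S \<Longrightarrow> v \<in> S \<Longrightarrow> norm (u - v) \<le> D"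
    using assms(2) by (metis bounded_two_points dist_norm)
  \<comment> \<open>The conditional form admits an empty \<open>S\<close>, for which
    \<open>u0\<close> is arbitrary.\<close>
  obtain u0 where u0: "S \<noteq> {} \<Longrightarrow> u0 \<in> S" by blast
  define K where "K = \<bar>C\<bar> + \<bar>g u0\<bar> + \<bar>C\<bar> * D powr a"
  have "\<bar>g u\<bar> \<le> K" if "u \<in> S" for u
  proof -
    have u0S: "u0 \<in> S" using u0 that by blast
    have "\<bar>g u - g u0\<bar> \<le> \<bar>C\<bar> * norm (u - u0) powr a"
      using C[OF that u0S] by (meson abs_ge_self mult_right_mono order_trans powr_ge_zero)
    also have "\<dots> \<le> \<bar>C\<bar> * D powr a"
      using D[OF that u0S] assms(3) by (intro mult_left_mono powr_mono2) auto
    finally show ?thesis unfolding K_def by linarith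
  qed
  moreover have "\<bar>g u - g v\<bar> \<le> K * norm (u - v) powr a" if "u \<in> S" "v \<in> S" for u v
  proof -
    have "C \<le> K" unfolding K_def by (smt (verit) mult_nonneg_nonneg powr_ge_zero)
    then show ?thesis using C[OF that] by (meson mult_right_mono order_trans powr_ge_zero)
  qed
  moreover have "0 \<le> K" by (simp add: K_def)
  ultimately show thesis using that by blast
qed

section \<open>Directional derivatives and the mean value theorem\<close>

text \<open>The coordinate form is linear in \<open>w\<close> for every \<open>g\<close>, and bounds
  on partial derivatives transfer to it directly. It is the Frechet derivative wherever
  \<open>g\<close> is differentiable.\<close>

definition dir_deriv :: "(real^'n::finite \<Rightarrow> real) \<Rightarrow> real^'n \<Rightarrow> real^'n \<Rightarrow> real" where
  "dir_deriv g v w = (\<Sum>h\<in>UNIV. partial_deriv h g v * w $ h)"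

lemma has_derivative_dir_deriv:
  assumes "g differentiable (at v)"
  shows "(g has_derivative dir_deriv g v) (at v)"
proof -
  have d: "(g has_derivative frechet_derivative g (at v)) (at v)"
    using assms frechet_derivative_works by blast
  then have l: "linear (frechet_derivative g (at v))" by (rule has_derivative_linear)
  have "frechet_derivative g (at v) w = dir_deriv g v w" for w
  proof -
    have "frechet_derivative g (at v) w = frechet_derivative g (at v) (\<Sum>h\<in>UNIV. w $ h *\<^sub>R axis h 1)"
      by (metis basis_expansion scalar_mult_eq_scaleR)
    also have "\<dots> = (\<Sum>h\<in>UNIV. w $ h * partial_deriv h g v)"
      by (simp add: linear_sum[OF l] linear_cmul[OF l] partial_deriv_def)
    finally show ?thesis by (simp add: dir_deriv_def mult.commute)
  qed
  then show ?thesis using d by presburger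
qed

lemma linear_dir_deriv: "linear (dir_deriv g v)"
  by (rule linearI) (simp_all add: dir_deriv_def algebra_simps sum.distrib sum_distrib_left)

lemma abs_inner_sum_le:
  fixes w :: "real^'n::finite"
  assumes "\<And>h. \<bar>p h\<bar> \<le> K"
  shows "\<bar>\<Sum>h\<in>UNIV. p h * w $ h\<bar> \<le> real CARD('n) * K * norm w"
proof -
  have "\<bar>p h * w $ h\<bar> \<le> K * norm w" for h
    unfolding abs_mult using assms[of h] component_le_norm_cart[of w h] by (intro mult_mono) auto
  then have "\<bar>\<Sum>h\<in>UNIV. p h * w $ h\<bar> \<le> (\<Sum>h\<in>(UNIV::'n set). K * norm w)"
    by (intro order_trans[OF sum_abs] sum_mono)
  then show ?thesis by simp
qed

lemma dir_deriv_le: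
  fixes w :: "real^'n::finite"
  assumes "\<And>h. \<bar>partial_deriv h g v\<bar> \<le> K"
  shows "\<bar>dir_deriv g v w\<bar> \<le> real CARD('n) * K * norm w"
  unfolding dir_deriv_def by (rule abs_inner_sum_le[OF assms])

lemma dir_deriv_diff_le:
  fixes w :: "real^'n::finite"
  assumes "\<And>h. \<bar>partial_deriv h g u - partial_deriv h g v\<bar> \<le> K"
  shows "\<bar>dir_deriv g u w - dir_deriv g v w\<bar> \<le> real CARD('n) * K * norm w"
  using abs_inner_sum_le[of "\<lambda>h. partial_deriv h g u - partial_deriv h g v" K w] assms
  by (simp add: dir_deriv_def left_diff_distrib sum_subtractf)

lemma has_derivative_along_line:
  assumes "\<And>v. g differentiable (at v)"
  shows "((\<lambda>s. g (u + s *\<^sub>R w)) has_derivative (\<lambda>r. r * dir_deriv g (u + s *\<^sub>R w) w)) (at s within I)"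
proof -
  have "((\<lambda>s. g (u + s *\<^sub>R w)) has_derivative (\<lambda>r. dir_deriv g (u + s *\<^sub>R w) (r *\<^sub>R w))) (at s within I)"
    by (rule has_derivative_compose[OF _ has_derivative_dir_deriv[OF assms]])
      (auto intro!: derivative_eq_intros)
  then show ?thesis by (simp add: linear_cmul[OF linear_dir_deriv])
qed

lemma line_in_convex:
  assumes "convex S" "u \<in> S" "v \<in> S" "0 \<le> s" "s \<le> 1"
  shows "u + s *\<^sub>R (v - u) \<in> S"
proof -
  have "u + s *\<^sub>R (v - u) = (1 - s) *\<^sub>R u + s *\<^sub>R v" by (simp add: algebra_simps)
  then show ?thesis using assms convexD_alt by metis
qed

lemma mvt_dir_deriv:
  assumes "\<And>v. g differentiable (at v)" "convex S" "u \<in> S" "v \<in> S"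
  obtains s where "0 < s" "s < 1" "u + s *\<^sub>R (v - u) \<in> S" "g v - g u = dir_deriv g (u + s *\<^sub>R (v - u)) (v - u)"
proof -
  have "\<exists>s\<in>{0<..<1}. g (u + 1 *\<^sub>R (v - u)) - g (u + 0 *\<^sub>R (v - u)) = (1 - 0) * dir_deriv g (u + s *\<^sub>R (v - u)) (v - u)"
    by (rule mvt_simple[of 0 1 "\<lambda>s. g (u + s *\<^sub>R (v - u))" "\<lambda>s r. r * dir_deriv g (u + s *\<^sub>R (v - u)) (v - u)"])
      (auto intro: has_derivative_along_line assms)
  then show thesis using that line_in_convex[OF assms(2-4)] by auto
qed

text \<open>The four-point inequality is what a \<open>C\<^sup>1\<close> function with \<open>a\<close>-Hoelder derivative satisfies on a
  convex set; unlike derivatives, it passes to products by elementary algebra.\<close>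
definition four_point :: "'e::real_normed_vector set \<Rightarrow> real \<Rightarrow> real \<Rightarrow> ('e \<Rightarrow> real) \<Rightarrow> bool" where
  "four_point S a K g \<longleftrightarrow> 0 \<le> K \<and> (\<forall>u\<in>S. \<bar>g u\<bar> \<le> K) \<and>
     (\<forall>u\<in>S. \<forall>v\<in>S. \<bar>g u - g v\<bar> \<le> K * norm (u - v)) \<and>
     (\<forall>z\<in>S. \<forall>z'\<in>S. \<forall>y\<in>S. \<forall>y'\<in>S. \<forall>\<epsilon>. norm (z' - z) \<le> \<epsilon> \<longrightarrow> norm (y' - y) \<le> \<epsilon> \<longrightarrow> \<epsilon> \<le> 1 \<longrightarrow>
        \<bar>(g z' - g z) - (g y' - g y)\<bar> \<le> K * (norm ((z' - y') - (z - y)) + \<epsilon> powr a * norm (z - y)))"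

lemma four_pointD:
  assumes "four_point S a K g"
  shows "0 \<le> K" "u \<in> S \<Longrightarrow> \<bar>g u\<bar> \<le> K" "u \<in> S \<Longrightarrow> v \<in> S \<Longrightarrow> \<bar>g u - g v\<bar> \<le> K * norm (u - v)"
    "z \<in> S \<Longrightarrow> z' \<in> S \<Longrightarrow> y \<in> S \<Longrightarrow> y' \<in> S \<Longrightarrow> norm (z' - z) \<le> \<epsilon> \<Longrightarrow> norm (y' - y) \<le> \<epsilon> \<Longrightarrow> \<epsilon> \<le> 1 \<Longrightarrow>
      \<bar>(g z' - g z) - (g y' - g y)\<bar> \<le> K * (norm ((z' - y') - (z - y)) + \<epsilon> powr a * norm (z - y))"
  using assms unfolding four_point_def by blast+

lemma four_point_mono:
  assumes g: "four_point S a K g" and "K \<le> K'"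
  shows "four_point S a K' g"
proof -
  have le: "b \<le> K * c \<Longrightarrow> 0 \<le> c \<Longrightarrow> b \<le> K' * c" for b c
    using assms(2) by (meson mult_right_mono order_trans)
  show ?thesis
    unfolding four_point_def
  proof (intro conjI ballI allI impI)
    show "0 \<le> K'" using four_pointD(1)[OF g] assms(2) by linarith
  qed (use four_pointD[OF g] assms(2) in \<open>auto intro!: le intro: order_trans\<close>)
qed

text \<open>The mean value theorem is applied once, to the difference of \<open>g\<close> along the
  segments from \<open>y'\<close> to \<open>z'\<close> and from \<open>y\<close> to
  \<open>z\<close>, so both derivatives are taken at the same parameter \<open>s\<close>. The points
  \<open>W' s\<close> and \<open>W s\<close> differ by a convex combination of \<open>y' - y\<close>
  and \<open>z' - z\<close>, hence by at most \<epsilon>, and the Hoelder bound gives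
  \<epsilon>^a.\<close>

lemma four_point_C1:
  fixes g :: "real^'n::finite \<Rightarrow> real"
  assumes diff: "\<And>v. g differentiable (at v)" and S: "convex S" and a: "0 \<le> a"
    and K: "0 \<le> K" "\<And>u. u \<in> S \<Longrightarrow> \<bar>g u\<bar> \<le> K" "\<And>u h. u \<in> S \<Longrightarrow> \<bar>partial_deriv h g u\<bar> \<le> K"
    and holder: "\<And>u v h. u \<in> S \<Longrightarrow> v \<in> S \<Longrightarrow>
      \<bar>partial_deriv h g u - partial_deriv h g v\<bar> \<le> K * norm (u - v) powr a"
  shows "four_point S a (real CARD('n) * K) g"
  unfolding four_point_def
proof (intro conjI ballI allI impI)
  have card: "1 \<le> real CARD('n)"
    by (metis One_nat_def Suc_leI of_nat_1 of_nat_le_iff zero_less_card_finite)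
  show "0 \<le> real CARD('n) * K" using K by simp
  show "\<bar>g u\<bar> \<le> real CARD('n) * K" if "u \<in> S" for u
    using K(2)[OF that] mult_right_mono[OF card K(1)] by simp
  show "\<bar>g u - g v\<bar> \<le> real CARD('n) * K * norm (u - v)" if uv: "u \<in> S" "v \<in> S" for u v
  proof -
    obtain s where "v + s *\<^sub>R (u - v) \<in> S" "g u - g v = dir_deriv g (v + s *\<^sub>R (u - v)) (u - v)"
      using mvt_dir_deriv[OF diff S uv(2,1)] by metis
    then show ?thesis using dir_deriv_le K(3) by metis
  qed
  fix z z' y y' \<epsilon>
  assume in_S: "z \<in> S" "z' \<in> S" "y \<in> S" "y' \<in> S" and le: "norm (z' - z) \<le> \<epsilon>" "norm (y' - y) \<le> \<epsilon>" "\<epsilon> \<le> 1"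
  define W where "W = (\<lambda>s::real. y + s *\<^sub>R (z - y))"
  define W' where "W' = (\<lambda>s::real. y' + s *\<^sub>R (z' - y'))"
  have "\<exists>s\<in>{0<..<1}. (g (W' 1) - g (W 1)) - (g (W' 0) - g (W 0))
      = (1 - 0) * dir_deriv g (W' s) (z' - y') - (1 - 0) * dir_deriv g (W s) (z - y)"
    by (rule mvt_simple[of 0 1 "\<lambda>s. g (W' s) - g (W s)"
          "\<lambda>s r. r * dir_deriv g (W' s) (z' - y') - r * dir_deriv g (W s) (z - y)"])
      (auto simp: W_def W'_def intro!: has_derivative_diff has_derivative_along_line diff)
  then obtain s where s: "0 < s" "s < 1" and
    eq: "(g z' - g z) - (g y' - g y) = dir_deriv g (W' s) (z' - y') - dir_deriv g (W s) (z - y)"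
    by (auto simp: W_def W'_def)
  have WS: "W s \<in> S" "W' s \<in> S" unfolding W_def W'_def using s in_S by (auto intro!: line_in_convex[OF S])
  have "W' s - W s = (1 - s) *\<^sub>R (y' - y) + s *\<^sub>R (z' - z)" by (simp add: W_def W'_def algebra_simps)
  then have "norm (W' s - W s) \<le> (1 - s) * norm (y' - y) + s * norm (z' - z)"
    using norm_triangle_ineq[of "(1 - s) *\<^sub>R (y' - y)" "s *\<^sub>R (z' - z)"] s by simp
  also have "\<dots> \<le> (1 - s) * \<epsilon> + s * \<epsilon>" using s le by (intro add_mono mult_left_mono) auto
  finally have W\<epsilon>: "norm (W' s - W s) \<le> \<epsilon>" by (simp add: algebra_simps)
  have "\<bar>partial_deriv h g (W' s) - partial_deriv h g (W s)\<bar> \<le> K * \<epsilon> powr a" for h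
    using W\<epsilon> a K(1) by (intro order_trans[OF holder[OF WS(2,1)]] mult_left_mono powr_mono2) auto
  then have "\<bar>dir_deriv g (W' s) (z - y) - dir_deriv g (W s) (z - y)\<bar> \<le> real CARD('n) * (K * \<epsilon> powr a) * norm (z - y)"
    by (rule dir_deriv_diff_le)
  moreover have "\<bar>dir_deriv g (W' s) ((z' - y') - (z - y))\<bar> \<le> real CARD('n) * K * norm ((z' - y') - (z - y))"
    by (rule dir_deriv_le[OF K(3)[OF WS(2)]])
  moreover have "dir_deriv g (W' s) (z' - y') - dir_deriv g (W s) (z - y)
     = dir_deriv g (W' s) ((z' - y') - (z - y)) + (dir_deriv g (W' s) (z - y) - dir_deriv g (W s) (z - y))"
    by (simp add: linear_diff[OF linear_dir_deriv])
  ultimately show "\<bar>(g z' - g z) - (g y' - g y)\<bar>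
     \<le> real CARD('n) * K * (norm ((z' - y') - (z - y)) + \<epsilon> powr a * norm (z - y))"
    unfolding eq by (simp add: distrib_left mult.assoc)
qed

lemma four_point_sum:
  assumes "\<And>i. i \<in> I \<Longrightarrow> four_point S a K (g i)"
  shows "four_point S a (real (card I) * K) (\<lambda>u. \<Sum>i\<in>I. g i u)"
proof (cases "finite I \<and> I \<noteq> {}")
  case True
  then obtain i0 where "i0 \<in> I" by blast
  then have K0: "0 \<le> K" using four_pointD(1)[OF assms] by blast
  have le: "\<bar>\<Sum>i\<in>I. b i\<bar> \<le> real (card I) * c" if "\<And>i. i \<in> I \<Longrightarrow> \<bar>b i\<bar> \<le> c" for b :: "_ \<Rightarrow> real" and c
    using sum_bounded_above[of I "\<lambda>i. \<bar>b i\<bar>" c] that by (auto intro: order_trans[OF sum_abs])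
  show ?thesis
    unfolding four_point_def sum_subtractf[symmetric] mult.assoc
    using K0 by (auto intro!: le four_pointD(2-4)[OF assms])
next
  case False
  then have "(\<Sum>i\<in>I. g i u) = 0" "card I = 0" for u by auto
  then show ?thesis by (simp add: four_point_def)
qed

text \<open>The second difference of a product consists of two second differences times values, and
  two products of a first difference in time with a first difference between the trajectories. The
  latter carry a factor \<epsilon>, which is at most \<epsilon>^a because a \<le> 1.\<close>

lemma four_point_mult:
  assumes p: "four_point S a K p" and q: "four_point S a K q" and a: "a \<le> 1"
  shows "four_point S a (4 * K\<^sup>2) (\<lambda>u. p u * q u)"
  unfolding four_point_def
proof (intro conjI ballI allI impI)
  note K0 = four_pointD(1)[OF p]
  show "0 \<le> 4 * K\<^sup>2" by simp
  show "\<bar>p u * q u\<bar> \<le> 4 * K\<^sup>2" if "u \<in> S" for u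
  proof -
    have "\<bar>p u * q u\<bar> \<le> K * K"
      unfolding abs_mult using four_pointD(2)[OF p that] four_pointD(2)[OF q that] K0 by (intro mult_mono) auto
    then show ?thesis by (simp add: power2_eq_square)
  qed
  show "\<bar>p u * q u - p v * q v\<bar> \<le> 4 * K\<^sup>2 * norm (u - v)" if "u \<in> S" "v \<in> S" for u v
  proof -
    have "p u * q u - p v * q v = (p u - p v) * q u + p v * (q u - q v)" by (simp add: algebra_simps)
    moreover have "\<bar>(p u - p v) * q u\<bar> \<le> (K * norm (u - v)) * K"
      unfolding abs_mult
      by (intro mult_mono mult_nonneg_nonneg K0 norm_ge_zero abs_ge_zero four_pointD(2)[OF q that(1)] four_pointD(3)[OF p that])
    moreover have "\<bar>p v * (q u - q v)\<bar> \<le> K * (K * norm (u - v))"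
      unfolding abs_mult
      by (intro mult_mono mult_nonneg_nonneg K0 norm_ge_zero abs_ge_zero four_pointD(2)[OF p that(2)] four_pointD(3)[OF q that])
    moreover have "(K * norm (u - v)) * K + K * (K * norm (u - v)) \<le> 4 * K\<^sup>2 * norm (u - v)"
      using K0 by (simp add: power2_eq_square algebra_simps mult_nonneg_nonneg)
    ultimately show ?thesis by linarith
  qed
  fix z z' y y' \<epsilon>
  assume in_S: "z \<in> S" "z' \<in> S" "y \<in> S" "y' \<in> S" and le: "norm (z' - z) \<le> \<epsilon>" "norm (y' - y) \<le> \<epsilon>" "\<epsilon> \<le> 1"
  define X where "X = norm ((z' - y') - (z - y))"
  define V where "V = norm (z - y)"
  define b where "b = \<epsilon> powr a"
  have \<epsilon>0: "0 \<le> \<epsilon>" using le norm_ge_zero order_trans by blast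
  have \<epsilon>b: "\<epsilon> \<le> b"
  proof (cases "\<epsilon> = 0")
    case False
    then show ?thesis unfolding b_def using powr_mono'[of a 1 \<epsilon>] le(3) \<epsilon>0 a by simp
  qed (simp add: b_def)
  have XV: "0 \<le> X" "0 \<le> V" "0 \<le> b" by (auto simp: X_def V_def b_def)
  have zy': "norm (z' - y') \<le> X + V"
    unfolding X_def V_def using norm_triangle_ineq[of "(z' - y') - (z - y)" "z - y"] by simp
  have "(p z' * q z' - p z * q z) - (p y' * q y' - p y * q y)
     = ((p z' - p z) - (p y' - p y)) * q z' + (p y' - p y) * (q z' - q y')
       + p z * ((q z' - q z) - (q y' - q y)) + (p z - p y) * (q y' - q y)"
    by (simp add: algebra_simps)
  moreover have "\<bar>((p z' - p z) - (p y' - p y)) * q z'\<bar> \<le> (K * (X + b * V)) * K"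
    unfolding abs_mult X_def V_def b_def using K0
    by (intro mult_mono four_pointD(4)[OF p] four_pointD(2)[OF q] in_S le) auto
  moreover have "\<bar>(p y' - p y) * (q z' - q y')\<bar> \<le> (K * \<epsilon>) * (K * (X + V))"
    unfolding abs_mult using K0 \<epsilon>0 le zy' in_S
    by (intro mult_mono order_trans[OF four_pointD(3)[OF p]] order_trans[OF four_pointD(3)[OF q]] mult_left_mono) auto
  moreover have "\<bar>p z * ((q z' - q z) - (q y' - q y))\<bar> \<le> K * (K * (X + b * V))"
    unfolding abs_mult X_def V_def b_def using K0
    by (intro mult_mono four_pointD(4)[OF q] four_pointD(2)[OF p] in_S le) auto
  moreover have "\<bar>(p z - p y) * (q y' - q y)\<bar> \<le> (K * V) * (K * \<epsilon>)"
    unfolding abs_mult V_def using K0 \<epsilon>0 le in_S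
    by (intro mult_mono order_trans[OF four_pointD(3)[OF p]] order_trans[OF four_pointD(3)[OF q]] mult_left_mono) auto
  moreover have "(K * (X + b * V)) * K + (K * \<epsilon>) * (K * (X + V)) + K * (K * (X + b * V)) + (K * V) * (K * \<epsilon>)
     \<le> 4 * K\<^sup>2 * (X + b * V)"
  proof -
    have "\<epsilon> * X \<le> X" "\<epsilon> * V \<le> b * V" using le(3) XV \<epsilon>b by (auto simp: mult_left_le_one_le \<epsilon>0 intro: mult_right_mono)
    then have "(X + b * V) + \<epsilon> * (X + V) + (X + b * V) + V * \<epsilon> \<le> 4 * (X + b * V)"
      using XV by (simp add: algebra_simps)
    from mult_left_mono[OF this, of "K\<^sup>2"] show ?thesis by (simp add: power2_eq_square algebra_simps)
  qed
  ultimately show "\<bar>(p z' * q z' - p z * q z) - (p y' * q y' - p y * q y)\<bar>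
     \<le> 4 * K\<^sup>2 * (norm ((z' - y') - (z - y)) + \<epsilon> powr a * norm (z - y))"
    unfolding X_def[symmetric] V_def[symmetric] b_def[symmetric] by linarith
qed

lemma dir_deriv_taylor:
  fixes g :: "real^'n::finite \<Rightarrow> real"
  assumes diff: "\<And>v. g differentiable (at v)" and S: "convex S"
    and four: "\<And>h. four_point S a K (partial_deriv h g)" and uv: "u \<in> S" "v \<in> S"
  shows "\<bar>g v - g u - dir_deriv g u (v - u)\<bar> \<le> real CARD('n) * K * (norm (v - u))\<^sup>2"
proof -
  obtain s where s: "0 < s" "s < 1" "u + s *\<^sub>R (v - u) \<in> S" "g v - g u = dir_deriv g (u + s *\<^sub>R (v - u)) (v - u)"
    using mvt_dir_deriv[OF diff S uv] by metis
  have "\<bar>partial_deriv h g (u + s *\<^sub>R (v - u)) - partial_deriv h g u\<bar> \<le> K * norm (v - u)" for h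
    using s four_pointD(1)[OF four]
    by (intro order_trans[OF four_pointD(3)[OF four s(3) uv(1)]] mult_left_mono) (auto intro: mult_left_le_one_le)
  then show ?thesis
    using dir_deriv_diff_le[of g "u + s *\<^sub>R (v - u)" u "K * norm (v - u)" "v - u"] s(4)
    by (simp add: power2_eq_square mult.assoc)
qed

text \<open>Interpolating along the two segments from \<open>z\<close> to \<open>z'\<close> and from \<open>y\<close> to \<open>y'\<close>, rather than from \<open>y\<close> to \<open>z\<close>,
  avoids the symmetry of second derivatives.\<close>
lemma dir_deriv_taylor_four:
  fixes g :: "real^'n::finite \<Rightarrow> real"
  assumes diff: "\<And>v. g differentiable (at v)" and S: "convex S"
    and four: "\<And>h. four_point S a K (partial_deriv h g)" and a: "0 \<le> a"
    and in_S: "z \<in> S" "z' \<in> S" "y \<in> S" "y' \<in> S"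
    and le: "norm (z' - z) \<le> \<epsilon>" "norm (y' - y) \<le> \<epsilon>" "\<epsilon> \<le> 1"
  shows "\<bar>(g z' - g z - dir_deriv g z (z' - z)) - (g y' - g y - dir_deriv g y (y' - y))\<bar>
     \<le> 2 * real CARD('n) * K * (\<epsilon> * norm ((z' - y') - (z - y)) + \<epsilon> powr (1 + a) * norm (z - y))"
proof -
  define X where "X = norm ((z' - y') - (z - y))"
  define V where "V = norm (z - y)"
  define p where "p = (\<lambda>r::real. z + r *\<^sub>R (z' - z))"
  define q where "q = (\<lambda>r::real. y + r *\<^sub>R (y' - y))"
  have \<epsilon>0: "0 \<le> \<epsilon>" using le norm_ge_zero order_trans by blast
  note K0 = four_pointD(1)[OF four]
  have "\<exists>r\<in>{0<..<1}. ((g (p 1) - 1 * dir_deriv g z (z' - z)) - (g (q 1) - 1 * dir_deriv g y (y' - y)))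
     - ((g (p 0) - 0 * dir_deriv g z (z' - z)) - (g (q 0) - 0 * dir_deriv g y (y' - y)))
      = ((1 - 0) * dir_deriv g (p r) (z' - z) - (1 - 0) * dir_deriv g z (z' - z))
        - ((1 - 0) * dir_deriv g (q r) (y' - y) - (1 - 0) * dir_deriv g y (y' - y))"
    by (rule mvt_simple[of 0 1 "\<lambda>r. (g (p r) - r * dir_deriv g z (z' - z)) - (g (q r) - r * dir_deriv g y (y' - y))"
          "\<lambda>r k. (k * dir_deriv g (p r) (z' - z) - k * dir_deriv g z (z' - z))
        - (k * dir_deriv g (q r) (y' - y) - k * dir_deriv g y (y' - y))"])
      (auto simp: p_def q_def intro!: has_derivative_diff has_derivative_along_line diff
        has_derivative_mult_left has_derivative_ident)
  then obtain r where r: "0 < r" "r < 1" and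
    eq: "(g z' - g z - dir_deriv g z (z' - z)) - (g y' - g y - dir_deriv g y (y' - y))
     = (dir_deriv g (p r) (z' - z) - dir_deriv g z (z' - z)) - (dir_deriv g (q r) (y' - y) - dir_deriv g y (y' - y))"
    by (auto simp: p_def q_def algebra_simps)
  have pq: "p r \<in> S" "q r \<in> S" unfolding p_def q_def using r in_S by (auto intro!: line_in_convex[OF S])
  have pz: "norm (p r - z) \<le> \<epsilon>" "norm (q r - y) \<le> \<epsilon>"
    unfolding p_def q_def using r le by (auto intro: order_trans[OF mult_left_le_one_le])
  have "\<bar>partial_deriv h g (p r) - partial_deriv h g z\<bar> \<le> K * \<epsilon>" for h
    using pz K0 by (intro order_trans[OF four_pointD(3)[OF four pq(1) in_S(1)]] mult_left_mono)
  then have 1: "\<bar>dir_deriv g (p r) ((z' - y') - (z - y)) - dir_deriv g z ((z' - y') - (z - y))\<bar> \<le> real CARD('n) * (K * \<epsilon>) * X"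
    unfolding X_def by (rule dir_deriv_diff_le)
  have "\<bar>\<Sum>h\<in>UNIV. ((partial_deriv h g (p r) - partial_deriv h g z) - (partial_deriv h g (q r) - partial_deriv h g y)) * (y' - y) $ h\<bar>
     \<le> real CARD('n) * (K * (X + \<epsilon> powr a * V)) * norm (y' - y)"
  proof (rule abs_inner_sum_le)
    fix h
    have "(p r - q r) - (z - y) = r *\<^sub>R ((z' - y') - (z - y))" by (simp add: p_def q_def algebra_simps)
    then have "norm ((p r - q r) - (z - y)) \<le> X" unfolding X_def using r by (simp add: mult_left_le_one_le)
    then show "\<bar>(partial_deriv h g (p r) - partial_deriv h g z) - (partial_deriv h g (q r) - partial_deriv h g y)\<bar>
       \<le> K * (X + \<epsilon> powr a * V)"
      unfolding V_def using K0
      by (intro order_trans[OF four_pointD(4)[OF four in_S(1) pq(1) in_S(3) pq(2) pz le(3)]] mult_left_mono) auto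
  qed
  also have "\<dots> \<le> real CARD('n) * (K * (X + \<epsilon> powr a * V)) * \<epsilon>"
    using le K0 by (intro mult_left_mono) (auto simp: X_def V_def)
  finally have 2: "\<bar>(dir_deriv g (p r) (y' - y) - dir_deriv g z (y' - y)) - (dir_deriv g (q r) (y' - y) - dir_deriv g y (y' - y))\<bar>
     \<le> real CARD('n) * (K * (X + \<epsilon> powr a * V)) * \<epsilon>"
    by (simp add: dir_deriv_def left_diff_distrib sum_subtractf)
  \<comment> \<open>The change of direction, of size \<open>X\<close>, is paired with a plain
    difference of derivatives, of order \<epsilon>. The common direction \<open>y' - y\<close>, of
    size at most \<epsilon>, is paired with the second difference of the derivatives.\<close>
  have eq': "(dir_deriv g (p r) (z' - z) - dir_deriv g z (z' - z)) - (dir_deriv g (q r) (y' - y) - dir_deriv g y (y' - y))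
     = (dir_deriv g (p r) ((z' - y') - (z - y)) - dir_deriv g z ((z' - y') - (z - y)))
       + ((dir_deriv g (p r) (y' - y) - dir_deriv g z (y' - y)) - (dir_deriv g (q r) (y' - y) - dir_deriv g y (y' - y)))"
    using linear_add[OF linear_dir_deriv, of g "p r" "(z' - y') - (z - y)" "y' - y"]
      linear_add[OF linear_dir_deriv, of g z "(z' - y') - (z - y)" "y' - y"] by simp
  have "\<epsilon> powr a * \<epsilon> = \<epsilon> powr (1 + a)"
    using \<epsilon>0 powr_add[of \<epsilon> 1 a] by (cases "\<epsilon> = 0") auto
  then have "real CARD('n) * (K * \<epsilon>) * X + real CARD('n) * (K * (X + \<epsilon> powr a * V)) * \<epsilon>
     = real CARD('n) * K * (2 * (\<epsilon> * X) + \<epsilon> powr (1 + a) * V)"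
    by (simp add: algebra_simps)
  also have "\<dots> \<le> real CARD('n) * K * (2 * (\<epsilon> * X) + 2 * (\<epsilon> powr (1 + a) * V))"
    using K0 by (intro mult_left_mono) (auto simp: V_def)
  also have "\<dots> = 2 * real CARD('n) * K * (\<epsilon> * X + \<epsilon> powr (1 + a) * V)" by (simp add: algebra_simps)
  finally show ?thesis
    unfolding eq eq' X_def[symmetric] V_def[symmetric] using 1 2 by linarith
qed

section \<open>From Hoelder derivatives to four-point bounds\<close>

text \<open>A Lipschitz function on a bounded set is Hoelder for every smaller exponent: the surplus
  power 1 - a of the distance is bounded by that of the diameter.\<close>

lemma four_point_imp_holder_on:
  assumes g: "four_point S a K g" and S: "bounded S" and a: "a \<le> 1"
  shows "holder_on a S g"
proof -
  obtain D where D: "\<And>u v. u \<in> S \<Longrightarrow> v \<in> S \<Longrightarrow> norm (u - v) \<le> D"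
    using S by (metis bounded_two_points dist_norm)
  have "\<bar>g u - g v\<bar> \<le> (K * D powr (1 - a)) * norm (u - v) powr a" if uv: "u \<in> S" "v \<in> S" for u v
  proof (cases "u = v")
    case False
    then have "norm (u - v) = norm (u - v) powr (1 - a) * norm (u - v) powr a"
      using powr_add[of "norm (u - v)" "1 - a" a] by simp
    also have "\<dots> \<le> D powr (1 - a) * norm (u - v) powr a"
      using D[OF uv] a by (intro mult_right_mono powr_mono2) auto
    finally have "K * norm (u - v) \<le> K * (D powr (1 - a) * norm (u - v) powr a)"
      using four_pointD(1)[OF g] by (rule mult_left_mono)
    then show ?thesis using four_pointD(3)[OF g uv] by (simp add: mult.assoc)
  qed simp
  then show ?thesis unfolding holder_on_def dist_norm real_norm_def by blast
qed

lemma four_point_of_holder_partials: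
  fixes g :: "real^'n::finite \<Rightarrow> real"
  assumes diff: "\<And>v. g differentiable (at v)" and S: "convex S" "compact S" and a: "0 < a"
    and holder: "\<And>h. holder_on a S (partial_deriv h g)"
  shows "\<exists>K. four_point S a K g"
proof -
  have "continuous_on S g"
    using diff by (meson continuous_at_imp_continuous_on differentiable_imp_continuous_within)
  then have "bounded (g ` S)" using S(2) by (intro compact_imp_bounded compact_continuous_image)
  then obtain M where M: "\<And>u. u \<in> S \<Longrightarrow> \<bar>g u\<bar> \<le> M" unfolding bounded_iff by auto
  have "\<exists>K\<ge>0. \<forall>u\<in>S. \<bar>partial_deriv h g u\<bar> \<le> K \<and>
      (\<forall>v\<in>S. \<bar>partial_deriv h g u - partial_deriv h g v\<bar> \<le> K * norm (u - v) powr a)" for h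
    using holder_on_imp_bounded[OF holder compact_imp_bounded[OF S(2)] a] by metis
  then obtain K where K: "\<And>h. 0 \<le> K h" "\<And>h u. u \<in> S \<Longrightarrow> \<bar>partial_deriv h g u\<bar> \<le> K h"
    "\<And>h u v. u \<in> S \<Longrightarrow> v \<in> S \<Longrightarrow> \<bar>partial_deriv h g u - partial_deriv h g v\<bar> \<le> K h * norm (u - v) powr a"
    by metis
  define L where "L = \<bar>M\<bar> + (\<Sum>h\<in>UNIV. K h)"
  have sum0: "0 \<le> (\<Sum>h\<in>UNIV. K h)" using K(1) by (simp add: sum_nonneg)
  have "K h \<le> (\<Sum>h\<in>UNIV. K h)" for h by (rule member_le_sum) (use K(1) in auto)
  then have L: "0 \<le> L" "\<bar>M\<bar> \<le> L" "\<And>h. K h \<le> L"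
    using sum0 unfolding L_def by (auto intro: add_increasing)
  have "four_point S a (real CARD('n) * L) g"
  proof (rule four_point_C1[OF diff S(1)])
    show "\<bar>g u\<bar> \<le> L" if "u \<in> S" for u using M[OF that] L by linarith
    show "\<bar>partial_deriv h g u\<bar> \<le> L" if "u \<in> S" for u h using K(2)[OF that, of h] L(3)[of h] by linarith
    show "\<bar>partial_deriv h g u - partial_deriv h g v\<bar> \<le> L * norm (u - v) powr a" if "u \<in> S" "v \<in> S" for u v h
      using K(3)[OF that, of h] mult_right_mono[OF L(3)[of h], of "norm (u - v) powr a"] by simp
  qed (use L a in auto)
  then show ?thesis by blast
qed

lemma four_point_uniform:
  fixes g :: "'p::finite \<Rightarrow> 'e::real_normed_vector \<Rightarrow> real"
  assumes "\<And>p. \<exists>K. four_point S a K (g p)"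
  shows "\<exists>K. \<forall>p. four_point S a K (g p)"
proof -
  obtain K where K: "\<And>p. four_point S a (K p) (g p)" using assms by metis
  have "K p \<le> (\<Sum>p\<in>UNIV. K p)" for p
    by (rule member_le_sum) (use four_pointD(1)[OF K] in auto)
  then have "four_point S a (\<Sum>p\<in>UNIV. K p) (g p)" for p using four_point_mono[OF K] by blast
  then show ?thesis by blast
qed

lemma holder_derivs_imp_locally_holder: "holder_derivs N a g \<Longrightarrow> locally_holder a g"
  by (cases N) auto

text \<open>\<open>N\<close> counts the derivatives beyond the second. With at least one more, the
  second derivatives are Lipschitz on \<open>S\<close> and \<open>a\<close> is 1, the largest
  exponent that \<open>rough_field\<close> admits. Regularity then descends: Hoelder second
  derivatives give the four-point bound for the first ones, these are in turn Hoelder, and this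
  gives the bound for \<open>g\<close>.\<close>

lemma holder_derivs_imp_four_point:
  fixes g :: "real^'n::finite \<Rightarrow> real"
  assumes g: "holder_derivs (Suc (Suc N)) b g" and b: "0 < b" "b \<le> 1"
    and a: "a = (if N = 0 then b else 1)" and S: "convex S" "compact S"
  shows "\<exists>K. four_point S a K g" "\<exists>K. four_point S a K (partial_deriv h g)"
proof -
  have a01: "0 < a" "a \<le> 1" using a b by auto
  have diff: "\<And>v. g differentiable (at v)" "\<And>h v. partial_deriv h g differentiable (at v)"
    and second: "\<And>h k. holder_derivs N b (partial_deriv k (partial_deriv h g))"
    using g by auto
  have "holder_on a S (partial_deriv k (partial_deriv h g))" for h k
  proof (cases N)
    case 0
    then show ?thesis using second[of k h] a b S by (auto intro: locally_holder_imp_holder_on)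
  next
    case (Suc M)
    define p where "p = partial_deriv k (partial_deriv h g)"
    have p: "\<And>v. p differentiable (at v)" "\<And>l. holder_derivs M b (partial_deriv l p)"
      using second[of k h] Suc unfolding p_def by auto
    have "holder_on b S (partial_deriv l p)" for l
      using holder_derivs_imp_locally_holder[OF p(2)] b S by (intro locally_holder_imp_holder_on)
    then obtain K where "four_point S b K p"
      using four_point_of_holder_partials[OF p(1) S b(1)] by blast
    from four_pointD(3)[OF this] have "holder_on 1 S p"
      unfolding holder_on_def dist_norm real_norm_def by auto
    then show ?thesis using a Suc by (simp add: p_def)
  qed
  then have 1: "\<exists>K. four_point S a K (partial_deriv h g)" for h
    by (intro four_point_of_holder_partials[OF diff(2) S a01(1)])
  then show "\<exists>K. four_point S a K (partial_deriv h g)" .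
  have "holder_on a S (partial_deriv h g)" for h
    using 1 four_point_imp_holder_on[OF _ compact_imp_bounded[OF S(2)] a01(2)] by blast
  then show "\<exists>K. four_point S a K g"
    by (intro four_point_of_holder_partials[OF diff(1) S a01(1)])
qed

section \<open>Coordinate form of the vector fields\<close>

definition field_app :: "('n::finite \<Rightarrow> 'd::finite \<Rightarrow> real^'n \<Rightarrow> real) \<Rightarrow> real^'n \<Rightarrow> real^'d \<Rightarrow> real^'n" where
  "field_app f u \<xi> = (\<chi> i. \<Sum>j\<in>UNIV. f i j u * \<xi> $ j)"

definition field_deriv :: "('n::finite \<Rightarrow> 'd::finite \<Rightarrow> real^'n \<Rightarrow> real) \<Rightarrow> real^'n \<Rightarrow> real^'n \<Rightarrow> real^'d \<Rightarrow> real^'n" where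
  "field_deriv f u w \<xi> = (\<chi> i. \<Sum>j\<in>UNIV. dir_deriv (f i j) u w * \<xi> $ j)"

definition field_app2 :: "('n::finite \<Rightarrow> 'd::finite \<Rightarrow> real^'n \<Rightarrow> real) \<Rightarrow> real^'n \<Rightarrow> real^'d^'d \<Rightarrow> real^'n" where
  "field_app2 f u B = (\<chi> i. \<Sum>h\<in>UNIV. \<Sum>r\<in>UNIV. \<Sum>j\<in>UNIV.
     f h r u * partial_deriv h (f i j) u * B $ r $ j)"

definition outer :: "real^'d::finite \<Rightarrow> real^'d \<Rightarrow> real^'d^'d" where
  "outer \<xi> \<eta> = (\<chi> r j. \<xi> $ r * \<eta> $ j)"

text \<open>Summing over \<open>h\<close> first leaves a linear form in the entries of
  \<open>B\<close>. Its coefficients are sums of products, to which the four-point calculus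
  applies.\<close>

lemma field_app2_alt:
  "field_app2 f u B = (\<chi> i. \<Sum>r\<in>UNIV. \<Sum>j\<in>UNIV.
     (\<Sum>h\<in>UNIV. f h r u * partial_deriv h (f i j) u) * B $ r $ j)"
proof -
  have "(\<Sum>h\<in>UNIV. \<Sum>r\<in>UNIV. \<Sum>j\<in>UNIV. p h r j * B $ r $ j)
      = (\<Sum>r\<in>UNIV. \<Sum>j\<in>UNIV. (\<Sum>h\<in>UNIV. p h r j) * B $ r $ j)" for p :: "'a \<Rightarrow> 'b \<Rightarrow> 'b \<Rightarrow> real"
  proof -
    have "(\<Sum>h\<in>UNIV. \<Sum>r\<in>UNIV. \<Sum>j\<in>UNIV. p h r j * B $ r $ j)
      = (\<Sum>r\<in>UNIV. \<Sum>h\<in>UNIV. \<Sum>j\<in>UNIV. p h r j * B $ r $ j)" by (rule sum.swap)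
    also have "\<dots> = (\<Sum>r\<in>UNIV. \<Sum>j\<in>UNIV. \<Sum>h\<in>UNIV. p h r j * B $ r $ j)"
      by (intro sum.cong refl sum.swap)
    finally show ?thesis by (simp add: sum_distrib_right)
  qed
  then show ?thesis by (simp add: field_app2_def)
qed

lemma linear_field_app: "linear (field_app f u)"
  by (rule linearI) (simp_all add: field_app_def vec_eq_iff algebra_simps sum.distrib sum_distrib_left)

lemma linear_field_app2: "linear (field_app2 f u)"
  by (rule linearI) (simp_all add: field_app2_def vec_eq_iff algebra_simps sum.distrib sum_distrib_left)

lemma norm_vec_le:
  fixes v :: "real^'n::finite"
  assumes "\<And>i. \<bar>v $ i\<bar> \<le> K"
  shows "norm v \<le> real CARD('n) * K"
  using norm_le_l1_cart[of v] sum_bounded_above[of "UNIV :: 'n set" "\<lambda>i. \<bar>v $ i\<bar>" K] assms by simp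

lemma norm_vec_sum_le:
  fixes \<xi> :: "real^'d::finite" and p :: "'n::finite \<Rightarrow> 'd \<Rightarrow> real"
  assumes "\<And>i j. \<bar>p i j\<bar> \<le> K"
  shows "norm ((\<chi> i. \<Sum>j\<in>UNIV. p i j * \<xi> $ j) :: real^'n) \<le> real CARD('n) * (real CARD('d) * K * norm \<xi>)"
  by (rule norm_vec_le) (simp add: abs_inner_sum_le[OF assms])

lemma norm_vec_sum2_le:
  fixes B :: "real^'d::finite^'d" and p :: "'n::finite \<Rightarrow> 'd \<Rightarrow> 'd \<Rightarrow> real"
  assumes p: "\<And>i r j. \<bar>p i r j\<bar> \<le> K"
  shows "norm ((\<chi> i. \<Sum>r\<in>UNIV. \<Sum>j\<in>UNIV. p i r j * B $ r $ j) :: real^'n)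
    \<le> real CARD('n) * (real CARD('d) * (real CARD('d) * K * norm B))"
proof (rule norm_vec_le)
  fix i
  have K0: "0 \<le> K" using p[of undefined undefined undefined] by linarith
  have "\<bar>\<Sum>j\<in>UNIV. p i r j * B $ r $ j\<bar> \<le> real CARD('d) * K * norm B" for r
  proof -
    have "real CARD('d) * K * norm (B $ r) \<le> real CARD('d) * K * norm B"
      using K0 by (intro mult_left_mono) (auto simp: Finite_Cartesian_Product.norm_nth_le)
    then show ?thesis using abs_inner_sum_le[of "p i r" K "B $ r"] p by (meson order_trans)
  qed
  then have "(\<Sum>r\<in>UNIV. \<bar>\<Sum>j\<in>UNIV. p i r j * B $ r $ j\<bar>) \<le> real CARD('d) * (real CARD('d) * K * norm B)"
    using sum_bounded_above[of "UNIV :: 'd set" "\<lambda>r. \<bar>\<Sum>j\<in>UNIV. p i r j * B $ r $ j\<bar>"] by simp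
  then show "\<bar>(\<chi> i. \<Sum>r\<in>UNIV. \<Sum>j\<in>UNIV. p i r j * B $ r $ j) $ i\<bar> \<le> real CARD('d) * (real CARD('d) * K * norm B)"
    by (simp add: order_trans[OF sum_abs])
qed

lemma rough_field_vector:
  fixes f :: "'n::finite \<Rightarrow> 'd::finite \<Rightarrow> real^'n \<Rightarrow> real"
  assumes diff: "\<And>i j v. f i j differentiable (at v)" and S: "convex S" and a: "0 < a" "a \<le> 1"
    and f: "\<And>i j. four_point S a K (f i j)" and df: "\<And>i j h. four_point S a K (partial_deriv h (f i j))"
  shows "\<exists>C\<^sub>0. \<forall>C\<ge>C\<^sub>0. rough_field S (field_app f) (field_deriv f) (field_app2 f) outer C a"
proof -
  define n where "n = real CARD('n)"
  define d where "d = real CARD('d)"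
  have K0: "0 \<le> K" by (rule four_pointD(1)[OF f])
  have nd: "1 \<le> n" "1 \<le> d"
    unfolding n_def d_def by (metis One_nat_def Suc_leI of_nat_1 of_nat_le_iff zero_less_card_finite)+
  define K2 where "K2 = n * (4 * K\<^sup>2)"
  have g: "four_point S a K2 (\<lambda>u. \<Sum>h\<in>UNIV. f h r u * partial_deriv h (f i j) u)" for i r j
    using four_point_sum[of UNIV S a "4 * K\<^sup>2" "\<lambda>h u. f h r u * partial_deriv h (f i j) u"] four_point_mult[OF f df a(2)]
    by (simp add: K2_def n_def)
  have K20: "0 \<le> K2" using nd by (simp add: K2_def)
  \<comment> \<open>The factor 2n K comes from comparing two Taylor remainders and dominates the
    other demands on \<open>F\<close> and \<open>DF\<close>; \<open>K2\<close> is the four-point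
    constant of the coefficients of \<open>G\<close>.\<close>
  define C\<^sub>0 where "C\<^sub>0 = 1 + n * (d * (2 * n * K)) + n * (d * (d * K2))"
  have C\<^sub>0: "1 \<le> C\<^sub>0" "n * (d * K) \<le> C\<^sub>0" "n * (d * (n * K)) \<le> C\<^sub>0" "n * (d * (2 * n * K)) \<le> C\<^sub>0" "n * (d * (d * K2)) \<le> C\<^sub>0"
  proof -
    have pos: "0 \<le> n * (d * (2 * n * K))" "0 \<le> n * (d * (d * K2))" "0 \<le> n * (d * (n * K))" using nd K0 K20 by auto
    have "K \<le> n * K" using nd K0 by (simp add: mult_le_cancel_right1)
    then have "n * (d * K) \<le> n * (d * (n * K))" using nd by (intro mult_left_mono) auto
    moreover have "n * (d * (2 * n * K)) = 2 * (n * (d * (n * K)))" by simp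
    ultimately show "1 \<le> C\<^sub>0" "n * (d * K) \<le> C\<^sub>0" "n * (d * (n * K)) \<le> C\<^sub>0" "n * (d * (2 * n * K)) \<le> C\<^sub>0" "n * (d * (d * K2)) \<le> C\<^sub>0"
      unfolding C\<^sub>0_def using pos by linarith+
  qed
  have "rough_field S (field_app f) (field_deriv f) (field_app2 f) outer C a" if C: "C\<^sub>0 \<le> C" for C
  proof (rule rough_field.intro)
    have le: "b \<le> C * c" if "b \<le> k * c" "k \<le> C\<^sub>0" "0 \<le> c" for b c k
      using that C by (meson mult_right_mono order_trans)
    \<comment> \<open>A coefficient bound is split into a constant \<open>k\<close>, which
      \<open>C\<close> absorbs together with the dimensions, and a factor \<open>c\<close> made of
      distances, which is kept.\<close>
    have leF: "norm ((\<chi> i. \<Sum>j\<in>UNIV. p i j * \<xi> $ j) :: real^'n) \<le> C * (c * norm \<xi>)"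
      if p: "\<And>i j. \<bar>p i j\<bar> \<le> k * c" and k: "n * (d * k) \<le> C\<^sub>0" and c: "0 \<le> c" for p k c and \<xi> :: "real^'d"
      using norm_vec_sum_le[of p "k * c" \<xi>] p k c unfolding n_def[symmetric] d_def[symmetric]
      by (intro le[of _ "n * (d * k)"]) (auto simp: mult.assoc)
    have leG: "norm ((\<chi> i. \<Sum>r\<in>UNIV. \<Sum>j\<in>UNIV. p i r j * B $ r $ j) :: real^'n) \<le> C * (c * norm B)"
      if p: "\<And>i r j. \<bar>p i r j\<bar> \<le> K2 * c" and c: "0 \<le> c" for p c and B :: "real^'d^'d"
      using norm_vec_sum2_le[of p "K2 * c" B] p C\<^sub>0(5) c unfolding n_def[symmetric] d_def[symmetric]
      by (intro le[of _ "n * (d * (d * K2))"]) (auto simp: mult.assoc)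
    show "linear (field_app f u)" for u by (rule linear_field_app)
    show "linear (\<lambda>w. field_deriv f u w \<xi>)" for u \<xi>
      by (rule linearI) (simp_all add: field_deriv_def vec_eq_iff linear_add[OF linear_dir_deriv]
          linear_cmul[OF linear_dir_deriv] algebra_simps sum.distrib sum_distrib_left)
    show "linear (field_app2 f u)" for u by (rule linear_field_app2)
    show "field_app2 f u (outer \<xi> \<eta>) = field_deriv f u (field_app f u \<xi>) \<eta>" for u \<xi> \<eta>
    proof -
      have "(\<Sum>r\<in>UNIV. \<Sum>j\<in>UNIV. (\<Sum>h\<in>UNIV. f h r u * partial_deriv h (f i j) u) * (\<xi> $ r * \<eta> $ j))
        = (\<Sum>j\<in>UNIV. (\<Sum>h\<in>UNIV. partial_deriv h (f i j) u * (\<Sum>r\<in>UNIV. f h r u * \<xi> $ r)) * \<eta> $ j)" for i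
      proof -
        have "(\<Sum>r\<in>UNIV. \<Sum>j\<in>UNIV. (\<Sum>h\<in>UNIV. f h r u * partial_deriv h (f i j) u) * (\<xi> $ r * \<eta> $ j))
          = (\<Sum>j\<in>UNIV. \<Sum>r\<in>UNIV. (\<Sum>h\<in>UNIV. f h r u * partial_deriv h (f i j) u) * (\<xi> $ r * \<eta> $ j))"
          by (rule sum.swap)
        also have "\<dots> = (\<Sum>j\<in>UNIV. \<Sum>r\<in>UNIV. \<Sum>h\<in>UNIV. partial_deriv h (f i j) u * f h r u * \<xi> $ r * \<eta> $ j)"
          by (simp add: sum_distrib_left sum_distrib_right ac_simps)
        also have "\<dots> = (\<Sum>j\<in>UNIV. \<Sum>h\<in>UNIV. \<Sum>r\<in>UNIV. partial_deriv h (f i j) u * f h r u * \<xi> $ r * \<eta> $ j)"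
          by (intro sum.cong refl sum.swap)
        finally show ?thesis by (simp add: sum_distrib_left sum_distrib_right ac_simps)
      qed
      then show ?thesis
        by (simp add: field_app2_alt field_deriv_def field_app_def dir_deriv_def outer_def)
    qed
    show "1 \<le> C" using C C\<^sub>0 by linarith
    show "0 < a" "a \<le> 1" by (fact a)+
    fix u v z z' y y' w :: "real^'n" and \<xi> :: "real^'d" and B :: "real^'d^'d" and \<epsilon> :: real
    show "norm (field_app f u \<xi>) \<le> C * norm \<xi>" if "u \<in> S"
      using leF[of "\<lambda>i j. f i j u" K 1 \<xi>] four_pointD(2)[OF f that] C\<^sub>0 by (simp add: field_app_def)
    show "norm (field_app2 f u B) \<le> C * norm B" if "u \<in> S"
      unfolding field_app2_alt
      using leG[of "\<lambda>i r j. \<Sum>h\<in>UNIV. f h r u * partial_deriv h (f i j) u" 1 B] four_pointD(2)[OF g that] by simp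
    show "norm (field_deriv f u w \<xi>) \<le> C * norm w * norm \<xi>" if "u \<in> S"
    proof -
      have "\<bar>dir_deriv (f i j) u w\<bar> \<le> n * K * norm w" for i j
        unfolding n_def by (rule dir_deriv_le[OF four_pointD(2)[OF df that]])
      then show ?thesis
        using leF[of "\<lambda>i j. dir_deriv (f i j) u w" "n * K" "norm w" \<xi>] C\<^sub>0 by (simp add: field_deriv_def mult.assoc)
    qed
    show "norm (field_app f u \<xi> - field_app f v \<xi>) \<le> C * norm (u - v) * norm \<xi>" if "u \<in> S" "v \<in> S"
    proof -
      have "field_app f u \<xi> - field_app f v \<xi> = (\<chi> i. \<Sum>j\<in>UNIV. (f i j u - f i j v) * \<xi> $ j)"
        by (simp add: field_app_def vec_eq_iff left_diff_distrib sum_subtractf)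
      then show ?thesis
        using leF[of "\<lambda>i j. f i j u - f i j v" K "norm (u - v)" \<xi>] four_pointD(3)[OF f that] C\<^sub>0 by (simp add: mult.assoc)
    qed
    show "norm (field_deriv f u w \<xi> - field_deriv f v w \<xi>) \<le> C * norm (u - v) * norm w * norm \<xi>" if "u \<in> S" "v \<in> S"
    proof -
      have eq: "field_deriv f u w \<xi> - field_deriv f v w \<xi> = (\<chi> i. \<Sum>j\<in>UNIV. (dir_deriv (f i j) u w - dir_deriv (f i j) v w) * \<xi> $ j)"
        by (simp add: field_deriv_def vec_eq_iff left_diff_distrib sum_subtractf)
      have "\<bar>dir_deriv (f i j) u w - dir_deriv (f i j) v w\<bar> \<le> n * (K * norm (u - v)) * norm w" for i j
        unfolding n_def by (rule dir_deriv_diff_le[OF four_pointD(3)[OF df that]])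
      then show ?thesis
        using leF[of "\<lambda>i j. dir_deriv (f i j) u w - dir_deriv (f i j) v w" "n * K" "norm (u - v) * norm w" \<xi>] C\<^sub>0
        by (simp add: eq mult.assoc)
    qed
    show "norm (field_app2 f u B - field_app2 f v B) \<le> C * norm (u - v) * norm B" if "u \<in> S" "v \<in> S"
    proof -
      have eq: "field_app2 f u B - field_app2 f v B = (\<chi> i. \<Sum>r\<in>UNIV. \<Sum>j\<in>UNIV.
          ((\<Sum>h\<in>UNIV. f h r u * partial_deriv h (f i j) u) - (\<Sum>h\<in>UNIV. f h r v * partial_deriv h (f i j) v)) * B $ r $ j)"
        by (simp add: field_app2_alt vec_eq_iff left_diff_distrib sum_subtractf)
      show ?thesis unfolding eq mult.assoc by (rule leG) (use four_pointD(3)[OF g that] in auto)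
    qed
    show "norm (field_app f v \<xi> - field_app f u \<xi> - field_deriv f u (v - u) \<xi>) \<le> C * (norm (v - u))\<^sup>2 * norm \<xi>"
      if "u \<in> S" "v \<in> S"
    proof -
      have eq: "field_app f v \<xi> - field_app f u \<xi> - field_deriv f u (v - u) \<xi>
        = (\<chi> i. \<Sum>j\<in>UNIV. (f i j v - f i j u - dir_deriv (f i j) u (v - u)) * \<xi> $ j)"
        by (simp add: field_app_def field_deriv_def vec_eq_iff left_diff_distrib sum_subtractf)
      show ?thesis unfolding eq mult.assoc
        by (rule leF[of _ "n * K"]) (use dir_deriv_taylor[OF diff S df that] C\<^sub>0 in \<open>auto simp: n_def\<close>)
    qed
    assume in_S: "z \<in> S" "z' \<in> S" "y \<in> S" "y' \<in> S"
      and le: "norm (z' - z) \<le> \<epsilon>" "norm (y' - y) \<le> \<epsilon>" "\<epsilon> \<le> 1"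
    have \<epsilon>0: "0 \<le> \<epsilon>" using le norm_ge_zero order_trans by blast
    show "norm ((field_app f z' \<xi> - field_app f z \<xi> - field_deriv f z (z' - z) \<xi>)
        - (field_app f y' \<xi> - field_app f y \<xi> - field_deriv f y (y' - y) \<xi>))
      \<le> C * (\<epsilon> * norm ((z' - y') - (z - y)) + \<epsilon> powr (1 + a) * norm (z - y)) * norm \<xi>"
    proof -
      have eq: "(field_app f z' \<xi> - field_app f z \<xi> - field_deriv f z (z' - z) \<xi>)
        - (field_app f y' \<xi> - field_app f y \<xi> - field_deriv f y (y' - y) \<xi>)
        = (\<chi> i. \<Sum>j\<in>UNIV. ((f i j z' - f i j z - dir_deriv (f i j) z (z' - z)) - (f i j y' - f i j y - dir_deriv (f i j) y (y' - y))) * \<xi> $ j)"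
        by (simp add: field_app_def field_deriv_def vec_eq_iff left_diff_distrib sum_subtractf)
      show ?thesis unfolding eq mult.assoc
        by (rule leF[of _ "2 * n * K"])
          (use dir_deriv_taylor_four[OF diff S df less_imp_le[OF a(1)] in_S le] C\<^sub>0 \<epsilon>0 in \<open>auto simp: n_def\<close>)
    qed
    show "norm ((field_app2 f z' B - field_app2 f z B) - (field_app2 f y' B - field_app2 f y B))
      \<le> C * (norm ((z' - y') - (z - y)) + \<epsilon> powr a * norm (z - y)) * norm B"
    proof -
      define p where "p = (\<lambda>u i r j. \<Sum>h\<in>UNIV. f h r u * partial_deriv h (f i j) u)"
      have eq: "(field_app2 f z' B - field_app2 f z B) - (field_app2 f y' B - field_app2 f y B)
        = (\<chi> i. \<Sum>r\<in>UNIV. \<Sum>j\<in>UNIV. ((p z' i r j - p z i r j) - (p y' i r j - p y i r j)) * B $ r $ j)"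
        by (simp add: field_app2_alt p_def vec_eq_iff left_diff_distrib sum_subtractf)
      show ?thesis unfolding eq mult.assoc
        by (rule leG) (use four_pointD(4)[OF g in_S le] in \<open>auto simp: p_def\<close>)
    qed
  qed
  then show ?thesis by blast
qed

section \<open>Convergence of the Euler scheme\<close>

definition area :: "('d::finite \<Rightarrow> 'd \<Rightarrow> real \<Rightarrow> real \<Rightarrow> real) \<Rightarrow> real \<Rightarrow> real \<Rightarrow> real^'d^'d" where
  "area A s t = (\<chi> r j. A r j s t)"

lemma norm_matrix_le:
  fixes B :: "real^'d::finite^'d"
  assumes "\<And>r j. \<bar>B $ r $ j\<bar> \<le> K"
  shows "norm B \<le> real CARD('d) * (real CARD('d) * K)"
proof -
  have "norm (B $ r) \<le> real CARD('d) * K" for r by (rule norm_vec_le) (rule assms)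
  then have "(\<Sum>r\<in>UNIV. norm (B $ r)) \<le> (\<Sum>r\<in>(UNIV::'d set). real CARD('d) * K)"
    by (intro sum_mono)
  moreover have "norm B \<le> (\<Sum>r\<in>UNIV. norm (B $ r))"
    unfolding norm_vec_def[of B] by (rule L2_set_le_sum) auto
  ultimately show ?thesis by simp
qed

text \<open>Uniform continuity of \<omega> on the compact interval makes its increments over short
  intervals small uniformly, so the o-condition yields a linear bound in the increment of \<omega>.
  Dividing \<epsilon> by the dimension prepares the passage from components to the norm.\<close>

lemma is_solution_defect_small:
  fixes x :: "real \<Rightarrow> real^'d::finite" and y :: "real \<Rightarrow> real^'n::finite"
  assumes sol: "is_solution T x A f y0 y"
  obtains \<omega> where "mono_on {0..T} \<omega>"
    "\<And>\<epsilon>. 0 < \<epsilon> \<Longrightarrow> \<exists>\<eta>>0. \<forall>s t. 0 \<le> s \<longrightarrow> s < t \<longrightarrow> t \<le> T \<longrightarrow> t - s < \<eta> \<longrightarrow>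
      norm (y t - y s - field_app f (y s) (x t - x s) - field_app2 f (y s) (area A s t)) \<le> \<epsilon> * (\<omega> t - \<omega> s)"
proof -
  obtain \<omega> \<theta> where cont: "continuous_on {0..T} \<omega>" and mono: "mono_on {0..T} \<omega>"
    and \<theta>: "\<theta> 0 = 0" "\<theta> \<in> o[at_right 0](\<lambda>\<delta>. \<delta>)"
    and le: "\<And>i s t. 0 \<le> s \<Longrightarrow> s < t \<Longrightarrow> t \<le> T \<Longrightarrow>
       \<bar>y t $ i - y s $ i - (\<Sum>j\<in>UNIV. f i j (y s) * (x t $ j - x s $ j))
             - (\<Sum>h\<in>UNIV. \<Sum>r\<in>UNIV. \<Sum>j\<in>UNIV. f h r (y s) * partial_deriv h (f i j) (y s) * A r j s t)\<bar>
           \<le> \<theta> (\<omega> t - \<omega> s :: real)"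
    using sol unfolding is_solution_def by blast
  have "\<exists>\<eta>>0. \<forall>s t. 0 \<le> s \<longrightarrow> s < t \<longrightarrow> t \<le> T \<longrightarrow> t - s < \<eta> \<longrightarrow>
      norm (y t - y s - field_app f (y s) (x t - x s) - field_app2 f (y s) (area A s t)) \<le> \<epsilon> * (\<omega> t - \<omega> s)"
    if \<epsilon>: "0 < \<epsilon>" for \<epsilon>
  proof -
    define n where "n = real CARD('n)"
    have n: "0 < n" by (simp add: n_def)
    have "\<forall>\<^sub>F \<delta> in at_right 0. norm (\<theta> \<delta>) \<le> \<epsilon> / n * norm \<delta>"
      using landau_o.smallD[OF \<theta>(2), of "\<epsilon> / n"] \<epsilon> n by simp
    then obtain b where b: "0 < b" "\<And>\<delta>. 0 < \<delta> \<Longrightarrow> \<delta> < b \<Longrightarrow> norm (\<theta> \<delta>) \<le> \<epsilon> / n * norm \<delta>"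
      unfolding eventually_at_right_field by auto
    \<comment> \<open>An increment of \<omega> may vanish, and then the bound rests on \<theta>
      being 0 at 0.\<close>
    have \<theta>_le: "\<theta> \<delta> \<le> \<epsilon> / n * \<delta>" if "0 \<le> \<delta>" "\<delta> < b" for \<delta>
      using b(2)[of \<delta>] that \<theta>(1) by (cases "\<delta> = 0") auto
    have "uniformly_continuous_on {0..T} \<omega>" using cont by (intro compact_uniformly_continuous) auto
    then obtain \<eta> where \<eta>: "0 < \<eta>" "\<And>s t. s \<in> {0..T} \<Longrightarrow> t \<in> {0..T} \<Longrightarrow> dist t s < \<eta> \<Longrightarrow> dist (\<omega> t) (\<omega> s) < b"
      using b(1) unfolding uniformly_continuous_on_def by meson
    have "norm (y t - y s - field_app f (y s) (x t - x s) - field_app2 f (y s) (area A s t)) \<le> \<epsilon> * (\<omega> t - \<omega> s)"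
      if st: "0 \<le> s" "s < t" "t \<le> T" "t - s < \<eta>" for s t
    proof -
      have "\<omega> s \<le> \<omega> t" using mono_onD[OF mono, of s t] st by auto
      moreover have "dist (\<omega> t) (\<omega> s) < b" using st by (intro \<eta>) (auto simp: dist_real_def)
      ultimately have "\<theta> (\<omega> t - \<omega> s) \<le> \<epsilon> / n * (\<omega> t - \<omega> s)" by (intro \<theta>_le) (auto simp: dist_real_def)
      then have "\<bar>(y t - y s - field_app f (y s) (x t - x s) - field_app2 f (y s) (area A s t)) $ i\<bar>
          \<le> \<epsilon> / n * (\<omega> t - \<omega> s)" for i
        using le[OF st(1-3), of i] by (simp add: field_app_def field_app2_def area_def)
      from norm_vec_le[OF this] show ?thesis using n by (simp add: n_def)
    qed
    then show ?thesis using \<eta>(1) by blast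
  qed
  then show thesis using that mono by blast
qed

text \<open>Neither continuity of \<open>y\<close> nor a growth bound on \<open>f\<close> is at
  hand. The expansion with \<epsilon> = 1, started at the last grid point \<open>s\<close>, bounds
  \<open>y\<close> on the next interval of length \<eta>/2, and finitely many such intervals cover
  [0, T].\<close>

lemma solution_bounded:
  fixes x :: "real \<Rightarrow> real^'d::finite" and y :: "real \<Rightarrow> real^'n::finite"
  assumes sol: "is_solution T x A f y0 y"
    and x: "\<And>s t. 0 \<le> s \<Longrightarrow> s \<le> t \<Longrightarrow> t \<le> T \<Longrightarrow> norm (x t - x s) \<le> X"
    and A: "\<And>s t. 0 \<le> s \<Longrightarrow> s \<le> t \<Longrightarrow> t \<le> T \<Longrightarrow> norm (area A s t) \<le> X"
  shows "\<exists>R. \<forall>t. 0 \<le> t \<longrightarrow> t \<le> T \<longrightarrow> norm (y t) \<le> R"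
proof (cases "0 \<le> T")
  case True
  obtain \<omega> where mono: "mono_on {0..T} \<omega>" and
    "\<And>\<epsilon>. 0 < \<epsilon> \<Longrightarrow> \<exists>\<eta>>0. \<forall>s t. 0 \<le> s \<longrightarrow> s < t \<longrightarrow> t \<le> T \<longrightarrow> t - s < \<eta> \<longrightarrow>
      norm (y t - y s - field_app f (y s) (x t - x s) - field_app2 f (y s) (area A s t)) \<le> \<epsilon> * (\<omega> t - \<omega> s)"
    using is_solution_defect_small[OF sol] by metis
  from this(2)[of 1] obtain \<eta> where \<eta>: "0 < \<eta>" "\<And>s t. 0 \<le> s \<Longrightarrow> s < t \<Longrightarrow> t \<le> T \<Longrightarrow> t - s < \<eta> \<Longrightarrow>
      norm (y t - y s - field_app f (y s) (x t - x s) - field_app2 f (y s) (area A s t)) \<le> \<omega> t - \<omega> s"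
    by auto
  have step: "\<exists>R. \<forall>t. 0 \<le> t \<longrightarrow> t \<le> T \<longrightarrow> t \<le> real k * (\<eta> / 2) \<longrightarrow> norm (y t) \<le> R" for k
  proof (induction k)
    case 0
    have "norm (y t) \<le> norm (y 0)" if "0 \<le> t" "t \<le> 0" for t using that by simp
    then show ?case by auto
  next
    case (Suc k)
    then obtain R where R: "\<And>t. 0 \<le> t \<Longrightarrow> t \<le> T \<Longrightarrow> t \<le> real k * (\<eta> / 2) \<Longrightarrow> norm (y t) \<le> R" by blast
    define s where "s = real k * (\<eta> / 2)"
    have s0: "0 \<le> s" using \<eta> by (simp add: s_def)
    \<comment> \<open>The constants depend on the single point \<open>y s\<close>, which is harmless
      since one such point occurs per interval.\<close>
    obtain K1 where K1: "\<And>v. norm (field_app f (y s) v) \<le> norm v * K1"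
      using linear_conv_bounded_linear[of "field_app f (y s)"] linear_field_app bounded_linear.bounded by metis
    obtain K2 where K2: "\<And>v. norm (field_app2 f (y s) v) \<le> norm v * K2"
      using linear_conv_bounded_linear[of "field_app2 f (y s)"] linear_field_app2 bounded_linear.bounded by metis
    have "norm (y t) \<le> \<bar>R\<bar> + \<bar>X\<bar> * \<bar>K1\<bar> + \<bar>X\<bar> * \<bar>K2\<bar> + (\<omega> T - \<omega> 0)"
      if t: "0 \<le> t" "t \<le> T" "t \<le> real (Suc k) * (\<eta> / 2)" for t
    proof (cases "t \<le> s")
      case True
      have "\<omega> 0 \<le> \<omega> T" using mono_onD[OF mono, of 0 T] \<open>0 \<le> T\<close> by auto
      moreover have "norm (y t) \<le> R" using R t True by (simp add: s_def)
      moreover have "0 \<le> \<bar>X\<bar> * \<bar>K1\<bar>" "0 \<le> \<bar>X\<bar> * \<bar>K2\<bar>" by auto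
      ultimately show ?thesis by linarith
    next
      case False
      then have st: "s < t" "s \<le> t" "s \<le> T" using t by auto
      have "t - s \<le> \<eta> / 2" using t by (simp add: s_def algebra_simps)
      then have "t - s < \<eta>" using \<eta>(1) by linarith
      then have "norm (y t - y s - field_app f (y s) (x t - x s) - field_app2 f (y s) (area A s t)) \<le> \<omega> t - \<omega> s"
        using \<eta>(2) s0 st t by blast
      also have "\<dots> \<le> \<omega> T - \<omega> 0"
        using mono_onD[OF mono, of 0 s] mono_onD[OF mono, of t T] s0 st t by auto
      finally have 1: "norm (y t - y s - field_app f (y s) (x t - x s) - field_app2 f (y s) (area A s t)) \<le> \<omega> T - \<omega> 0" .
      have ab: "p * k \<le> \<bar>X\<bar> * \<bar>k\<bar>" if "0 \<le> p" "p \<le> X" for p k :: real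
      proof -
        have "p * k \<le> p * \<bar>k\<bar>" using that by (intro mult_left_mono) auto
        also have "\<dots> \<le> \<bar>X\<bar> * \<bar>k\<bar>" using that by (intro mult_right_mono) auto
        finally show ?thesis .
      qed
      have 2: "norm (field_app f (y s) (x t - x s)) \<le> \<bar>X\<bar> * \<bar>K1\<bar>"
        by (rule order_trans[OF K1]) (intro ab norm_ge_zero x s0 st t)
      have 3: "norm (field_app2 f (y s) (area A s t)) \<le> \<bar>X\<bar> * \<bar>K2\<bar>"
        by (rule order_trans[OF K2]) (intro ab norm_ge_zero A s0 st t)
      have 4: "norm (y s) \<le> R" using R[of s] s0 st by (simp add: s_def)
      have "y t = (y t - y s - field_app f (y s) (x t - x s) - field_app2 f (y s) (area A s t))
          + field_app f (y s) (x t - x s) + field_app2 f (y s) (area A s t) + y s" by simp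
      then have "norm (y t) \<le> norm (y t - y s - field_app f (y s) (x t - x s) - field_app2 f (y s) (area A s t))
          + norm (field_app f (y s) (x t - x s)) + norm (field_app2 f (y s) (area A s t)) + norm (y s)"
        by (metis (no_types, lifting) add_right_mono norm_triangle_ineq norm_triangle_le)
      then show ?thesis using 1 2 3 4 by linarith
    qed
    then show ?case by blast
  qed
  obtain k where "T / (\<eta> / 2) \<le> real k" using real_arch_simple by blast
  then have "T \<le> real k * (\<eta> / 2)" using \<eta>(1) by (simp add: field_simps)
  then show ?thesis using step[of k] by (meson order_trans)
qed auto

text \<open>As \<alpha> < 1/2, the inequality 1/\<alpha> < \<gamma> = N + b with b \<le> 1 forces N
  \<ge> 2. For N = 2 one has 2 + a = \<gamma>, and the claim on (2 + a)\<alpha> is the assumption on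
  \<gamma>; for larger N it is 3\<alpha> > 1. The exponent is fixed before the radius, since balls
  of several radii are used with it.\<close>

lemma C_space_rough_field:
  fixes f :: "'n::finite \<Rightarrow> 'd::finite \<Rightarrow> real^'n \<Rightarrow> real"
  assumes f: "f \<in> C_space \<gamma>" and \<alpha>: "1/3 < \<alpha>" "\<alpha> < 1/2" "1 / \<alpha> < \<gamma>"
  obtains a where "1 < (2 + a) * \<alpha>"
    "\<And>R. \<exists>C\<^sub>0. \<forall>C\<ge>C\<^sub>0. rough_field (cball 0 R) (field_app f) (field_deriv f) (field_app2 f) outer C a"
proof -
  obtain N b where N: "0 < b" "b \<le> 1" "\<gamma> = real N + b" and hd: "\<And>i j. holder_derivs N b (f i j)"
    using f unfolding C_space_def by blast
  have "2 < 1 / \<alpha>" using \<alpha> by (simp add: field_simps)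
  then have "2 \<le> N" using \<alpha> N by linarith
  then obtain M where M: "N = Suc (Suc M)" by (metis add_2_eq_Suc le_Suc_ex)
  \<comment> \<open>If third derivatives exist, the second ones are locally Lipschitz.\<close>
  define a where "a = (if M = 0 then b else 1)"
  have a: "0 < a" "a \<le> 1" using N by (auto simp: a_def)
  have "1 < (2 + a) * \<alpha>"
  proof (cases "M = 0")
    case True
    then have "1 / \<alpha> < 2 + a" using \<alpha>(3) N M by (simp add: a_def)
    then show ?thesis using \<alpha> by (simp add: field_simps)
  qed (use \<alpha> in \<open>simp add: a_def\<close>)
  moreover have "\<exists>C\<^sub>0. \<forall>C\<ge>C\<^sub>0. rough_field (cball 0 R) (field_app f) (field_deriv f) (field_app2 f) outer C a" for R
  proof -
    have four: "\<exists>K. four_point (cball 0 R) a K (f i j)" "\<exists>K. four_point (cball 0 R) a K (partial_deriv h (f i j))" for i j h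
      using holder_derivs_imp_four_point[OF hd[unfolded M] N(1,2) a_def convex_cball compact_cball] by blast+
    obtain K1 where K1: "\<And>p. four_point (cball 0 R) a K1 (f (fst p) (snd p))"
      using four_point_uniform[of "cball 0 R" a "\<lambda>p. f (fst p) (snd p)"] four(1) by blast
    obtain K2 where K2: "\<And>p. four_point (cball 0 R) a K2 (partial_deriv (fst p) (f (fst (snd p)) (snd (snd p))))"
      using four_point_uniform[of "cball 0 R" a "\<lambda>p. partial_deriv (fst p) (f (fst (snd p)) (snd (snd p)))"] four(2) by blast
    show ?thesis
    proof (rule rough_field_vector)
      show "f i j differentiable (at v)" for i j v using hd[unfolded M] by simp
      show "four_point (cball 0 R) a (max K1 K2) (f i j)" for i j
        using four_point_mono[OF K1[of "(i, j)"], of "max K1 K2"] by simp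
      show "four_point (cball 0 R) a (max K1 K2) (partial_deriv h (f i j))" for i j h
        using four_point_mono[OF K2[of "(h, i, j)"], of "max K1 K2"] by simp
    qed (use a in auto)
  qed
  ultimately show thesis using that by blast
qed

text \<open>On coarse grids the scheme may leave the ball where its error is controlled. A bound
  depending on the number of steps, but not on the nodes, suffices there: one step takes the ball of
  radius R into that of radius R + C X, with \<open>C\<close> depending on R.\<close>

lemma euler_bounded:
  fixes x :: "real \<Rightarrow> real^'d::finite" and f :: "'n::finite \<Rightarrow> 'd \<Rightarrow> real^'n \<Rightarrow> real"
  assumes bound: "\<And>R. \<exists>C\<ge>0. \<forall>u \<xi>. norm u \<le> R \<longrightarrow> norm (field_app f u \<xi>) \<le> C * norm \<xi>"
    and x: "\<And>s t. 0 \<le> s \<Longrightarrow> s \<le> t \<Longrightarrow> t \<le> T \<Longrightarrow> norm (x t - x s) \<le> X"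
  shows "\<exists>R. \<forall>\<tau>. (\<forall>j<k. 0 \<le> \<tau> j \<and> \<tau> j \<le> \<tau> (Suc j) \<and> \<tau> (Suc j) \<le> T) \<longrightarrow> norm (euler x f y0 \<tau> k) \<le> R"
proof (induction k)
  case (Suc k)
  then obtain R where R: "\<And>\<tau>. (\<forall>j<k. 0 \<le> \<tau> j \<and> \<tau> j \<le> \<tau> (Suc j) \<and> \<tau> (Suc j) \<le> T) \<Longrightarrow> norm (euler x f y0 \<tau> k) \<le> R"
    by blast
  obtain C where C: "0 \<le> C" "\<And>u \<xi>. norm u \<le> R \<Longrightarrow> norm (field_app f u \<xi>) \<le> C * norm \<xi>" using bound by blast
  have "norm (euler x f y0 \<tau> (Suc k)) \<le> R + C * X"
    if \<tau>: "\<forall>j<Suc k. 0 \<le> \<tau> j \<and> \<tau> j \<le> \<tau> (Suc j) \<and> \<tau> (Suc j) \<le> T" for \<tau>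
  proof -
    define u where "u = euler x f y0 \<tau> k"
    have u: "norm u \<le> R" unfolding u_def using \<tau> by (intro R) auto
    have "euler x f y0 \<tau> (Suc k) = u + field_app f u (x (\<tau> (Suc k)) - x (\<tau> k))"
      by (simp add: u_def field_app_def vec_eq_iff)
    moreover have "norm (field_app f u (x (\<tau> (Suc k)) - x (\<tau> k))) \<le> C * X"
      using \<tau> C(1) x[of "\<tau> k" "\<tau> (Suc k)"] by (intro order_trans[OF C(2)[OF u]] mult_left_mono) auto
    ultimately show ?thesis using u by (metis add_mono norm_triangle_le)
  qed
  then show ?case by blast
qed auto

section \<open>Fine and coarse grids combined\<close>

theorem theorem7p1:
  fixes \<alpha> \<beta> \<gamma> T c B :: real
    and x :: "real \<Rightarrow> real^'d::finite"
    and A :: "'d \<Rightarrow> 'd \<Rightarrow> real \<Rightarrow> real \<Rightarrow> real"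
    and f :: "'n::finite \<Rightarrow> 'd \<Rightarrow> real^'n \<Rightarrow> real"
    and y0 :: "real^'n"
    and y :: "real \<Rightarrow> real^'n"
  assumes "1/3 < \<alpha>" and "\<alpha> < 1/2" and "1 - \<alpha> < \<beta>" and "\<beta> < 2 * \<alpha>" and "0 < T"
    and "holder_on \<alpha> {0..T} x"
    and "\<And>i j s t u. 0 \<le> s \<Longrightarrow> s \<le> t \<Longrightarrow> t \<le> u \<Longrightarrow> u \<le> T \<Longrightarrow>
           A i j s u = A i j s t + A i j t u + (x t $ i - x s $ i) * (x u $ j - x t $ j)"
    and "\<And>i j s t. 0 \<le> s \<Longrightarrow> s \<le> t \<Longrightarrow> t \<le> T \<Longrightarrow>
           \<bar>A i j s t\<bar> \<le> c * (t - s) powr (2 * \<alpha>)"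
    and "\<And>i j (k::nat) (m::nat) h. 0 < k \<Longrightarrow> k < m \<Longrightarrow> 0 < h \<Longrightarrow> real m * h \<le> T \<Longrightarrow>
           \<bar>\<Sum>l = k..m - 1. A i j (real l * h) (real (l + 1) * h)\<bar>
             \<le> B * real (m - k) powr \<beta> * h powr (2 * \<alpha>)"
    and "1 / \<alpha> < \<gamma>" and "f \<in> C_space \<gamma>"
    and "is_solution T x A f y0 y"
  shows "\<exists>C. \<forall>t K. 0 < t \<and> t \<le> T \<and> 0 < (K::nat) \<longrightarrow>
           norm (euler x f y0 (\<lambda>k. real k * t / real K) K - y t)
             \<le> C * t powr (2 * \<alpha>) * real K powr (\<beta> - 2 * \<alpha>)"
proof -
  note \<alpha> = assms(1,2) and \<beta> = assms(3,4) and T = \<open>0 < T\<close> and chen = assms(7) and A = assms(8)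
    and sums = assms(9) and sol = assms(12)
  have \<beta>0: "0 < \<beta>" using \<alpha> \<beta> by linarith
  obtain X where X: "\<And>u v. u \<in> {0..T} \<Longrightarrow> v \<in> {0..T} \<Longrightarrow> dist (x u) (x v) \<le> X * dist u v powr \<alpha>"
    using assms(6) unfolding holder_on_def by blast
  have x: "norm (x t - x s) \<le> X * (t - s) powr \<alpha>" if "0 \<le> s" "s \<le> t" "t \<le> T" for s t
    using X[of t s] that by (simp add: dist_norm)
  define d where "d = real CARD('d)"
  have d0: "0 \<le> d" by (simp add: d_def)
  have matrix_le: "norm (\<chi> r j. p r j :: real^'d^'d) \<le> d * d * k" if "\<And>r j. \<bar>p r j\<bar> \<le> k" for p k
    using norm_matrix_le[of "\<chi> r j. p r j :: real^'d^'d" k] that by (simp add: d_def mult.assoc)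
  define C' where "C' = d * d * \<bar>c\<bar>"
  have area_le: "norm (area A s t) \<le> C' * ((t - s) powr \<alpha>)\<^sup>2" if st: "0 \<le> s" "s \<le> t" "t \<le> T" for s t
  proof -
    have "((t - s) powr \<alpha>)\<^sup>2 = (t - s) powr (2 * \<alpha>)"
      using st by (cases "t = s") (auto simp: powr_power mult.commute)
    moreover have "norm (area A s t) \<le> d * d * (\<bar>c\<bar> * (t - s) powr (2 * \<alpha>))"
      unfolding area_def
      by (rule matrix_le, rule order_trans[OF A[OF st]]) (simp add: mult_right_mono)
    ultimately show ?thesis by (simp add: C'_def mult.assoc)
  qed
  \<comment> \<open>The hypothesis on sums starts at k > 0. A sum from 0 has one additional term,
    bounded by the estimate on single areas, hence the summand \<bar>c\<bar>.\<close>
  define B' where "B' = d * d * (\<bar>B\<bar> + \<bar>c\<bar>)"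
  have C'0: "0 \<le> C'" and B'0: "0 \<le> B'" using d0 by (auto simp: C'_def B'_def)
  have sum_le: "norm (\<Sum>l\<in>{k..<m}. area A (real l * h) (real (Suc l) * h)) \<le> B' * ((real (m - k) * h) powr \<beta> * h powr (2 * \<alpha> - \<beta>))"
    if km: "k < m" and h: "0 < h" "real m * h \<le> T" for k m h
  proof -
    have eq: "(real (m - k) * h) powr \<beta> * h powr (2 * \<alpha> - \<beta>) = real (m - k) powr \<beta> * h powr (2 * \<alpha>)"
      using h by (simp add: powr_mult powr_add[symmetric] mult.assoc)
    define p where "p = (\<lambda>r j k. \<Sum>l\<in>{k..<m}. A r j (real l * h) (real (Suc l) * h))"
    \<comment> \<open>The index k' allows the first term to be split off when k = 0; k' = m is
      included because nothing may remain after that.\<close>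
    have pos: "\<bar>p r j k'\<bar> \<le> \<bar>B\<bar> * (real (m - k) powr \<beta> * h powr (2 * \<alpha>))" if k': "0 < k'" "k \<le> k'" "k' \<le> m" for r j k'
    proof (cases "k' = m")
      case False
      then have "{k'..<m} = {k'..m - 1}" using k' by auto
      then have "\<bar>p r j k'\<bar> \<le> B * real (m - k') powr \<beta> * h powr (2 * \<alpha>)"
        using sums[of k' m h r j] k' False h by (simp add: p_def)
      also have "\<dots> \<le> \<bar>B\<bar> * real (m - k) powr \<beta> * h powr (2 * \<alpha>)"
        using k' \<beta>0 by (intro mult_right_mono mult_mono powr_mono2) auto
      finally show ?thesis by (simp add: mult.assoc)
    qed (simp add: p_def)
    have "\<bar>p r j k\<bar> \<le> (\<bar>B\<bar> + \<bar>c\<bar>) * (real (m - k) powr \<beta> * h powr (2 * \<alpha>))" for r j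
    proof (cases "k = 0")
      case True
      have "1 * h \<le> real m * h" using h km by (intro mult_right_mono) auto
      then have mh: "h \<le> T" using h by linarith
      have "\<bar>A r j 0 h\<bar> \<le> c * h powr (2 * \<alpha>)" using A[of 0 h r j] h(1) mh by simp
      also have "\<dots> \<le> \<bar>c\<bar> * (real (m - k) powr \<beta> * h powr (2 * \<alpha>))"
      proof -
        have "1 powr \<beta> \<le> real (m - k) powr \<beta>" using km \<beta>0 by (intro powr_mono2) auto
        then have "1 * h powr (2 * \<alpha>) \<le> real (m - k) powr \<beta> * h powr (2 * \<alpha>)" by (intro mult_right_mono) auto
        then show ?thesis by (intro mult_mono) auto
      qed
      finally have "\<bar>A r j 0 h\<bar> \<le> \<bar>c\<bar> * (real (m - k) powr \<beta> * h powr (2 * \<alpha>))" .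
      moreover have "p r j k = A r j 0 h + p r j (Suc 0)"
        using km True by (simp add: p_def sum.atLeast_Suc_lessThan)
      moreover have "\<bar>p r j (Suc 0)\<bar> \<le> \<bar>B\<bar> * (real (m - k) powr \<beta> * h powr (2 * \<alpha>))"
        using pos[of "Suc 0"] km True by simp
      ultimately show ?thesis unfolding distrib_right by linarith
    next
      case False
      then have "\<bar>p r j k\<bar> \<le> \<bar>B\<bar> * (real (m - k) powr \<beta> * h powr (2 * \<alpha>))" using pos[of k] km by simp
      also have "\<dots> \<le> (\<bar>B\<bar> + \<bar>c\<bar>) * (real (m - k) powr \<beta> * h powr (2 * \<alpha>))" by (intro mult_right_mono) auto
      finally show ?thesis .
    qed
    then have "norm (\<chi> r j. p r j k :: real^'d^'d) \<le> d * d * ((\<bar>B\<bar> + \<bar>c\<bar>) * (real (m - k) powr \<beta> * h powr (2 * \<alpha>)))"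
      by (rule matrix_le)
    moreover have "(\<Sum>l\<in>{k..<m}. area A (real l * h) (real (Suc l) * h)) = (\<chi> r j. p r j k)"
      by (simp add: vec_eq_iff area_def p_def)
    ultimately show ?thesis unfolding eq by (simp add: B'_def mult.assoc)
  qed
  define X' where "X' = \<bar>X\<bar> * T powr \<alpha> + C' * (T powr \<alpha>)\<^sup>2"
  have x_bd: "norm (x t - x s) \<le> X'" and area_bd: "norm (area A s t) \<le> X'"
    if st: "0 \<le> s" "s \<le> t" "t \<le> T" for s t
  proof -
    have pw: "(t - s) powr \<alpha> \<le> T powr \<alpha>" using st \<alpha> by (intro powr_mono2) auto
    have "X * (t - s) powr \<alpha> \<le> \<bar>X\<bar> * T powr \<alpha>" using pw by (intro mult_mono) auto
    moreover have "C' * ((t - s) powr \<alpha>)\<^sup>2 \<le> C' * (T powr \<alpha>)\<^sup>2"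
      using pw C'0 by (intro mult_left_mono power_mono) auto
    moreover have "0 \<le> \<bar>X\<bar> * T powr \<alpha>" "0 \<le> C' * (T powr \<alpha>)\<^sup>2" using C'0 by auto
    ultimately show "norm (x t - x s) \<le> X'" "norm (area A s t) \<le> X'"
      using x[OF st] area_le[OF st] unfolding X'_def by linarith+
  qed
  obtain R where R: "\<And>t. 0 \<le> t \<Longrightarrow> t \<le> T \<Longrightarrow> norm (y t) \<le> R"
    using solution_bounded[OF sol x_bd area_bd] by blast
  obtain a where a: "1 < (2 + a) * \<alpha>"
    and field: "\<And>R. \<exists>C\<^sub>0. \<forall>C\<ge>C\<^sub>0. rough_field (cball 0 R) (field_app f) (field_deriv f) (field_app2 f) outer C a"
    using C_space_rough_field[OF assms(11) \<alpha> assms(10)] by metis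
  obtain C\<^sub>0 where C\<^sub>0: "\<And>C. C\<^sub>0 \<le> C \<Longrightarrow> rough_field (cball 0 (R + 1)) (field_app f) (field_deriv f) (field_app2 f) outer C a"
    using field by blast
  \<comment> \<open>\<open>C\<close> dominates the constants of the fields on the ball, of the path,
    and of the area after subtraction of its one-step sums, which is C' + B'.\<close>
  define C where "C = max C\<^sub>0 (max \<bar>X\<bar> (C' + B'))"
  interpret rough_field "cball 0 (R + 1)" "field_app f" "field_deriv f" "field_app2 f" outer C a
    by (rule C\<^sub>0) (simp add: C_def)
  obtain \<omega> where \<omega>: "mono_on {0..T} \<omega>" and
    small: "\<And>\<epsilon>. 0 < \<epsilon> \<Longrightarrow> \<exists>\<eta>>0. \<forall>s t. 0 \<le> s \<longrightarrow> s < t \<longrightarrow> t \<le> T \<longrightarrow> t - s < \<eta> \<longrightarrow>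
      norm (y t - y s - field_app f (y s) (x t - x s) - field_app2 f (y s) (area A s t)) \<le> \<epsilon> * (\<omega> t - \<omega> s)"
    using is_solution_defect_small[OF sol] by metis
  have "\<exists>\<Gamma> h\<^sub>0. 0 < h\<^sub>0 \<and> (\<forall>h K Z. 0 < h \<and> h \<le> h\<^sub>0 \<and> real K * h \<le> T \<and> Z 0 = y 0 \<and>
     (\<forall>k<K. Z (Suc k) = Z k + field_app f (Z k) (x (real (Suc k) * h) - x (real k * h))) \<longrightarrow>
     norm (Z K - y (real K * h)) \<le> \<Gamma> * ((real K * h) powr \<beta> * h powr (2 * \<alpha> - \<beta>)))"
  proof (rule euler_error[where A = "area A" and C' = C' and B = B' and R = R and \<omega> = \<omega>])
    show "area A s u = area A s t + area A t u + outer (x t - x s) (x u - x t)"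
      if "0 \<le> s" "s \<le> t" "t \<le> u" "u \<le> T" for s t u
      using chen[OF that] by (simp add: area_def outer_def vec_eq_iff)
    show "norm (x t - x s) \<le> C * (t - s) powr \<alpha>" if "0 \<le> s" "s \<le> t" "t \<le> T" for s t
    proof -
      have "X \<le> C" by (auto simp: C_def)
      then show ?thesis using x[OF that] by (meson mult_right_mono order_trans powr_ge_zero)
    qed
    show "C' + B' \<le> C" by (simp add: C_def)
    show "\<exists>\<eta>>0. \<forall>s t. 0 \<le> s \<longrightarrow> s < t \<longrightarrow> t \<le> T \<longrightarrow> t - s < \<eta> \<longrightarrow> norm (J y x (area A) s t) \<le> \<epsilon> * (\<omega> t - \<omega> s)"
      if "0 < \<epsilon>" for \<epsilon>
      unfolding J_def by (rule small[OF that])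
    show "1 < \<alpha> + \<beta>" using \<beta> by simp
  qed (fact \<alpha> \<beta> \<beta>0 a T area_le B'0 sum_le R \<omega> refl)+
  then obtain \<Gamma> h\<^sub>0 where h\<^sub>0: "0 < h\<^sub>0" and \<Gamma>: "\<And>h K Z. 0 < h \<Longrightarrow> h \<le> h\<^sub>0 \<Longrightarrow> real K * h \<le> T \<Longrightarrow> Z 0 = y 0 \<Longrightarrow>
     (\<And>k. k < K \<Longrightarrow> Z (Suc k) = Z k + field_app f (Z k) (x (real (Suc k) * h) - x (real k * h))) \<Longrightarrow>
     norm (Z K - y (real K * h)) \<le> \<Gamma> * ((real K * h) powr \<beta> * h powr (2 * \<alpha> - \<beta>))"
    by blast
  \<comment> \<open>A mesh above the threshold leaves at most this many steps, since K h = t \<le>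
    T.\<close>
  define K\<^sub>0 where "K\<^sub>0 = T / h\<^sub>0"
  have "\<exists>R. \<forall>\<tau>. (\<forall>j<k. 0 \<le> \<tau> j \<and> \<tau> j \<le> \<tau> (Suc j) \<and> \<tau> (Suc j) \<le> T) \<longrightarrow> norm (euler x f y0 \<tau> k) \<le> R" for k
  proof (rule euler_bounded[OF _ x_bd])
    fix R
    obtain C\<^sub>1 where "\<And>C. C\<^sub>1 \<le> C \<Longrightarrow> rough_field (cball 0 R) (field_app f) (field_deriv f) (field_app2 f) outer C a"
      using field by blast
    from this[of "max 0 C\<^sub>1"] show "\<exists>C\<ge>0. \<forall>u \<xi>. norm u \<le> R \<longrightarrow> norm (field_app f u \<xi>) \<le> C * norm \<xi>"
      by (intro exI[of _ "max 0 C\<^sub>1"]) (auto dest: rough_field.F_bound)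
  qed
  then obtain Re where Re: "\<And>k \<tau>. (\<And>j. j < k \<Longrightarrow> 0 \<le> \<tau> j \<and> \<tau> j \<le> \<tau> (Suc j) \<and> \<tau> (Suc j) \<le> T) \<Longrightarrow> norm (euler x f y0 \<tau> k) \<le> Re k"
    by metis
  define E where "E = (\<Sum>k\<le>nat \<lceil>K\<^sub>0\<rceil>. \<bar>Re k\<bar>) + \<bar>R\<bar>"
  \<comment> \<open>In the coarse case \<open>t\<close> is bounded below by the threshold mesh and
    \<open>K\<close> above by the largest number of steps. As \<beta> - 2\<alpha> is negative,
    \<open>D\<close> is then a lower bound for t^(2\<alpha>) K^(\<beta> - 2\<alpha>), and
    \<open>E / D\<close> is a valid constant.\<close>
  define D where "D = h\<^sub>0 powr (2 * \<alpha>) * K\<^sub>0 powr (\<beta> - 2 * \<alpha>)"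
  have K\<^sub>0: "0 < K\<^sub>0" using T h\<^sub>0 by (simp add: K\<^sub>0_def)
  have D0: "0 < D" using h\<^sub>0 K\<^sub>0 by (simp add: D_def)
  have E0: "0 \<le> E" by (simp add: E_def sum_nonneg)
  have "norm (euler x f y0 (\<lambda>k. real k * t / real K) K - y t)
      \<le> max \<Gamma> (E / D) * t powr (2 * \<alpha>) * real K powr (\<beta> - 2 * \<alpha>)"
    if t: "0 < t" "t \<le> T" and K: "0 < K" for t K
  proof -
    define \<tau> where "\<tau> = (\<lambda>k. real k * t / real K)"
    define h where "h = t / real K"
    have h: "0 < h" "real K * h = t" "\<And>k. \<tau> k = real k * h" using t K by (auto simp: h_def \<tau>_def)
    have goal: "norm (euler x f y0 \<tau> K - y t) \<le> max \<Gamma> (E / D) * (t powr (2 * \<alpha>) * real K powr (\<beta> - 2 * \<alpha>))"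
    proof (cases "h \<le> h\<^sub>0")
      case True
      have "norm (euler x f y0 \<tau> K - y (real K * h)) \<le> \<Gamma> * ((real K * h) powr \<beta> * h powr (2 * \<alpha> - \<beta>))"
      proof (rule \<Gamma>[OF h(1) True])
        show "real K * h \<le> T" using h t by simp
        show "euler x f y0 \<tau> 0 = y 0" using sol by (simp add: is_solution_def)
        show "euler x f y0 \<tau> (Suc k) = euler x f y0 \<tau> k + field_app f (euler x f y0 \<tau> k) (x (real (Suc k) * h) - x (real k * h))" for k
          by (simp add: field_app_def vec_eq_iff h(3))
      qed
      \<comment> \<open>Substituting h = t/K gives the powers of \<open>t\<close> and
        \<open>K\<close> their final form: \<beta> + (2\<alpha> - \<beta>) = 2\<alpha> for
        \<open>t\<close>, and the sign of 2\<alpha> - \<beta> is reversed for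
        \<open>K\<close>.\<close>
      also have "(real K * h) powr \<beta> * h powr (2 * \<alpha> - \<beta>) = t powr (2 * \<alpha>) * real K powr (\<beta> - 2 * \<alpha>)"
      proof -
        have "h powr (2 * \<alpha> - \<beta>) = t powr (2 * \<alpha> - \<beta>) * real K powr (\<beta> - 2 * \<alpha>)"
          using t K powr_minus_divide[of "real K" "2 * \<alpha> - \<beta>"] by (simp add: h_def powr_divide)
        then show ?thesis using t by (simp add: h(2) powr_add[symmetric] mult.assoc[symmetric])
      qed
      also have "\<Gamma> * (t powr (2 * \<alpha>) * real K powr (\<beta> - 2 * \<alpha>)) \<le> max \<Gamma> (E / D) * (t powr (2 * \<alpha>) * real K powr (\<beta> - 2 * \<alpha>))"
        by (intro mult_right_mono) auto
      finally show ?thesis by (simp only: h(2))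
    next
      case False
      then have hh: "h\<^sub>0 < h" by simp
      have "1 * h \<le> real K * h" using h K by (intro mult_right_mono) auto
      then have th: "h\<^sub>0 \<le> t" using hh h(2) by linarith
      have "real K * h\<^sub>0 \<le> T" using mult_left_mono[of h\<^sub>0 h "real K"] hh h t by simp
      then have KK: "real K \<le> K\<^sub>0" using h\<^sub>0 by (simp add: K\<^sub>0_def field_simps)
      have "\<bar>Re K\<bar> \<le> (\<Sum>k\<le>nat \<lceil>K\<^sub>0\<rceil>. \<bar>Re k\<bar>)"
      proof (rule member_le_sum)
        show "K \<in> {..nat \<lceil>K\<^sub>0\<rceil>}" using KK by (simp add: le_nat_iff) linarith
      qed auto
      moreover have "norm (euler x f y0 \<tau> K) \<le> Re K"
      proof (rule Re)
        fix j assume j: "j < K"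
        have "real (Suc j) * h \<le> real K * h" using j h by (intro mult_right_mono) auto
        then show "0 \<le> \<tau> j \<and> \<tau> j \<le> \<tau> (Suc j) \<and> \<tau> (Suc j) \<le> T"
          using h t by (simp add: algebra_simps)
      qed
      moreover have "norm (y t) \<le> R" using R t by simp
      ultimately have "norm (euler x f y0 \<tau> K - y t) \<le> E"
        unfolding E_def using norm_triangle_ineq4[of "euler x f y0 \<tau> K" "y t"] by linarith
      also have "E = E / D * D" using D0 by simp
      also have "\<dots> \<le> E / D * (t powr (2 * \<alpha>) * real K powr (\<beta> - 2 * \<alpha>))"
      proof -
        have "h\<^sub>0 powr (2 * \<alpha>) \<le> t powr (2 * \<alpha>)" using th h\<^sub>0 \<alpha> by (intro powr_mono2) auto
        moreover have "K\<^sub>0 powr (\<beta> - 2 * \<alpha>) \<le> real K powr (\<beta> - 2 * \<alpha>)" using KK K \<beta> by (intro powr_mono2') auto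
        ultimately show ?thesis unfolding D_def[symmetric] using E0 D0
          by (intro mult_left_mono) (auto simp: D_def intro!: mult_mono)
      qed
      also have "\<dots> \<le> max \<Gamma> (E / D) * (t powr (2 * \<alpha>) * real K powr (\<beta> - 2 * \<alpha>))"
        by (intro mult_right_mono) auto
      finally show ?thesis .
    qed
    then show ?thesis by (simp add: \<tau>_def mult.assoc)
  qed
  then show ?thesis by blast
qed

end
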